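(* Let $\beta>0$ and $\delta\in\mathbb{C}$ with $\mathrm{Re}(\delta)>-\frac13$. Let $$X_n^{CJ,\beta,\delta}:=\log|Z_n^{\beta,\delta}|-\frac{\delta+\bar\delta}\beta\log n.$$ Then, as $n\to\infty$, $(X_n^{CJ,\beta,\delta})_{n\in\mathbb{N}}$ converges mod-Gaussian on the strip $S_{1/3}=\{z\in\mathbb{C}:\mathrm{Re}(z)>-\frac13\}$ with parameters $t_n^\beta=\frac{\log n}{2\beta}$ and limiting function $\psi^{CJ,\beta,\delta}$ satisfying $$\begin{aligned}\log\psi^{CJ,\beta,\delta}(z)=\;&\Upsilon\left(1+\delta-\tfrac\beta2\right)-\Upsilon\left(1+\delta+\tfrac z2-\tfrac\beta2\right)+\Upsilon\left(1+\bar\delta-\tfrac\beta2\right)-\Upsilon\left(1+\bar\delta+\tfrac z2-\tfrac\beta2\right)\\&-\Upsilon\left(1+\delta+\bar\delta-\tfrac\beta2\right)+\Upsilon\left(1+\delta+\bar\delta+z-\tfrac\beta2\right).\end{aligned}$$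
   Context: $\beta$-circular Jacobi ensemble: $Z_n^{\beta,\delta}=\det(\mathrm{Id}_n-W_n^{CJ,\beta,\delta})=\prod_{k=1}^n(1-e^{i\theta_k})$, where the eigenangles $(\theta_1,\dots,\theta_n)\in[0,2\pi)^n$ of the random $n\times n$ unitary matrix $W_n^{CJ,\beta,\delta}$ have density proportional to $\prod_{1\le k<j\le n}|e^{i\theta_k}-e^{i\theta_j}|^\beta\prod_{k=1}^n(1-e^{-i\theta_k})^\delta(1-e^{i\theta_k})^{\bar\delta}$ (principal branches). For $\mathrm{Re}(w)>-\beta/2$, $$\Upsilon(w)=\frac\beta2\log G\left(\frac{2w}\beta+1\right)-\left(w-\frac12\right)\log\Gamma\left(\frac{2w}\beta+1\right)+\int_0^\infty\frac{\varphi(s)(e^{-sw}-1)}{e^{s\beta/2}-1}ds+\frac{w^2}\beta+\frac w2,$$ $\varphi(s)=\left(\frac12-\frac1s+\frac1{e^s-1}\right)\frac1s$, where $G$ is the Barnes $G$-function (entire, $G(1)=1$, $G(z+1)=G(z)\Gamma(z)$, $G(1+z)=(2\pi)^{z/2}e^{-(z+1)z/2}\prod_{j\ge1}\{(1+\frac zj)^j(1+\frac1j)^{z^2/2}e^{-z}\}$); $\log G,\log\Gamma$ are the analytic branches on the right half-plane that are real on $(0,\infty)$. Mod-Gaussian convergence: real random variables $X_n$ with moment generating functions existing on a strip $S=\{c<\mathrm{Re}(z)<d\}$ ($-\infty\le c<0<d\le\infty$) converge mod-Gaussian on $S$ with parameters $t_n\to+\infty$ and limiting function $\psi:S\to\mathbb{C}$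 if $\mathbb{E}[e^{zX_n}]e^{-t_nz^2/2}\to\psi(z)$ locally uniformly on $S$.
   Formalization: The parameters are taken as t_n = (log n)/β instead of (log n)/(2β): with the normalization e^{-t_n z²/2} the printed value fails, e.g. for β=2, δ=0, where E|Z_n|^z grows like n^{z²/4}, so the normalized moment generating function diverges for real z≠0. *)

theory Defs
  imports
    "HOL-Probability.Probability"
    "HOL-Complex_Analysis.Complex_Analysis"
    "Jordan_Normal_Form.Schur_Decomposition"
begin

definition strip :: "ereal \<Rightarrow> ereal \<Rightarrow> complex set" where
  "strip c d = {z. c < ereal (Re z) \<and> ereal (Re z) < d}"

text \<open>
  Sequences are indexed by \<open>n \<ge> 1\<close>, and each \<open>X n\<close> may live on its own probability space \<open>M n\<close>.
  On the open strip, locally uniform convergence is uniform convergence on compact subsets.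
\<close>

definition mod_gaussian_convergent ::
  "(nat \<Rightarrow> 'a measure) \<Rightarrow> (nat \<Rightarrow> 'a \<Rightarrow> real) \<Rightarrow> ereal \<Rightarrow> ereal \<Rightarrow> (nat \<Rightarrow> real)
    \<Rightarrow> (complex \<Rightarrow> complex) \<Rightarrow> bool"
where
  "mod_gaussian_convergent M X c d t \<psi> \<longleftrightarrow>
     c < 0 \<and> 0 < d \<and>
     (\<forall>n\<ge>1. prob_space (M n) \<and> X n \<in> borel_measurable (M n)) \<and>
     (\<forall>n\<ge>1. \<forall>z\<in>strip c d. integrable (M n) (\<lambda>\<omega>. exp (z * complex_of_real (X n \<omega>)))) \<and>
     filterlim t at_top sequentially \<and>
     (\<forall>K. compact K \<and> K \<subseteq> strip c d \<longrightarrow>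
        uniform_limit K
          (\<lambda>n z. (\<integral>\<omega>. exp (z * complex_of_real (X n \<omega>)) \<partial>M n) * exp (- of_real (t n) * z\<^sup>2 / 2))
          \<psi> sequentially)"

text \<open>
  For \<open>\<theta> \<in> [0,2\<pi>)\<^sup>n\<close> the product below is a nonnegative real number, since its \<open>k\<close>-th factors
  are conjugate to each other; \<open>Re\<close> only changes the type.
\<close>

definition circular_jacobi_weight :: "real \<Rightarrow> complex \<Rightarrow> nat \<Rightarrow> (nat \<Rightarrow> real) \<Rightarrow> real" where
  "circular_jacobi_weight \<beta> \<delta> n \<theta> =
     (\<Prod>j<n. \<Prod>k<j. cmod (cis (\<theta> k) - cis (\<theta> j)) powr \<beta>) *
     Re (\<Prod>k<n. (1 - cis (- \<theta> k)) powr \<delta> * (1 - cis (\<theta> k)) powr cnj \<delta>)"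

text \<open>
  \<open>W\<close> is a random \<open>n \<times> n\<close> unitary matrix on the probability space \<open>M\<close>, and \<open>\<theta>\<close> is the vector of its
  eigenangles (labelled by \<open>{..<n}\<close>, with multiplicity). The proportionality constant \<open>C\<close> is
  determined by the total mass being 1.
\<close>

definition circular_jacobi_ensemble ::
  "real \<Rightarrow> complex \<Rightarrow> nat \<Rightarrow> 'a measure \<Rightarrow> ('a \<Rightarrow> complex mat) \<Rightarrow> ('a \<Rightarrow> nat \<Rightarrow> real) \<Rightarrow> bool"
where
  "circular_jacobi_ensemble \<beta> \<delta> n M W \<theta> \<longleftrightarrow>
     prob_space M \<and>
     (\<forall>i<n. \<forall>j<n. (\<lambda>\<omega>. W \<omega> $$ (i, j)) \<in> borel_measurable M) \<and>
     (\<forall>\<omega>\<in>space M. W \<omega> \<in> carrier_mat n n \<and> mat_adjoint (W \<omega>) * W \<omega> = 1\<^sub>m n \<and>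
        char_poly (W \<omega>) = (\<Prod>k<n. [:- cis (\<theta> \<omega> k), 1:])) \<and>
     (\<exists>C. distributed M (\<Pi>\<^sub>M k\<in>{..<n}. restrict_space lborel {0..<2 * pi}) \<theta>
        (\<lambda>x. ennreal (C * circular_jacobi_weight \<beta> \<delta> n x)))"

text \<open>Weierstrass product of the Barnes function, with \<open>j\<close> shifted to start at 0.\<close>

definition barnes_G :: "complex \<Rightarrow> complex" where
  "barnes_G x = (let z = x - 1 in
     of_real (2 * pi) powr (z / 2) * exp (- (z + 1) * z / 2) *
     (\<Prod>j. (1 + z / of_nat (Suc j)) ^ Suc j * of_real (1 + 1 / real (Suc j)) powr (z\<^sup>2 / 2) * exp (- z)))"

text \<open>
  The analytic branch of the logarithm of \<open>barnes_G\<close> on the right half-plane that is real on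
  \<open>(0,\<infinity>)\<close>; its values there are unique because \<open>barnes_G\<close> is positive on \<open>(0,\<infinity>)\<close>. The values outside
  the right half-plane are irrelevant. The library's \<open>ln_Gamma\<close> is the corresponding branch for
  \<open>Gamma\<close>.
\<close>

definition ln_barnes_G :: "complex \<Rightarrow> complex" where
  "ln_barnes_G = (SOME L. L holomorphic_on {z. 0 < Re z} \<and>
     (\<forall>z. 0 < Re z \<longrightarrow> exp (L z) = barnes_G z) \<and>
     (\<forall>x::real. 0 < x \<longrightarrow> L (of_real x) \<in> \<real>))"

definition binet_phi :: "real \<Rightarrow> real" where
  "binet_phi s = (1 / 2 - 1 / s + 1 / (exp s - 1)) * (1 / s)"

definition Upsilon :: "real \<Rightarrow> complex \<Rightarrow> complex" where
  "Upsilon \<beta> w =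
     of_real (\<beta> / 2) * ln_barnes_G (2 * w / of_real \<beta> + 1)
     - (w - 1 / 2) * ln_Gamma (2 * w / of_real \<beta> + 1)
     + (LBINT s:{0<..}. of_real (binet_phi s) * (exp (- of_real s * w) - 1) / of_real (exp (s * \<beta> / 2) - 1))
     + w\<^sup>2 / of_real \<beta> + w / 2"

text \<open>
  The exponent is analytic on the strip and vanishes at 0, so it is the logarithm of this function.
\<close>

definition circular_jacobi_psi :: "real \<Rightarrow> complex \<Rightarrow> complex \<Rightarrow> complex" where
  "circular_jacobi_psi \<beta> \<delta> z = (let b = of_real (\<beta> / 2) in exp (
       Upsilon \<beta> (1 + \<delta> - b) - Upsilon \<beta> (1 + \<delta> + z / 2 - b)
     + Upsilon \<beta> (1 + cnj \<delta> - b) - Upsilon \<beta> (1 + cnj \<delta> + z / 2 - b)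
     - Upsilon \<beta> (1 + \<delta> + cnj \<delta> - b) + Upsilon \<beta> (1 + \<delta> + cnj \<delta> + z - b)))"

text \<open>
  Pitfall: with the normalization \<open>exp (- t n * z\<^sup>2 / 2)\<close> of \<open>mod_gaussian_convergent\<close>, the parameter for the characteristic
  polynomial is \<open>ln n / \<beta>\<close>, the asymptotic variance of \<open>ln \<bar>Z\<bar>\<close>. (For \<open>\<beta> = 2\<close>, \<open>\<delta> = 0\<close> the
  moment of order \<open>z\<close> of \<open>\<bar>Z\<bar>\<close> grows like \<open>n powr (z\<^sup>2 / 4)\<close>.) The source prints \<open>ln n / (2 * \<beta>)\<close>,
  which is the coefficient of \<open>z\<^sup>2\<close> in the exponent; with it the normalized moment
  generating function would have no limit for real \<open>z \<noteq> 0\<close>.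
\<close>

end

theory Submission
  imports Defs "HOL-Real_Asymp.Real_Asymp"
begin

text \<open>
  The moment of order \<open>z\<close> of \<open>\<bar>Z\<bar>\<close> is, up to normalization, the Morris integral of
  \<open>\<Prod> (1 - cis (- \<theta> k)) powr a * (1 - cis (\<theta> k)) powr b\<close> against the Vandermonde weight with exponent \<open>2 l\<close>, where
  \<open>l = \<beta> / 2\<close>, at \<open>a = \<delta> + z / 2\<close> and \<open>b = cnj \<delta> + z / 2\<close>. The proof evaluates this integral up to a factor that does
  not depend on \<open>z\<close>, and then determines the asymptotics of the resulting product of gamma functions.

  For \<open>l \<ge> 1\<close>, Aomoto's integration by parts in one angle relates the integrals of the weight times
  \<open>\<Prod>i<r. 1 - cis (\<theta> i)\<close> for successive \<open>r\<close> (\<open>aomoto_step\<close>). Chaining these relations gives the effect of raising \<open>b\<close> by 1,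
  and complex conjugation that of raising \<open>a\<close>; analytic continuation in \<open>l\<close> extends the result to all \<open>l > 0\<close>
  (\<open>morris_shift_both\<close>). Along the line \<open>a + b = s\<close> with \<open>a - b\<close> fixed, the Morris integral and a product of gamma
  functions thus satisfy the same recurrence under \<open>s \<mapsto> s + 2\<close>, and their quotient is periodic. It is constant,
  because the integral divided by \<open>2 powr (n s)\<close> is monotone in \<open>s\<close> and hardly changes over a period when \<open>s\<close> is large
  (\<open>line_ratio_constant\<close>). The identity theorem extends this to complex \<open>s\<close> (\<open>line_morris_eq_gamma\<close>).

  The logarithm of the moment generating function is therefore an alternating sum of the values of
  \<open>\<Sum>k=1..n. ln_Gamma (l k + w)\<close> at six points \<open>w\<close>. Constant and linear functions of \<open>w\<close> cancel in this alternating sum,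
  so each sum is needed only modulo affine functions of \<open>w\<close>. For the same reason Binet's formula is needed only up to
  an affine function, in which form it follows from the Laplace integral of the trigamma function
  (\<open>binet_up_to_affine\<close>). After summation, the main term of Binet's formula yields the logarithms of the Weierstrass
  products of the Barnes and gamma functions, and the Binet integrals form a geometric series whose limit is the
  integral in \<open>Upsilon\<close>. Hence each sum is \<open>w\<^sup>2 / \<beta> * ln n + Upsilon \<beta> w\<close> plus an affine function and a term that tends
  to 0 locally uniformly (\<open>ln_Gamma_sum_asymptotics\<close>). The six squares add up to \<open>(\<delta> + cnj \<delta>) z + z\<^sup>2 / 2\<close>, which is
  exactly what the centering and the Gaussian factor remove.
\<close>

section \<open>Moment generating functions are holomorphic\<close>

lemma norm_exp_taylor_le:
  fixes u :: complex
  shows "norm (exp u - (\<Sum>k\<le>n. u ^ k / fact k)) \<le> exp (norm u) * norm u ^ Suc n / fact n"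
proof -
  have "norm (exp u - (\<Sum>k\<le>n. exp 0 * (u - 0) ^ k / fact k)) \<le> exp (norm u) * norm (u - 0) ^ Suc n / fact n"
  proof (rule complex_Taylor[where S = "closed_segment 0 u" and f = "\<lambda>_. exp"])
    show "(exp has_field_derivative exp x) (at x within closed_segment 0 u)" for x :: complex
      by (rule DERIV_subset[OF DERIV_exp]) auto
    fix x assume "x \<in> closed_segment 0 u"
    then have "norm x \<le> norm u"
      using segment_bound1 by fastforce
    then show "norm (exp x) \<le> exp (norm u)"
      using complex_Re_le_cmod[of x] by simp
  qed auto
  then show ?thesis by simp
qed

lemma norm_exp_minus_1_le: "norm (exp u - 1 :: complex) \<le> norm u * exp (norm u)"
  using norm_exp_taylor_le[of u 0] by (simp add: mult.commute)

lemma norm_exp_taylor2_le: "norm (exp u - 1 - u :: complex) \<le> (norm u)\<^sup>2 * exp (norm u)"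
  using norm_exp_taylor_le[of u 1] by (simp add: power2_eq_square diff_diff_eq mult_ac)

lemma has_field_derivative_from_quadratic_remainder:
  fixes F :: "complex \<Rightarrow> complex"
  assumes "e > 0" and "\<And>h. norm h < e \<Longrightarrow> norm (F (z + h) - F z - D * h) \<le> C * (norm h)\<^sup>2"
  shows "(F has_field_derivative D) (at z)"
  unfolding has_field_derivative_def has_derivative_at
proof (intro conjI)
  show "bounded_linear ((*) D)" by (rule bounded_linear_mult_right)
  have "((\<lambda>h::complex. C * norm h) \<longlongrightarrow> C * norm (0::complex)) (at 0)"
    by (rule tendsto_mult_left[OF tendsto_norm[OF tendsto_ident_at]])
  then have lim: "((\<lambda>h::complex. C * norm h) \<longlongrightarrow> 0) (at 0)" by simp
  show "(\<lambda>h. norm (F (z + h) - F z - D * h) / norm h) \<midarrow>0\<rightarrow> 0"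
  proof (rule Lim_null_comparison[OF _ lim])
    have "eventually (\<lambda>h. norm h < e \<and> h \<noteq> 0) (at (0::complex))"
      unfolding eventually_at using assms(1) by (auto simp: dist_norm intro!: exI[of _ e])
    then show "\<forall>\<^sub>F h in at 0. norm (norm (F (z + h) - F z - D * h) / norm h) \<le> C * norm h"
    proof eventually_elim
      case (elim h)
      then show ?case
        using assms(2)[of h] by (simp add: field_simps power2_eq_square)
    qed
  qed
qed


context
  fixes M :: "'a measure" and X :: "'a \<Rightarrow> real" and g :: "'a \<Rightarrow> complex" and c :: real
  assumes X [measurable]: "X \<in> borel_measurable M" and g [measurable]: "g \<in> borel_measurable M"
    and int: "\<And>x. x > c \<Longrightarrow> integrable M (\<lambda>\<omega>. exp (x * X \<omega>) * norm (g \<omega>))"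
begin

text \<open>
  The hypothesis holds on an open half-line of exponents. Shifting the exponent a little to either side
  therefore leaves room for a polynomial factor and for a factor growing like an exponential of \<open>\<bar>X\<bar>\<close>.
\<close>

lemma abs_power_exp_integrable:
  assumes "x > c"
  shows "\<exists>e>0. integrable M (\<lambda>\<omega>. \<bar>X \<omega>\<bar> ^ n * exp (x * X \<omega> + e * \<bar>X \<omega>\<bar>) * norm (g \<omega>))"
proof (intro exI conjI)
  \<comment> \<open>A quarter of the distance to \<open>c\<close>, since the exponent is moved by \<open>2 e\<close> below.\<close>
  define e where "e = (x - c) / 4"
  show e: "e > 0" using assms by (simp add: e_def)
  have i: "integrable M (\<lambda>\<omega>. fact n / e ^ n * (exp ((x - 2 * e) * X \<omega>) * norm (g \<omega>) + exp ((x + 2 * e) * X \<omega>) * norm (g \<omega>)))"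
    using assms by (intro integrable_mult_right Bochner_Integration.integrable_add int) (simp_all add: e_def field_simps)
  show "integrable M (\<lambda>\<omega>. \<bar>X \<omega>\<bar> ^ n * exp (x * X \<omega> + e * \<bar>X \<omega>\<bar>) * norm (g \<omega>))"
  proof (rule Bochner_Integration.integrable_bound[OF i])
    have *: "\<bar>t\<bar> ^ n * exp (x * t + e * \<bar>t\<bar>) \<le> fact n / e ^ n * (exp ((x - 2 * e) * t) + exp ((x + 2 * e) * t))" for t :: real
    proof -
      have "(\<Sum>k\<in>{n}. inverse (fact k) * (e * \<bar>t\<bar>) ^ k) \<le> (\<Sum>k. inverse (fact k) * (e * \<bar>t\<bar>) ^ k)"
        using e by (intro sum_le_suminf summable_exp) auto
      also have "\<dots> = exp (e * \<bar>t\<bar>)"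
        by (simp add: exp_def)
      finally have "\<bar>t\<bar> ^ n \<le> fact n / e ^ n * exp (e * \<bar>t\<bar>)"
        using e by (simp add: field_simps power_mult_distrib)
      then have "\<bar>t\<bar> ^ n * exp (x * t + e * \<bar>t\<bar>) \<le> fact n / e ^ n * exp (e * \<bar>t\<bar>) * exp (x * t + e * \<bar>t\<bar>)"
        by (rule mult_right_mono) simp
      also have "\<dots> = fact n / e ^ n * exp (x * t + 2 * e * \<bar>t\<bar>)"
        by (simp add: mult_exp_exp algebra_simps)
      also have "\<dots> \<le> fact n / e ^ n * (exp ((x - 2 * e) * t) + exp ((x + 2 * e) * t))"
      proof (rule mult_left_mono)
        show "exp (x * t + 2 * e * \<bar>t\<bar>) \<le> exp ((x - 2 * e) * t) + exp ((x + 2 * e) * t)"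
          by (cases "t \<ge> 0") (simp_all add: algebra_simps)
      qed (use e in simp)
      finally show ?thesis .
    qed
    have "\<bar>X \<omega>\<bar> ^ n * exp (x * X \<omega> + e * \<bar>X \<omega>\<bar>) * norm (g \<omega>)
        \<le> fact n / e ^ n * (exp ((x - 2 * e) * X \<omega>) + exp ((x + 2 * e) * X \<omega>)) * norm (g \<omega>)" for \<omega>
      by (rule mult_right_mono[OF *]) simp
    then show "AE \<omega> in M. norm (\<bar>X \<omega>\<bar> ^ n * exp (x * X \<omega> + e * \<bar>X \<omega>\<bar>) * norm (g \<omega>)) \<le>
        norm (fact n / e ^ n * (exp ((x - 2 * e) * X \<omega>) * norm (g \<omega>) + exp ((x + 2 * e) * X \<omega>) * norm (g \<omega>)))"
      using e by (intro AE_I2) (simp add: algebra_simps abs_mult)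
  qed measurable
qed

lemma power_exp_integrable:
  assumes "Re z > c"
  shows "integrable M (\<lambda>\<omega>. of_real (X \<omega>) ^ n * exp (z * of_real (X \<omega>)) * g \<omega>)"
proof -
  obtain e where e: "e > 0" and i: "integrable M (\<lambda>\<omega>. \<bar>X \<omega>\<bar> ^ n * exp (Re z * X \<omega> + e * \<bar>X \<omega>\<bar>) * norm (g \<omega>))"
    using abs_power_exp_integrable[OF assms] by blast
  show ?thesis
    by (rule Bochner_Integration.integrable_bound[OF i])
       (use e in \<open>auto intro!: AE_I2 mult_right_mono mult_left_mono simp: norm_mult norm_power abs_mult\<close>)
qed

text \<open>
  The second-order remainder of the exponential is at most \<open>\<bar>h\<bar>\<^sup>2\<close> times a fixed integrable function, so the
  remainder of the integral is quadratic in \<open>h\<close> as well. This is applied to the characteristic polynomial, to the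
  coupling constant of the Morris integral, and to Laplace transforms.
\<close>

lemma mgf_has_field_derivative:
  assumes z: "Re z > c"
  shows "((\<lambda>z. \<integral>\<omega>. exp (z * of_real (X \<omega>)) * g \<omega> \<partial>M) has_field_derivative
          (\<integral>\<omega>. of_real (X \<omega>) * exp (z * of_real (X \<omega>)) * g \<omega> \<partial>M)) (at z)"
proof -
  obtain e where e: "e > 0" and i: "integrable M (\<lambda>\<omega>. \<bar>X \<omega>\<bar> ^ 2 * exp (Re z * X \<omega> + e * \<bar>X \<omega>\<bar>) * norm (g \<omega>))"
    using abs_power_exp_integrable[OF z] by blast
  define C where "C = (\<integral>\<omega>. \<bar>X \<omega>\<bar> ^ 2 * exp (Re z * X \<omega> + e * \<bar>X \<omega>\<bar>) * norm (g \<omega>) \<partial>M)"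
  define d where "d = min e (Re z - c)"
  show ?thesis
  proof (rule has_field_derivative_from_quadratic_remainder[where e = d and C = C])
    show "d > 0" using e z by (simp add: d_def)
    fix h :: complex assume h: "norm h < d"
    have "Re (z + h) > c"
      using h abs_Re_le_cmod[of h] unfolding d_def plus_complex.sel by linarith
    note i1 = power_exp_integrable[OF this, of 0] power_exp_integrable[OF z, of 0] power_exp_integrable[OF z, of 1]
    note i1 = i1[simplified]
    have "norm ((\<integral>\<omega>. exp ((z + h) * of_real (X \<omega>)) * g \<omega> \<partial>M) - (\<integral>\<omega>. exp (z * of_real (X \<omega>)) * g \<omega> \<partial>M)
         - (\<integral>\<omega>. of_real (X \<omega>) * exp (z * of_real (X \<omega>)) * g \<omega> \<partial>M) * h)
       = norm (\<integral>\<omega>. exp ((z + h) * of_real (X \<omega>)) * g \<omega> - exp (z * of_real (X \<omega>)) * g \<omega>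
         - of_real (X \<omega>) * exp (z * of_real (X \<omega>)) * g \<omega> * h \<partial>M)"
      using i1 by simp
    also have "\<dots> \<le> (\<integral>\<omega>. (norm h)\<^sup>2 * (\<bar>X \<omega>\<bar> ^ 2 * exp (Re z * X \<omega> + e * \<bar>X \<omega>\<bar>) * norm (g \<omega>)) \<partial>M)"
    proof (rule order.trans[OF integral_norm_bound], rule integral_mono)
      fix \<omega>
      let ?u = "h * of_real (X \<omega>)"
      have "exp ((z + h) * of_real (X \<omega>)) * g \<omega> - exp (z * of_real (X \<omega>)) * g \<omega>
         - of_real (X \<omega>) * exp (z * of_real (X \<omega>)) * g \<omega> * h = exp (z * of_real (X \<omega>)) * g \<omega> * (exp ?u - 1 - ?u)"
        by (simp add: algebra_simps exp_add)
      moreover have "norm \<dots> = exp (Re z * X \<omega>) * norm (g \<omega>) * norm (exp ?u - 1 - ?u)"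
        by (simp add: norm_mult)
      moreover have "\<dots> \<le> exp (Re z * X \<omega>) * norm (g \<omega>) * ((norm ?u)\<^sup>2 * exp (e * \<bar>X \<omega>\<bar>))"
      proof (intro mult_left_mono)
        have "norm ?u \<le> e * \<bar>X \<omega>\<bar>"
          using h by (auto simp: norm_mult d_def intro!: mult_right_mono)
        then have "(norm ?u)\<^sup>2 * exp (norm ?u) \<le> (norm ?u)\<^sup>2 * exp (e * \<bar>X \<omega>\<bar>)"
          by (intro mult_left_mono) auto
        then show "norm (exp ?u - 1 - ?u) \<le> (norm ?u)\<^sup>2 * exp (e * \<bar>X \<omega>\<bar>)"
          using norm_exp_taylor2_le[of ?u] by linarith
      qed auto
      moreover have "\<dots> = (norm h)\<^sup>2 * (\<bar>X \<omega>\<bar> ^ 2 * exp (Re z * X \<omega> + e * \<bar>X \<omega>\<bar>) * norm (g \<omega>))"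
        by (simp add: norm_mult power_mult_distrib exp_add algebra_simps)
      ultimately show "norm (exp ((z + h) * of_real (X \<omega>)) * g \<omega> - exp (z * of_real (X \<omega>)) * g \<omega>
         - of_real (X \<omega>) * exp (z * of_real (X \<omega>)) * g \<omega> * h) \<le> (norm h)\<^sup>2 * (\<bar>X \<omega>\<bar> ^ 2 * exp (Re z * X \<omega> + e * \<bar>X \<omega>\<bar>) * norm (g \<omega>))"
        by simp
    qed (use i1 i in auto)
    also have "\<dots> = C * (norm h)\<^sup>2"
      by (simp add: C_def)
    finally show "norm ((\<integral>\<omega>. exp ((z + h) * of_real (X \<omega>)) * g \<omega> \<partial>M) - (\<integral>\<omega>. exp (z * of_real (X \<omega>)) * g \<omega> \<partial>M)
         - (\<integral>\<omega>. of_real (X \<omega>) * exp (z * of_real (X \<omega>)) * g \<omega> \<partial>M) * h) \<le> C * (norm h)\<^sup>2" .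
  qed
qed

lemma mgf_holomorphic:
  "(\<lambda>z. \<integral>\<omega>. exp (z * of_real (X \<omega>)) * g \<omega> \<partial>M) holomorphic_on {z. Re z > c}"
proof -
  have "open {z. Re z > c}" by (rule open_halfspace_Re_gt)
  then show ?thesis
    unfolding holomorphic_on_open[OF \<open>open _\<close>]
    using mgf_has_field_derivative by blast
qed

end

section \<open>The one-particle weight on the circle\<close>

abbreviation circ :: "real measure" where
  "circ \<equiv> restrict_space lborel {0..<2 * pi}"

definition angles :: "nat \<Rightarrow> (nat \<Rightarrow> real) measure" where
  "angles n = (\<Pi>\<^sub>M k\<in>{..<n}. circ)"

text \<open>
  The weight of a single angle in the Morris integral. The conventions for \<open>0 powr a\<close> make it vanish at \<open>t = 0\<close>,
  so it is defined on the whole circle.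
\<close>

definition jac :: "complex \<Rightarrow> complex \<Rightarrow> real \<Rightarrow> complex" where
  "jac a b t = (1 - cis (- t)) powr a * (1 - cis t) powr b"

definition vand :: "nat \<Rightarrow> (nat \<Rightarrow> real) \<Rightarrow> real" where
  "vand n \<theta> = (\<Prod>j<n. \<Prod>k<j. cmod (cis (\<theta> k) - cis (\<theta> j)))"

text \<open>
  The coupling \<open>l\<close> is complex in order to allow analytic continuation in it; for real \<open>l > 0\<close> this is the
  weight of a circular ensemble with \<open>\<beta> = 2 l\<close>.
\<close>

definition morris_weight :: "nat \<Rightarrow> complex \<Rightarrow> complex \<Rightarrow> complex \<Rightarrow> (nat \<Rightarrow> real) \<Rightarrow> complex" where
  "morris_weight n l a b \<theta> = of_real (vand n \<theta>) powr (2 * l) * (\<Prod>k<n. jac a b (\<theta> k))"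

definition morris :: "nat \<Rightarrow> complex \<Rightarrow> complex \<Rightarrow> complex \<Rightarrow> complex" where
  "morris n l a b = (\<integral>\<theta>. morris_weight n l a b \<theta> \<partial>angles n)"


lemma one_minus_cis_cases: "1 - cis t = 0 \<or> Re (1 - cis t) > 0"
proof (cases "cos t = 1")
  case True
  then have "sin t = 0"
    by (metis cos_one_sin_zero)
  then show ?thesis using True by (simp add: complex_eq_iff)
next
  case False
  then have "cos t < 1" using cos_le_one[of t] by linarith
  then show ?thesis by simp
qed

lemma cis_minus_eq_1_iff [simp]: "cis (- t) = 1 \<longleftrightarrow> cis t = 1"
  by (simp flip: cis_inverse)

lemma cmod_one_minus_cis: "cmod (1 - cis t) = 2 * \<bar>sin (t / 2)\<bar>"
  using dist_exp_i_1[of t] by (simp add: cis_conv_exp norm_minus_commute)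

lemma cmod_one_minus_cis_le: "cmod (1 - cis t) \<le> 2"
  using cmod_one_minus_cis[of t] abs_sin_le_one[of "t/2"] by simp

lemma jac_zero: "cis t = 1 \<Longrightarrow> jac a b t = 0"
  by (simp add: jac_def)

lemma jac_shift: "jac a (b + 1) t = (1 - cis t) * jac a b t"
  by (cases "cis t = 1") (simp_all add: jac_def powr_add)

lemma one_minus_cis_polar: "1 - cis (- t) = of_real (2 * sin (t / 2)) * cis ((pi - t) / 2)"
proof -
  have "cos t = 1 - 2 * (sin (t / 2))\<^sup>2" "sin t = 2 * sin (t / 2) * cos (t / 2)"
    using cos_double_sin[of "t / 2"] sin_double[of "t / 2"] by simp_all
  moreover have "cos (pi / 2 - t / 2) = sin (t / 2)" "sin (pi / 2 - t / 2) = cos (t / 2)"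
    using cos_sin_eq[of "pi / 2 - t / 2"] sin_cos_eq[of "pi / 2 - t / 2"] by auto
  ultimately show ?thesis
    by (simp add: complex_eq_iff diff_divide_distrib power2_eq_square)
qed

text \<open>
  The two principal logarithms have the real part \<open>ln (2 sin (t / 2))\<close> and opposite imaginary parts
  \<open>\<plusminus> (\<pi> - t) / 2\<close>, both within the range of the principal branch.
\<close>

lemma jac_exp:
  assumes "0 < t" "t < 2 * pi"
  shows "jac a b t = exp ((a + b) * of_real (ln (2 * sin (t / 2))) + (a - b) * \<i> * of_real ((pi - t) / 2))"
proof -
  have s: "sin (t / 2) > 0" using assms by (intro sin_gt_zero) auto
  have p: "1 - cis (- t) = exp (of_real (ln (2 * sin (t / 2))) + \<i> * of_real ((pi - t) / 2))"
    unfolding one_minus_cis_polar using s by (simp add: exp_add exp_of_real cis_conv_exp)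
  then have l1: "Ln (1 - cis (- t)) = of_real (ln (2 * sin (t / 2))) + \<i> * of_real ((pi - t) / 2)"
    using assms by (simp add: Ln_exp)
  have "1 - cis t = cnj (1 - cis (- t))" by (simp add: cis_cnj)
  also have "\<dots> = exp (of_real (ln (2 * sin (t / 2))) - \<i> * of_real ((pi - t) / 2))"
    unfolding p exp_cnj by simp
  finally have p2: "1 - cis t = exp (of_real (ln (2 * sin (t / 2))) - \<i> * of_real ((pi - t) / 2))" .
  have l2: "Ln (1 - cis t) = of_real (ln (2 * sin (t / 2))) - \<i> * of_real ((pi - t) / 2)"
    unfolding p2
  proof (rule Ln_exp)
    have im: "Im (of_real (ln (2 * sin (t / 2))) - \<i> * of_real ((pi - t) / 2)) = (t - pi) / 2"
      by (simp add: field_simps)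
    have "- (2 * pi) < t - pi" "t - pi \<le> 2 * pi"
      using assms pi_gt_zero by linarith+
    then show "- pi < Im (of_real (ln (2 * sin (t / 2))) - \<i> * of_real ((pi - t) / 2))"
      and "Im (of_real (ln (2 * sin (t / 2))) - \<i> * of_real ((pi - t) / 2)) \<le> pi"
      unfolding im by simp_all
  qed
  have "1 - cis t \<noteq> 0" "1 - cis (- t) \<noteq> 0" unfolding p p2 by simp_all
  then show ?thesis
    by (simp add: jac_def powr_def l1 l2 algebra_simps add_divide_distrib diff_divide_distrib flip: exp_add)
qed


lemma cis_neq_1: "0 < t \<Longrightarrow> t < 2 * pi \<Longrightarrow> cis t \<noteq> 1"
proof
  assume t: "0 < t" "t < 2 * pi" and "cis t = 1"
  then have "cmod (1 - cis t) = 0" by simp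
  then have "sin (t / 2) = 0" unfolding cmod_one_minus_cis by simp
  moreover have "sin (t / 2) > 0" using t by (intro sin_gt_zero) auto
  ultimately show False by simp
qed

lemma cis_eq_imp_eq:
  assumes "s \<in> {0..<2 * pi}" "t \<in> {0..<2 * pi}" "cis s = cis t"
  shows "s = t"
proof -
  have *: "cis (x - y) \<noteq> 1" if "y < x" "x \<in> {0..<2 * pi}" "y \<in> {0..<2 * pi}" for x y
    using that by (intro cis_neq_1) auto
  have "cis (s - t) = 1" "cis (t - s) = 1"
    using assms(3) by (simp_all flip: cis_divide)
  then show ?thesis
    using *[of t s] *[of s t] assms by (meson linorder_neqE_linordered_idom)
qed

lemma norm_powr_le: "norm (z powr a :: complex) \<le> norm z powr Re a * exp (\<bar>Im a\<bar> * pi)"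
proof (cases "z = 0")
  case False
  have "- (Im a * Im (Ln z)) \<le> \<bar>Im a\<bar> * pi"
  proof -
    have "\<bar>Im (Ln z)\<bar> \<le> pi"
      using Im_Ln_le_pi[OF False] mpi_less_Im_Ln[OF False] by linarith
    then have "\<bar>Im a\<bar> * \<bar>Im (Ln z)\<bar> \<le> \<bar>Im a\<bar> * pi" by (rule mult_left_mono) simp
    then show ?thesis using abs_ge_minus_self[of "Im a * Im (Ln z)"] by (simp add: abs_mult)
  qed
  then show ?thesis
    using False by (simp add: powr_def norm_exp_eq_Re flip: exp_add)
qed simp

lemma norm_jac_le:
  "norm (jac a b t) \<le> cmod (1 - cis t) powr Re (a + b) * exp ((\<bar>Im a\<bar> + \<bar>Im b\<bar>) * pi)"
proof -
  have "cmod (1 - cis (- t)) = cmod (1 - cis t)"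
    by (simp add: cmod_one_minus_cis)
  then have "norm (jac a b t) \<le> (cmod (1 - cis t) powr Re a * exp (\<bar>Im a\<bar> * pi)) * (cmod (1 - cis t) powr Re b * exp (\<bar>Im b\<bar> * pi))"
    unfolding jac_def norm_mult using norm_powr_le[of "1 - cis (- t)" a] norm_powr_le[of "1 - cis t" b]
    by (intro mult_mono) auto
  then show ?thesis
    by (simp add: powr_add exp_add algebra_simps)
qed

lemma norm_jac_bound:
  assumes "Re (a + b) \<ge> 0"
  shows "norm (jac a b t) \<le> 2 powr Re (a + b) * exp ((\<bar>Im a\<bar> + \<bar>Im b\<bar>) * pi)"
  by (rule order.trans[OF norm_jac_le] mult_right_mono powr_mono2)+ (use assms cmod_one_minus_cis_le in auto)

lemma cis_circle_Ln_ok: "cis t \<noteq> 1 \<Longrightarrow> 1 - cis t \<notin> \<real>\<^sub>\<le>\<^sub>0"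
  using one_minus_cis_cases[of t] by (auto simp: complex_nonpos_Reals_iff)

lemma isCont_cis: "isCont cis t"
  using continuous_on_cis[OF continuous_on_id[of UNIV]] by (simp add: continuous_on_eq_continuous_at)

lemma cis_has_vector_derivative: "(cis has_vector_derivative \<i> * cis t) (at t)"
proof -
  have "((\<lambda>z. exp (\<i> * z)) has_field_derivative \<i> * exp (\<i> * of_real t)) (at (of_real t))"
    by (auto intro!: derivative_eq_intros)
  from has_vector_derivative_real_field[OF this] show ?thesis
    by (simp add: cis_conv_exp[abs_def])
qed

lemma jac_continuous_at_nonsingular:
  assumes "cis t \<noteq> 1"
  shows "isCont (jac a b) t"
  unfolding jac_def using cis_circle_Ln_ok[of t] cis_circle_Ln_ok[of "- t"] assms
  by (intro continuous_intros isCont_cis isCont_o2[OF _ isCont_cis]) auto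

lemma closed_cis_eq_1: "closed {t. cis t = 1}"
  by (intro closed_Collect_eq continuous_intros)

lemma jac_measurable [measurable]: "jac a b \<in> borel_measurable borel"
proof -
  have "(\<lambda>t. if t \<in> - {t. cis t = 1} then jac a b t else 0) \<in> borel_measurable borel"
    using closed_cis_eq_1
    by (intro borel_measurable_continuous_on_if continuous_at_imp_continuous_on ballI
          jac_continuous_at_nonsingular) auto
  also have "(\<lambda>t. if t \<in> - {t. cis t = 1} then jac a b t else 0) = jac a b"
    by (auto simp: jac_zero)
  finally show ?thesis .
qed

text \<open>
  The modulus is controlled by a positive power of the chord \<open>\<bar>1 - cis t\<bar>\<close>, which forces the limit 0 at the
  singular point. This is why integration by parts over the circle has no boundary terms.
\<close>

lemma jac_continuous_on:
  assumes "Re (a + b) > 0"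
  shows "continuous_on S (jac a b)"
proof (intro continuous_at_imp_continuous_on ballI)
  fix t
  show "isCont (jac a b) t"
  proof (cases "cis t = 1")
    case True
    have "((\<lambda>t. cmod (1 - cis t) powr Re (a + b) * exp ((\<bar>Im a\<bar> + \<bar>Im b\<bar>) * pi)) \<longlongrightarrow> 0 powr Re (a + b) * exp ((\<bar>Im a\<bar> + \<bar>Im b\<bar>) * pi)) (at t)"
    proof (intro tendsto_intros tendsto_powr')
      have "((\<lambda>t. cmod (1 - cis t)) \<longlongrightarrow> cmod (1 - cis t)) (at t)"
        by (intro tendsto_intros tendsto_ident_at)
      then show "((\<lambda>t. cmod (1 - cis t)) \<longlongrightarrow> 0) (at t)" using True by simp
    qed (use assms in auto)
    then have lim: "((\<lambda>t. cmod (1 - cis t) powr Re (a + b) * exp ((\<bar>Im a\<bar> + \<bar>Im b\<bar>) * pi)) \<longlongrightarrow> 0) (at t)"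
      by simp
    have "(jac a b \<longlongrightarrow> 0) (at t)"
      by (rule Lim_null_comparison[OF always_eventually lim]) (intro allI norm_jac_le)
    then show ?thesis
      using True by (simp add: isCont_def jac_zero)
  qed (rule jac_continuous_at_nonsingular)
qed

text \<open>
  The derivative is a combination of two neighbouring weights with constant coefficients. This is what turns
  integration by parts into a two-term recursion.
\<close>

lemma jac_has_vector_derivative:
  assumes "cis t \<noteq> 1"
  shows "(jac a (b + 1) has_vector_derivative - \<i> * ((a + b + 1) * jac a b t - (b + 1) * jac a (b + 1) t)) (at t)"
proof -
  have ok: "1 - cis t \<notin> \<real>\<^sub>\<le>\<^sub>0" "1 - cis (- t) \<notin> \<real>\<^sub>\<le>\<^sub>0"
    using cis_circle_Ln_ok[of t] cis_circle_Ln_ok[of "- t"] assms by auto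
  have nz: "1 - cis t \<noteq> 0" "1 - cis (- t) \<noteq> 0" using assms by auto
  have d1: "((\<lambda>t. 1 - cis t) has_vector_derivative - \<i> * cis t) (at t)"
    using has_vector_derivative_diff[OF has_vector_derivative_const[of 1] cis_has_vector_derivative[of t]] by simp
  have d2: "((\<lambda>t. 1 - cis (- t)) has_vector_derivative \<i> * cis (- t)) (at t)"
    using has_vector_derivative_diff[OF has_vector_derivative_const[of 1]
        vector_diff_chain_at[OF has_vector_derivative_minus[OF has_vector_derivative_id] cis_has_vector_derivative[of "- t"]]]
    by (simp add: o_def)
  have e1: "((\<lambda>t. (1 - cis t) powr (b + 1)) has_vector_derivative - \<i> * cis t * ((b + 1) * (1 - cis t) powr b)) (at t)"
    using field_vector_diff_chain_at[OF d1 has_field_derivative_powr[OF ok(1), of "b + 1"]] by (simp add: o_def)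
  have e2: "((\<lambda>t. (1 - cis (- t)) powr a) has_vector_derivative \<i> * cis (- t) * (a * (1 - cis (- t)) powr (a - 1))) (at t)"
    using field_vector_diff_chain_at[OF d2 has_field_derivative_powr[OF ok(2), of a]] by (simp add: o_def)
  have c: "cis (- t) = 1 / cis t" by (metis cis_inverse inverse_eq_divide)
  have p1: "(1 - cis (- t)) powr (a - 1) = (1 - cis (- t)) powr a / (1 - cis (- t))"
    using nz by (simp add: powr_diff)
  have p2: "(1 - cis t) powr (b + 1) = (1 - cis t) powr b * (1 - cis t)"
    using nz by (simp add: powr_add)
  have q: "cis (- t) / (1 - cis (- t)) = - 1 / (1 - cis t)"
  proof -
    have "(1 / x) / (1 - 1 / x) = - 1 / (1 - x)" if "x \<noteq> 0" "x \<noteq> 1" for x :: complex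
    proof -
      have "1 - 1 / x = (x - 1) / x" using that by (simp add: diff_divide_distrib)
      then show ?thesis using that by (simp add: minus_divide_right)
    qed
    then show ?thesis unfolding c using assms by simp
  qed
  have *: "cis (- t) * (X / (1 - cis (- t))) * (Y * (1 - cis t)) = - X * Y" for X Y
  proof -
    have "cis (- t) * (X / (1 - cis (- t))) * (Y * (1 - cis t)) = cis (- t) / (1 - cis (- t)) * (X * Y * (1 - cis t))"
      by simp
    also have "\<dots> = - X * Y" unfolding q using nz(1) by simp
    finally show ?thesis .
  qed
  show ?thesis
    unfolding jac_def
    apply (rule has_vector_derivative_eq_rhs[OF has_vector_derivative_mult[OF e2 e1]])
    unfolding p1 p2 mult.assoc mult.left_commute[of _ a] *[unfolded mult.assoc]
    by (simp add: algebra_simps)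
qed

lemma cnj_jac:
  assumes "t \<in> {0..<2 * pi}"
  shows "cnj (jac a b t) = jac (cnj b) (cnj a) t"
proof (cases "t = 0")
  case False
  then show ?thesis
    using assms by (simp add: jac_exp exp_cnj algebra_simps)
qed (simp add: jac_def)

section \<open>Symmetry of the product measure and of the Vandermonde factor\<close>

lemma finite_measure_circ: "finite_measure circ"
  by (rule finite_measureI) (simp add: emeasure_restrict_space space_restrict_space)

interpretation circ: product_sigma_finite "\<lambda>_::nat. circ"
proof (unfold product_sigma_finite_def, intro allI)
  interpret finite_measure circ by (rule finite_measure_circ)
  show "sigma_finite_measure circ" by unfold_locales
qed

lemma space_angles: "space (angles n) = {..<n} \<rightarrow>\<^sub>E {0..<2 * pi}"
  by (simp add: angles_def space_PiM space_restrict_space)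

lemma angle_measurable [measurable]:
  assumes "k < n"
  shows "(\<lambda>\<theta>. \<theta> k) \<in> borel_measurable (angles n)"
proof -
  have "(\<lambda>\<theta>. \<theta> k) \<in> measurable (angles n) circ"
    unfolding angles_def by (rule measurable_component_singleton) (use assms in auto)
  moreover have "(\<lambda>t. t) \<in> borel_measurable circ"
    by (rule measurable_restrict_space1) simp
  ultimately show ?thesis
    using measurable_comp[of "\<lambda>\<theta>. \<theta> k" "angles n" circ "\<lambda>t. t" borel] by (simp add: comp_def)
qed

lemma finite_measure_angles: "finite_measure (angles n)"
proof (rule finite_measureI)
  have "emeasure (angles n) (space (angles n)) = (\<Prod>i<n. emeasure circ (space circ))"
    unfolding angles_def space_PiM by (rule circ.emeasure_PiM) (simp, rule sets.top)
  also have "\<dots> \<noteq> \<infinity>"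
    using finite_measure.emeasure_finite[OF finite_measure_circ] by (simp add: ennreal_prod_eq_top power_eq_top_ennreal)
  finally show "emeasure (angles n) (space (angles n)) \<noteq> \<infinity>" .
qed

lemma angles_integrable_bounded:
  fixes f :: "_ \<Rightarrow> complex"
  assumes "f \<in> borel_measurable (angles n)" "\<And>\<theta>. \<theta> \<in> space (angles n) \<Longrightarrow> norm (f \<theta>) \<le> B"
  shows "integrable (angles n) f"
  by (rule finite_measure.integrable_const_bound[OF finite_measure_angles _ assms(1), of B]) (use assms(2) in auto)

definition swap_angles :: "nat \<Rightarrow> nat \<Rightarrow> nat \<Rightarrow> (nat \<Rightarrow> real) \<Rightarrow> nat \<Rightarrow> real" where
  "swap_angles n i j \<theta> = (\<lambda>k\<in>{..<n}. \<theta> (Transposition.transpose i j k))"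

lemma transpose_lt: "i < n \<Longrightarrow> j < n \<Longrightarrow> k < n \<Longrightarrow> Transposition.transpose i j k < (n::nat)"
  by (auto simp: Transposition.transpose_def)

lemma bij_betw_transpose_lessThan:
  "i < n \<Longrightarrow> j < n \<Longrightarrow> bij_betw (Transposition.transpose i j) {..<n} {..<n::nat}"
  by (rule bij_betwI[where g = "Transposition.transpose i j"]) (auto intro: transpose_lt)

lemma swap_angles_measurable:
  assumes "i < n" "j < n"
  shows "swap_angles n i j \<in> measurable (angles n) (angles n)"
  unfolding angles_def swap_angles_def[abs_def]
  using assms by (intro measurable_restrict measurable_component_singleton) (auto intro: transpose_lt)

lemma distr_swap_angles:
  assumes ij: "i < n" "j < n"
  shows "distr (angles n) (angles n) (swap_angles n i j) = angles n"
  unfolding angles_def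
proof (rule circ.PiM_eqI)
  fix A assume A: "\<And>k. k \<in> {..<n} \<Longrightarrow> A k \<in> sets circ"
  let ?t = "Transposition.transpose i j"
  have bij: "bij_betw ?t {..<n} {..<n}"
    using ij by (rule bij_betw_transpose_lessThan)
  have "emeasure (distr (Pi\<^sub>M {..<n} (\<lambda>_. circ)) (Pi\<^sub>M {..<n} (\<lambda>_. circ)) (swap_angles n i j)) (Pi\<^sub>E {..<n} A)
     = emeasure (Pi\<^sub>M {..<n} (\<lambda>_. circ)) (swap_angles n i j -` Pi\<^sub>E {..<n} A \<inter> space (Pi\<^sub>M {..<n} (\<lambda>_. circ)))"
    using swap_angles_measurable[OF ij] A unfolding angles_def by (intro emeasure_distr) (auto intro!: sets_PiM_I_finite)
  also have "swap_angles n i j -` Pi\<^sub>E {..<n} A \<inter> space (Pi\<^sub>M {..<n} (\<lambda>_. circ)) = Pi\<^sub>E {..<n} (\<lambda>k. A (?t k))"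
  proof (intro Set.set_eqI iffI)
    fix \<theta> assume "\<theta> \<in> Pi\<^sub>E {..<n} (\<lambda>k. A (?t k))"
    then have 1: "\<theta> k \<in> A (?t k)" if "k < n" for k using that by auto
    have "\<theta> (?t k) \<in> A k" if "k < n" for k
      using 1[of "?t k"] that ij by (auto intro: transpose_lt)
    moreover have "\<theta> k \<in> space circ" if "k < n" for k
      using 1[OF that] A[of "?t k"] transpose_lt[OF ij that] sets.sets_into_space[of "A (?t k)" circ] by auto
    ultimately show "\<theta> \<in> swap_angles n i j -` Pi\<^sub>E {..<n} A \<inter> space (Pi\<^sub>M {..<n} (\<lambda>_. circ))"
      using \<open>\<theta> \<in> _\<close> by (auto simp: swap_angles_def space_PiM PiE_iff)
  next
    fix \<theta> assume *: "\<theta> \<in> swap_angles n i j -` Pi\<^sub>E {..<n} A \<inter> space (Pi\<^sub>M {..<n} (\<lambda>_. circ))"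
    then have 1: "\<theta> (?t k) \<in> A k" if "k < n" for k
      using that by (auto simp: swap_angles_def PiE_iff)
    have "\<theta> k \<in> A (?t k)" if "k < n" for k
      using 1[of "?t k"] that ij by (auto intro: transpose_lt)
    then show "\<theta> \<in> Pi\<^sub>E {..<n} (\<lambda>k. A (?t k))"
      using * by (auto simp: space_PiM PiE_iff)
  qed
  also have "emeasure (Pi\<^sub>M {..<n} (\<lambda>_. circ)) (Pi\<^sub>E {..<n} (\<lambda>k. A (?t k))) = (\<Prod>k<n. emeasure circ (A (?t k)))"
    using A ij by (intro circ.emeasure_PiM) (auto intro: transpose_lt)
  also have "\<dots> = (\<Prod>k<n. emeasure circ (A k))"
    by (rule prod.reindex_bij_betw[OF bij])
  finally show "emeasure (distr (Pi\<^sub>M {..<n} (\<lambda>_. circ)) (Pi\<^sub>M {..<n} (\<lambda>_. circ)) (swap_angles n i j)) (Pi\<^sub>E {..<n} A) = (\<Prod>k<n. emeasure circ (A k))" .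
qed auto

lemma integral_swap_angles:
  fixes f :: "_ \<Rightarrow> complex"
  assumes "i < n" "j < n" and f: "f \<in> borel_measurable (angles n)"
  shows "(\<integral>\<theta>. f (swap_angles n i j \<theta>) \<partial>angles n) = (\<integral>\<theta>. f \<theta> \<partial>angles n)"
proof -
  have "(\<integral>\<theta>. f \<theta> \<partial>angles n) = (\<integral>\<theta>. f \<theta> \<partial>distr (angles n) (angles n) (swap_angles n i j))"
    using distr_swap_angles[OF assms(1,2)] by simp
  also have "\<dots> = (\<integral>\<theta>. f (swap_angles n i j \<theta>) \<partial>angles n)"
    by (rule integral_distr[OF swap_angles_measurable[OF assms(1,2)] f])
  finally show ?thesis by simp
qed

lemma vand_nonneg: "vand n \<theta> \<ge> 0"
  by (auto simp: vand_def intro!: prod_nonneg)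

lemma vand_Suc: "vand (Suc m) \<theta> = vand m \<theta> * (\<Prod>k<m. cmod (cis (\<theta> k) - cis (\<theta> m)))"
  by (simp add: vand_def)

lemma vand_le: "vand n \<theta> \<le> 2 ^ (n * n)"
proof -
  have 1: "cmod (cis x - cis y) \<le> 2" for x y
    using norm_triangle_ineq4[of "cis x" "cis y"] by simp
  have "vand n \<theta> \<le> (\<Prod>j<n. 2 ^ n)"
    unfolding vand_def
  proof (intro prod_mono conjI prod_nonneg ballI)
    fix j assume "j \<in> {..<n}"
    have "(\<Prod>k<j. cmod (cis (\<theta> k) - cis (\<theta> j))) \<le> (\<Prod>k<j. 2)"
      by (intro prod_mono) (use 1 in auto)
    also have "\<dots> \<le> 2 ^ n" using \<open>j \<in> _\<close> by simp
    finally show "(\<Prod>k<j. cmod (cis (\<theta> k) - cis (\<theta> j))) \<le> 2 ^ n" .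
  qed auto
  then show ?thesis by (simp add: power_mult)
qed

lemma vand_measurable [measurable]: "vand n \<in> borel_measurable (angles n)"
proof -
  have c: "(\<lambda>\<theta>. cis (\<theta> k)) \<in> borel_measurable (angles n)" if "k < n" for k
    using that measurable_compose[OF angle_measurable borel_measurable_continuous_onI[OF continuous_on_cis[OF continuous_on_id]]] by auto
  show ?thesis
    unfolding vand_def[abs_def] by (intro borel_measurable_prod measurable_compose[OF _ borel_measurable_norm] borel_measurable_diff c) auto
qed

text \<open>
  The squared product runs over all ordered pairs of distinct indices, a description that no longer refers to
  the order of the indices.
\<close>

lemma pair_prod_square:
  fixes f :: "nat \<Rightarrow> nat \<Rightarrow> real"
  assumes "\<And>j k. f j k = f k j"
  shows "(\<Prod>j<n. \<Prod>k<j. f j k)\<^sup>2 = (\<Prod>j<n. \<Prod>k\<in>{..<n} - {j}. f j k)"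
proof (induction n)
  case (Suc n)
  have "(\<Prod>j<Suc n. \<Prod>k\<in>{..<Suc n} - {j}. f j k) = (\<Prod>j<n. \<Prod>k\<in>{..<Suc n} - {j}. f j k) * (\<Prod>k<n. f n k)"
    by (simp add: lessThan_Suc)
  also have "(\<Prod>j<n. \<Prod>k\<in>{..<Suc n} - {j}. f j k) = (\<Prod>j<n. (\<Prod>k\<in>{..<n} - {j}. f j k) * f n j)"
  proof (rule prod.cong[OF refl])
    fix j assume "j \<in> {..<n}"
    then have "{..<Suc n} - {j} = insert n ({..<n} - {j})" by auto
    then show "(\<Prod>k\<in>{..<Suc n} - {j}. f j k) = (\<Prod>k\<in>{..<n} - {j}. f j k) * f n j"
      using assms[of j n] by simp
  qed
  finally show ?case
    using Suc by (simp add: prod.distrib power2_eq_square mult_ac)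
qed simp

text \<open>
  A transposition only permutes the factors of the squared product; the square root is unique because the
  product is nonnegative.
\<close>

lemma vand_swap:
  assumes "i < n" "j < n"
  shows "vand n (swap_angles n i j \<theta>) = vand n \<theta>"
proof -
  let ?t = "Transposition.transpose i j"
  define f where "f \<theta> l k = cmod (cis (\<theta> k) - cis (\<theta> l))" for \<theta> :: "nat \<Rightarrow> real" and l k :: nat
  have sym: "f \<theta> l k = f \<theta> k l" for \<theta> k l by (simp add: f_def norm_minus_commute)
  have sq: "(vand n \<theta>)\<^sup>2 = (\<Prod>l<n. \<Prod>k\<in>{..<n} - {l}. f \<theta> l k)" for \<theta>
    using pair_prod_square[of "f \<theta>" n, OF sym] by (simp add: vand_def f_def)
  have bij: "bij_betw ?t {..<n} {..<n}"
    using assms by (rule bij_betw_transpose_lessThan)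
  have bij': "bij_betw ?t ({..<n} - {l}) ({..<n} - {?t l})" if "l < n" for l
    by (rule bij_betwI[where g = ?t]) (use assms that in \<open>auto intro: transpose_lt simp: transpose_eq_iff\<close>)
  have "(\<Prod>l<n. \<Prod>k\<in>{..<n} - {l}. f (swap_angles n i j \<theta>) l k) = (\<Prod>l<n. \<Prod>k\<in>{..<n} - {l}. f \<theta> (?t l) (?t k))"
    by (intro prod.cong refl) (auto simp: f_def swap_angles_def)
  also have "\<dots> = (\<Prod>l<n. \<Prod>k\<in>{..<n} - {?t l}. f \<theta> (?t l) k)"
    by (intro prod.cong refl prod.reindex_bij_betw bij') auto
  also have "\<dots> = (\<Prod>l<n. \<Prod>k\<in>{..<n} - {l}. f \<theta> l k)"
    by (rule prod.reindex_bij_betw[OF bij])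
  finally have "(vand n (swap_angles n i j \<theta>))\<^sup>2 = (vand n \<theta>)\<^sup>2"
    unfolding sq .
  then show ?thesis
    by (rule power2_eq_imp_eq) (rule vand_nonneg)+
qed

lemma prod_swap_angles:
  assumes "i < n" "j < n"
  shows "(\<Prod>k<n. g (swap_angles n i j \<theta> k)) = (\<Prod>k<n. g (\<theta> k) :: 'b :: comm_monoid_mult)"
proof -
  let ?t = "Transposition.transpose i j"
  have bij: "bij_betw ?t {..<n} {..<n}"
    using assms by (rule bij_betw_transpose_lessThan)
  have "(\<Prod>k<n. g (swap_angles n i j \<theta> k)) = (\<Prod>k<n. g (\<theta> (?t k)))"
    by (intro prod.cong) (auto simp: swap_angles_def)
  also have "\<dots> = (\<Prod>k<n. g (\<theta> k))"
    by (rule prod.reindex_bij_betw[OF bij])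
  finally show ?thesis .
qed

lemma morris_weight_swap:
  "i < n \<Longrightarrow> j < n \<Longrightarrow> morris_weight n l a b (swap_angles n i j \<theta>) = morris_weight n l a b \<theta>"
  by (simp add: morris_weight_def vand_swap prod_swap_angles)

lemma powr_of_nonneg_measurable:
  assumes [measurable]: "f \<in> borel_measurable M" and nn: "\<And>x. f x \<ge> 0"
  shows "(\<lambda>x. complex_of_real (f x) powr l) \<in> borel_measurable M"
proof -
  have "(\<lambda>x. if f x = 0 then 0 else exp (l * of_real (ln (f x)))) \<in> borel_measurable M"
    by measurable
  also have "(\<lambda>x. if f x = 0 then 0 else exp (l * of_real (ln (f x)))) = (\<lambda>x. complex_of_real (f x) powr l)"
    using nn by (auto simp: powr_def Ln_of_real less_le)
  finally show ?thesis .
qed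

lemma norm_of_nonneg_powr: "x \<ge> 0 \<Longrightarrow> norm (complex_of_real x powr l) = x powr Re l"
  by (cases "x = 0") (auto simp: powr_def norm_exp_eq_Re Ln_of_real)

lemma morris_weight_measurable [measurable]: "morris_weight n l a b \<in> borel_measurable (angles n)"
  unfolding morris_weight_def[abs_def]
  by (intro borel_measurable_times borel_measurable_prod powr_of_nonneg_measurable vand_measurable vand_nonneg
       measurable_compose[OF angle_measurable jac_measurable]) auto

lemma vand_powr_le: "Re l \<ge> 0 \<Longrightarrow> norm (complex_of_real (vand n \<theta>) powr (2 * l)) \<le> (2 ^ (n * n)) powr (2 * Re l)"
  using powr_mono2[of "2 * Re l" "vand n \<theta>" "2 ^ (n * n)"] vand_nonneg[of n \<theta>] vand_le[of n \<theta>]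
  by (simp add: norm_of_nonneg_powr)

lemma morris_weight_bounded:
  assumes "Re l \<ge> 0" "Re (a + b) \<ge> 0"
  shows "norm (morris_weight n l a b \<theta>) \<le> (2 ^ (n * n)) powr (2 * Re l) * (\<Prod>k<n. 2 powr Re (a + b) * exp ((\<bar>Im a\<bar> + \<bar>Im b\<bar>) * pi))"
  unfolding morris_weight_def norm_mult prod_norm[symmetric]
  by (intro mult_mono prod_mono conjI vand_powr_le norm_jac_bound prod_nonneg) (use assms in auto)

section \<open>Integration by parts in one angle\<close>

text \<open>
  This is \<open>cot ((t - s) / 2)\<close>, the logarithmic derivative in \<open>t\<close> of the squared chord between \<open>cis t\<close> and
  \<open>cis s\<close>. In this form it takes the value 0 at coinciding points by the convention for division by 0.
\<close>

definition half_cot :: "real \<Rightarrow> real \<Rightarrow> real" where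
  "half_cot t s = 2 * sin (t - s) / (2 - 2 * cos (t - s))"

lemma half_cot_antisym: "half_cot s t = - half_cot t s"
proof -
  have "sin (s - t) = - sin (t - s)" "cos (s - t) = cos (t - s)"
    using sin_minus[of "t - s"] cos_minus[of "t - s"] by simp_all
  then show ?thesis unfolding half_cot_def by simp
qed

lemma unit_vector_identities:
  fixes c s C S :: real
  assumes "s\<^sup>2 + c\<^sup>2 = 1" "S\<^sup>2 + C\<^sup>2 = 1"
  shows "(c - C)\<^sup>2 + (s - S)\<^sup>2 = 2 - 2 * (C * c + S * s)"
    and "(c - C) * (2 * (S * c - C * s)) = (S + s) * (2 - 2 * (C * c + S * s))"
    and "(s - S) * (2 * (S * c - C * s)) = - (C + c) * (2 - 2 * (C * c + S * s))"
proof -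
  have "(c - C)\<^sup>2 + (s - S)\<^sup>2 - (2 - 2 * (C * c + S * s)) = (s\<^sup>2 + c\<^sup>2 - 1) + (S\<^sup>2 + C\<^sup>2 - 1)"
    by (simp add: power2_eq_square algebra_simps)
  then show "(c - C)\<^sup>2 + (s - S)\<^sup>2 = 2 - 2 * (C * c + S * s)"
    using assms by simp
  have "(c - C) * (2 * (S * c - C * s)) - (S + s) * (2 - 2 * (C * c + S * s))
      = 2 * S * (s\<^sup>2 + c\<^sup>2 - 1) + 2 * s * (S\<^sup>2 + C\<^sup>2 - 1)"
    by (simp add: power2_eq_square algebra_simps)
  then show "(c - C) * (2 * (S * c - C * s)) = (S + s) * (2 - 2 * (C * c + S * s))"
    using assms by simp
  have "(s - S) * (2 * (S * c - C * s)) - - (C + c) * (2 - 2 * (C * c + S * s))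
      = 2 * C * (1 - (s\<^sup>2 + c\<^sup>2)) + 2 * c * (1 - (S\<^sup>2 + C\<^sup>2))"
    by (simp add: power2_eq_square algebra_simps)
  then show "(s - S) * (2 * (S * c - C * s)) = - (C + c) * (2 - 2 * (C * c + S * s))"
    using assms by simp
qed

lemma cmod_cis_diff_sq: "(cmod (cis s - cis t))\<^sup>2 = 2 - 2 * cos (t - s)"
proof -
  have "(cmod (cis s - cis t))\<^sup>2 = (cos s - cos t)\<^sup>2 + (sin s - sin t)\<^sup>2"
    by (simp add: cmod_power2)
  also have "\<dots> = 2 - 2 * cos (t - s)"
    unfolding cos_diff by (rule unit_vector_identities) simp_all
  finally show ?thesis .
qed

lemma cmod_cis_diff_powr: "cmod (cis s - cis t) powr (2 * l) = (2 - 2 * cos (t - s)) powr l"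
  by (simp add: cmod_cis_diff_sq[symmetric] powr_powr flip: powr_numeral)

lemma cis_eq_iff_cos: "cis s = cis t \<longleftrightarrow> 2 - 2 * cos (t - s) = 0"
  unfolding cmod_cis_diff_sq[symmetric] by simp

lemma cos_gap_pos: "cis s \<noteq> cis t \<Longrightarrow> 2 - 2 * cos (t - s) > 0"
  using cis_eq_iff_cos[of s t] cos_le_one[of "t - s"] by linarith

text \<open>
  With \<open>x = cis t\<close> and \<open>y = cis s\<close> the cotangent is \<open>\<i> (x + y) / (x - y)\<close>, so the difference of the two points
  cancels its pole.
\<close>

lemma cis_diff_half_cot:
  assumes "cis s \<noteq> cis t"
  shows "(cis s - cis t) * of_real (half_cot t s) = - \<i> * (cis t + cis s)"
proof -
  have "(cis s - cis t) * of_real (2 * sin (t - s)) = - \<i> * (cis t + cis s) * of_real (2 - 2 * cos (t - s))"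
  proof -
    have "(cos s - cos t) * (2 * sin (t - s)) = (sin t + sin s) * (2 - 2 * cos (t - s))"
      "(sin s - sin t) * (2 * sin (t - s)) = - (cos t + cos s) * (2 - 2 * cos (t - s))"
      unfolding sin_diff cos_diff by (rule unit_vector_identities; simp)+
    then show ?thesis
      by (simp add: complex_eq_iff algebra_simps)
  qed
  then show ?thesis
    unfolding half_cot_def using cos_gap_pos[OF assms] by (simp add: nonzero_eq_divide_eq del: of_real_mult of_real_diff)
qed

lemma chord_power_has_derivative:
  assumes "cis s \<noteq> cis t"
  shows "((\<lambda>t. cmod (cis s - cis t) powr (2 * l)) has_real_derivative
          l * half_cot t s * cmod (cis s - cis t) powr (2 * l)) (at t)"
proof -
  have p: "2 - 2 * cos (t - s) > 0" by (rule cos_gap_pos[OF assms])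
  have "((\<lambda>t. 2 - 2 * cos (t - s)) has_real_derivative 2 * sin (t - s)) (at t)"
    by (auto intro!: derivative_eq_intros)
  from DERIV_fun_powr[where r = l, OF this p]
  have "((\<lambda>t. (2 - 2 * cos (t - s)) powr l) has_real_derivative
      l * (2 - 2 * cos (t - s)) powr (l - 1) * (2 * sin (t - s))) (at t)"
    by simp
  moreover have "(2 - 2 * cos (t - s)) powr (l - 1) = (2 - 2 * cos (t - s)) powr l / (2 - 2 * cos (t - s))"
    using p by (simp add: powr_diff)
  ultimately show ?thesis
    unfolding cmod_cis_diff_powr half_cot_def by (simp add: mult_ac)
qed

lemma prod_log_derivative:
  fixes h :: "nat \<Rightarrow> real \<Rightarrow> real"
  assumes "\<And>j. j < m \<Longrightarrow> (h j has_real_derivative c j * h j t) (at t)"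
  shows "((\<lambda>t. \<Prod>j<m. h j t) has_real_derivative (\<Sum>j<m. c j) * (\<Prod>j<m. h j t)) (at t)"
  using assms
proof (induction m)
  case (Suc m)
  have "((\<lambda>t. (\<Prod>j<m. h j t) * h m t) has_real_derivative
      (\<Sum>j<m. c j) * (\<Prod>j<m. h j t) * h m t + c m * h m t * (\<Prod>j<m. h j t)) (at t)"
    using Suc by (intro DERIV_mult) auto
  then show ?case by (simp add: algebra_simps)
qed simp

lemma half_cot_chord_bound:
  assumes "l \<ge> 1"
  shows "\<bar>half_cot t s\<bar> * cmod (cis s - cis t) powr (2 * l) \<le> 2 * 4 powr (l - 1)"
proof (cases "cis s = cis t")
  case False
  have p: "2 - 2 * cos (t - s) > 0" by (rule cos_gap_pos[OF False])
  have "\<bar>half_cot t s\<bar> * (2 - 2 * cos (t - s)) powr l = 2 * \<bar>sin (t - s)\<bar> * (2 - 2 * cos (t - s)) powr (l - 1)"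
    using p by (simp add: half_cot_def powr_diff abs_mult)
  also have "\<dots> \<le> 2 * 1 * 4 powr (l - 1)"
  proof (intro mult_mono powr_mono2)
    show "2 - 2 * cos (t - s) \<le> 4" using cos_ge_minus_one[of "t - s"] by linarith
  qed (use p assms in auto)
  finally show ?thesis unfolding cmod_cis_diff_powr by simp
qed simp

lemma half_cot_measurable [measurable]:
  assumes [measurable]: "i < n" "j < n"
  shows "(\<lambda>\<theta>. half_cot (\<theta> i) (\<theta> j)) \<in> borel_measurable (angles n)"
proof -
  have [measurable]: "(\<lambda>\<theta>. \<theta> i) \<in> borel_measurable (angles n)" "(\<lambda>\<theta>. \<theta> j) \<in> borel_measurable (angles n)"
    using assms by (auto intro: angle_measurable)
  show ?thesis unfolding half_cot_def by measurable
qed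

lemma cis_angle_measurable: "k < n \<Longrightarrow> (\<lambda>\<theta>. cis (\<theta> k)) \<in> borel_measurable (angles n)"
  using measurable_compose[OF angle_measurable borel_measurable_continuous_onI[OF continuous_on_cis[OF continuous_on_id]]] by auto

lemma vand_powr_Suc:
  "complex_of_real (vand (Suc m) \<theta>) powr (2 * of_real l) =
   of_real (vand m \<theta> powr (2 * l)) * of_real (\<Prod>k<m. cmod (cis (\<theta> k) - cis (\<theta> m)) powr (2 * l))"
proof -
  have "complex_of_real (vand (Suc m) \<theta>) powr (2 * of_real l) = of_real (vand (Suc m) \<theta> powr (2 * l))"
    using powr_of_real[OF vand_nonneg, of "Suc m" \<theta> "2 * l"] by simp
  also have "vand (Suc m) \<theta> powr (2 * l) = vand m \<theta> powr (2 * l) * (\<Prod>k<m. cmod (cis (\<theta> k) - cis (\<theta> m)) powr (2 * l))"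
    unfolding vand_Suc by (subst powr_mult) (auto simp: vand_nonneg prod_nonneg prod_powr_distrib)
  finally show ?thesis by simp
qed

text \<open>
  For \<open>l \<ge> 1\<close> the chord between the two points occurs in the weight with a power of at least 2, which absorbs the
  simple pole of the cotangent. All integrals in the recursion are then integrals of bounded functions.
\<close>

lemma half_cot_weight_bounded:
  assumes l: "l \<ge> 1" and ab: "Re (a + b) \<ge> 0" and j: "j < m"
  shows "\<exists>B. \<forall>\<theta>. norm (of_real (half_cot (\<theta> m) (\<theta> j)) * morris_weight (Suc m) (of_real l) a b \<theta>) \<le> B"
proof (intro exI allI)
  fix \<theta> :: "nat \<Rightarrow> real"
  let ?h = "\<lambda>k. cmod (cis (\<theta> k) - cis (\<theta> m)) powr (2 * l)"
  let ?J = "2 powr Re (a + b) * exp ((\<bar>Im a\<bar> + \<bar>Im b\<bar>) * pi)"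
  have "norm (of_real (half_cot (\<theta> m) (\<theta> j)) * morris_weight (Suc m) (of_real l) a b \<theta>)
     = vand m \<theta> powr (2 * l) * (\<bar>half_cot (\<theta> m) (\<theta> j)\<bar> * (\<Prod>k<m. ?h k)) * (\<Prod>k<Suc m. norm (jac a b (\<theta> k)))"
    unfolding morris_weight_def vand_powr_Suc norm_mult prod_norm[symmetric]
    by (simp add: vand_nonneg abs_prod prod_nonneg flip: of_real_prod)
  also have "\<bar>half_cot (\<theta> m) (\<theta> j)\<bar> * (\<Prod>k<m. ?h k) = (\<bar>half_cot (\<theta> m) (\<theta> j)\<bar> * ?h j) * (\<Prod>k\<in>{..<m} - {j}. ?h k)"
    using j by (simp add: prod.remove[of "{..<m}" j])
  also have "vand m \<theta> powr (2 * l) * ((\<bar>half_cot (\<theta> m) (\<theta> j)\<bar> * ?h j) * (\<Prod>k\<in>{..<m} - {j}. ?h k)) * (\<Prod>k<Suc m. norm (jac a b (\<theta> k)))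
     \<le> (2 ^ (m * m)) powr (2 * l) * ((2 * 4 powr (l - 1)) * (\<Prod>k\<in>{..<m} - {j}. 2 powr (2 * l))) * (\<Prod>k<Suc m. ?J)"
  proof (rule mult_mono[OF mult_mono[OF _ mult_mono[OF half_cot_chord_bound]]])
    show "vand m \<theta> powr (2 * l) \<le> (2 ^ (m * m)) powr (2 * l)"
      using l by (intro powr_mono2 vand_le vand_nonneg) auto
    show "(\<Prod>k\<in>{..<m} - {j}. ?h k) \<le> (\<Prod>k\<in>{..<m} - {j}. 2 powr (2 * l))"
      using l norm_triangle_ineq4[of "cis _" "cis (\<theta> m)"] by (intro prod_mono conjI powr_mono2) auto
    show "(\<Prod>k<Suc m. norm (jac a b (\<theta> k))) \<le> (\<Prod>k<Suc m. ?J)"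
      using ab by (intro prod_mono conjI norm_jac_bound) auto
  qed (use l in \<open>auto intro!: prod_nonneg mult_nonneg_nonneg\<close>)
  finally show "norm (of_real (half_cot (\<theta> m) (\<theta> j)) * morris_weight (Suc m) (of_real l) a b \<theta>)
     \<le> (2 ^ (m * m)) powr (2 * l) * ((2 * 4 powr (l - 1)) * (\<Prod>k\<in>{..<m} - {j}. 2 powr (2 * l))) * (\<Prod>k<Suc m. ?J)" .
qed

text \<open>
  The test functions of Aomoto's argument: by symmetry of the weight they stand for the elementary symmetric
  polynomials in the variables \<open>1 - cis (\<theta> i)\<close>.
\<close>

definition chord_prod :: "nat \<Rightarrow> (nat \<Rightarrow> real) \<Rightarrow> complex" where
  "chord_prod r \<theta> = (\<Prod>i<r. 1 - cis (\<theta> i))"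

lemma chord_prod_measurable: "r \<le> n \<Longrightarrow> chord_prod r \<in> borel_measurable (angles n)"
  unfolding chord_prod_def[abs_def]
  by (intro borel_measurable_prod borel_measurable_diff cis_angle_measurable) auto

lemma chord_prod_bounded: "norm (chord_prod r \<theta>) \<le> 2 ^ r"
proof -
  have "norm (chord_prod r \<theta>) \<le> (\<Prod>i<r. 2)"
    unfolding chord_prod_def prod_norm[symmetric]
    by (intro prod_mono conjI cmod_one_minus_cis_le) auto
  then show ?thesis by simp
qed

text \<open>
  The integrand is the derivative in the last angle of \<open>chord_prod r \<theta>\<close> times the weight, with the exponent \<open>b\<close>
  of the last angle raised by 1. That function vanishes at both ends of the interval.
\<close>

lemma angular_derivative_integral_zero:
  fixes a b :: complex and l :: real
  assumes l: "l \<ge> 1" and ab: "Re (a + b) \<ge> 0" and r: "r \<le> m"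
  shows "(\<integral>\<theta>. chord_prod r \<theta> * (- \<i> * ((a + b + 1) - (b + 1) * (1 - cis (\<theta> m)))) * morris_weight (Suc m) (of_real l) a b \<theta>
         + (\<Sum>j<m. chord_prod r \<theta> * (1 - cis (\<theta> m)) * of_real l * (of_real (half_cot (\<theta> m) (\<theta> j)) * morris_weight (Suc m) (of_real l) a b \<theta>)) \<partial>angles (Suc m)) = 0"
proof -
  let ?\<Phi> = "morris_weight (Suc m) (of_real l) a b"
  define F where "F = (\<lambda>\<theta>. chord_prod r \<theta> * (- \<i> * ((a + b + 1) - (b + 1) * (1 - cis (\<theta> m)))) * ?\<Phi> \<theta>
         + (\<Sum>j<m. chord_prod r \<theta> * (1 - cis (\<theta> m)) * of_real l * (of_real (half_cot (\<theta> m) (\<theta> j)) * ?\<Phi> \<theta>)))"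
  have F_meas: "F \<in> borel_measurable (angles (Suc m))"
    unfolding F_def using r
    by (intro borel_measurable_add borel_measurable_times borel_measurable_sum borel_measurable_diff borel_measurable_const
        chord_prod_measurable cis_angle_measurable morris_weight_measurable borel_measurable_of_real half_cot_measurable) auto
  have "\<forall>j. \<exists>B. j < m \<longrightarrow> (\<forall>\<theta>. norm (of_real (half_cot (\<theta> m) (\<theta> j)) * ?\<Phi> \<theta>) \<le> B)"
    using half_cot_weight_bounded[OF l ab] by blast
  from choice[OF this] obtain Bk where Bk: "\<And>j \<theta>. j < m \<Longrightarrow> norm (of_real (half_cot (\<theta> m) (\<theta> j)) * ?\<Phi> \<theta>) \<le> Bk j"
    by blast
  obtain B0 where B0: "\<And>\<theta>. norm (?\<Phi> \<theta>) \<le> B0"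
    using morris_weight_bounded[of "of_real l" a b "Suc m"] l ab by auto
  define B where "B = 2 ^ r * (norm (a + b + 1) + norm (b + 1) * 2) * B0 + (\<Sum>j<m. 2 ^ r * 2 * l * Bk j)"
  have F_bound: "norm (F \<theta>) \<le> B" for \<theta>
  proof -
    have 1: "norm (- \<i> * ((a + b + 1) - (b + 1) * (1 - cis (\<theta> m)))) \<le> norm (a + b + 1) + norm (b + 1) * 2"
      unfolding norm_mult by (simp add: norm_mult, rule order.trans[OF norm_triangle_ineq4])
         (simp add: norm_mult mult_left_mono cmod_one_minus_cis_le)
    have B0': "B0 \<ge> 0" using order.trans[OF norm_ge_zero B0] .
    have Bk': "Bk j \<ge> 0" if "j < m" for j using order.trans[OF norm_ge_zero Bk[OF that]] .
    show ?thesis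
      unfolding F_def B_def
      apply (intro order.trans[OF norm_triangle_ineq] add_mono order.trans[OF norm_sum] sum_mono)
      subgoal
        unfolding norm_mult[of "chord_prod r \<theta> * _"] norm_mult[of "chord_prod r \<theta>"]
        by (intro mult_mono chord_prod_bounded 1 B0 mult_nonneg_nonneg B0' add_nonneg_nonneg) auto
      subgoal for j
        unfolding norm_mult[of "_ * of_real l"] norm_mult[of _ "of_real l"] norm_mult[of "chord_prod r \<theta>"]
        using l by (intro mult_mono chord_prod_bounded cmod_one_minus_cis_le Bk mult_nonneg_nonneg Bk') auto
      done
  qed
  have F_int: "integrable (Pi\<^sub>M (insert m {..<m}) (\<lambda>_. circ)) F"
    using angles_integrable_bounded[OF F_meas F_bound] by (simp add: angles_def lessThan_Suc)
  have inner: "(\<integral>t. F (x(m := t)) \<partial>circ) = 0" if x: "x \<in> space (Pi\<^sub>M {..<m} (\<lambda>_. circ))" for x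
  proof -
    have x': "x k \<in> {0..<2 * pi}" if "k < m" for k
      using x that by (auto simp: space_PiM space_restrict_space PiE_iff)
    define c0 where "c0 = chord_prod r x * of_real (vand m x powr (2 * l)) * (\<Prod>k<m. jac a b (x k))"
    define H where "H t = (\<Prod>j<m. cmod (cis (x j) - cis t) powr (2 * l))" for t
    define G where "G t = c0 * (jac a (b + 1) t * of_real (H t))" for t
    have jm: "chord_prod r (x(m := t)) = chord_prod r x" for t
      unfolding chord_prod_def using r by (intro prod.cong) auto
    have vm: "vand m (x(m := t)) = vand m x" for t
      unfolding vand_def by (intro prod.cong) auto
    have \<Phi>: "?\<Phi> (x(m := t)) = of_real (vand m x powr (2 * l)) * of_real (H t) * ((\<Prod>k<m. jac a b (x k)) * jac a b t)" for t
      unfolding morris_weight_def vand_powr_Suc vm H_def by simp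
    have F_eq: "F (x(m := t)) = c0 * (- \<i> * ((a + b + 1) * jac a b t - (b + 1) * jac a (b + 1) t) * of_real (H t)
        + jac a (b + 1) t * of_real ((\<Sum>j<m. l * half_cot t (x j)) * H t))" for t
      unfolding F_def jm \<Phi> c0_def jac_shift
      by (simp add: algebra_simps sum_distrib_left sum_distrib_right)
    \<comment> \<open>Coinciding angles form a finite set, which the fundamental theorem of calculus may leave out.\<close>
    have deriv: "(G has_vector_derivative F (x(m := t))) (at t)"
      if t: "t \<in> {0<..<2 * pi} - x ` {..<m}" for t
    proof -
      have "cis (x j) \<noteq> cis t" if "j < m" for j
        using cis_eq_imp_eq[OF x'[OF that], of t] t that by auto
      then have "(H has_real_derivative (\<Sum>j<m. l * half_cot t (x j)) * H t) (at t)"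
        unfolding H_def[abs_def] by (intro prod_log_derivative chord_power_has_derivative)
      then have Hd: "((\<lambda>t. complex_of_real (H t)) has_vector_derivative of_real ((\<Sum>j<m. l * half_cot t (x j)) * H t)) (at t)"
        by (intro has_vector_derivative_of_real) (simp add: has_real_derivative_iff_has_vector_derivative)
      show ?thesis
        unfolding G_def[abs_def] F_eq
        by (rule has_vector_derivative_eq_rhs[OF has_vector_derivative_mult_right[OF
              has_vector_derivative_mult[OF jac_has_vector_derivative Hd]]])
           (use t cis_neq_1 in \<open>auto simp: algebra_simps\<close>)
    qed
    have cont: "continuous_on {0..2 * pi} G"
      unfolding G_def[abs_def] H_def[abs_def] using l ab
      by (intro continuous_intros jac_continuous_on continuous_on_powr' ballI conjI) auto
    have hi: "((\<lambda>t. F (x(m := t))) has_integral G (2 * pi) - G 0) {0..2 * pi}"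
      by (rule fundamental_theorem_of_calculus_interior_strong[OF _ _ deriv cont]) auto
    have meas: "(\<lambda>t. F (x(m := t))) \<in> borel_measurable circ"
      using measurable_comp[OF measurable_component_update[OF x, of m] F_meas[unfolded angles_def lessThan_Suc]]
      by (simp add: comp_def)
    have "integrable circ (\<lambda>t. F (x(m := t)))"
      by (rule finite_measure.integrable_const_bound[OF finite_measure_circ _ meas, of B]) (use F_bound in auto)
    then have si: "set_integrable lborel {0..<2 * pi} (\<lambda>t. F (x(m := t)))"
      by (simp add: set_integrable_def integrable_restrict_space)
    have "(\<integral>t. F (x(m := t)) \<partial>circ) = (LINT t:{0..<2 * pi}|lborel. F (x(m := t)))"
      by (simp add: set_lebesgue_integral_def integral_restrict_space)
    also have "\<dots> = integral {0..<2 * pi} (\<lambda>t. F (x(m := t)))"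
      by (rule set_borel_integral_eq_integral(2)[OF si])
    also have "\<dots> = integral {0..2 * pi} (\<lambda>t. F (x(m := t)))"
      by (rule integral_spike_set; rule negligible_subset[of "{2 * pi}"]) auto
    also have "\<dots> = G (2 * pi) - G 0"
      using hi by (rule integral_unique)
    also have "\<dots> = 0"
      by (simp add: G_def jac_zero)
    finally show ?thesis .
  qed
  have "(\<integral>\<theta>. F \<theta> \<partial>angles (Suc m)) = (\<integral>x. (\<integral>t. F (x(m := t)) \<partial>circ) \<partial>Pi\<^sub>M {..<m} (\<lambda>_. circ))"
    unfolding angles_def lessThan_Suc by (rule circ.product_integral_insert[OF _ _ F_int]) auto
  also have "\<dots> = (\<integral>x. 0 \<partial>Pi\<^sub>M {..<m} (\<lambda>_. circ))"
    by (rule Bochner_Integration.integral_cong[OF refl inner])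
  finally show ?thesis unfolding F_def by simp
qed

section \<open>Recursions for the Morris integral\<close>

lemma swap_angles_apply: "k < n \<Longrightarrow> swap_angles n i j \<theta> k = \<theta> (Transposition.transpose i j k)"
  by (simp add: swap_angles_def)

lemma morris_weight_eq_0:
  assumes "i < j" "j < n" "cis (\<theta> i) = cis (\<theta> j)"
  shows "morris_weight n l a b \<theta> = 0"
proof -
  have "(\<Prod>k<j. cmod (cis (\<theta> k) - cis (\<theta> j))) = 0"
    using assms by (intro prod_zero) auto
  then have "vand n \<theta> = 0"
    unfolding vand_def using assms by (intro prod_zero) auto
  then show ?thesis by (simp add: morris_weight_def)
qed

context
  fixes a b :: complex and l :: real and m :: nat
  assumes l: "l \<ge> 1" and ab: "Re (a + b) \<ge> 0"
begin

private abbreviation "\<Phi> \<equiv> morris_weight (Suc m) (of_real l) a b"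

lemma integrable_times_weight:
  assumes f: "f \<in> borel_measurable (angles (Suc m))" and K: "\<And>\<theta>. norm (f \<theta>) \<le> K"
  shows "integrable (angles (Suc m)) (\<lambda>\<theta>. f \<theta> * \<Phi> \<theta>)"
proof -
  obtain B where B: "\<And>\<theta>. norm (\<Phi> \<theta>) \<le> B"
    using morris_weight_bounded[of "of_real l" a b "Suc m"] l ab by auto
  show ?thesis
    by (rule angles_integrable_bounded[of _ _ "K * B"])
       (use f B K order.trans[OF norm_ge_zero K] in \<open>auto simp: norm_mult intro!: mult_mono\<close>)
qed

lemma integrable_times_half_cot_weight:
  assumes f: "f \<in> borel_measurable (angles (Suc m))" and K: "\<And>\<theta>. norm (f \<theta>) \<le> K" and j: "j < m"
  shows "integrable (angles (Suc m)) (\<lambda>\<theta>. f \<theta> * (of_real (half_cot (\<theta> m) (\<theta> j)) * \<Phi> \<theta>))"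
proof -
  obtain B where B: "\<And>\<theta>. norm (of_real (half_cot (\<theta> m) (\<theta> j)) * \<Phi> \<theta>) \<le> B"
    using half_cot_weight_bounded[OF l ab j] by auto
  show ?thesis
  proof (rule angles_integrable_bounded[of _ _ "K * B"])
    show "(\<lambda>\<theta>. f \<theta> * (of_real (half_cot (\<theta> m) (\<theta> j)) * \<Phi> \<theta>)) \<in> borel_measurable (angles (Suc m))"
      using f j by (intro borel_measurable_times borel_measurable_of_real half_cot_measurable morris_weight_measurable) auto
  qed (use B K order.trans[OF norm_ge_zero K] in \<open>auto simp: norm_mult[of "f _"] intro!: mult_mono\<close>)
qed

lemma chord_prod_times_measurable:
  "r \<le> m \<Longrightarrow> k \<le> m \<Longrightarrow> (\<lambda>\<theta>. chord_prod r \<theta> * (1 - cis (\<theta> k))) \<in> borel_measurable (angles (Suc m))"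
  by (intro borel_measurable_times borel_measurable_diff borel_measurable_const
        chord_prod_measurable cis_angle_measurable) auto

lemma chord_prod_times_bounded: "norm (chord_prod r \<theta> * (1 - cis (\<theta> k))) \<le> 2 ^ r * 2"
  unfolding norm_mult by (intro mult_mono chord_prod_bounded cmod_one_minus_cis_le) auto

private abbreviation "A r \<equiv> (\<integral>\<theta>. chord_prod r \<theta> * \<Phi> \<theta> \<partial>angles (Suc m))"

lemma chord_prod_swap_above:
  assumes "r \<le> i" "r \<le> j" "i < n" "j < n"
  shows "chord_prod r (swap_angles n i j \<theta>) = chord_prod r \<theta>"
  unfolding chord_prod_def using assms by (intro prod.cong) (auto simp: swap_angles_apply)

text \<open>
  The weight is symmetric, so it does not matter which of the remaining angles supplies the next factor.
\<close>

lemma chord_prod_times_integral: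
  assumes "r \<le> j" "j \<le> m"
  shows "(\<integral>\<theta>. chord_prod r \<theta> * (1 - cis (\<theta> j)) * \<Phi> \<theta> \<partial>angles (Suc m)) = A (Suc r)"
proof -
  have "A (Suc r) = (\<integral>\<theta>. chord_prod (Suc r) (swap_angles (Suc m) r j \<theta>) * \<Phi> (swap_angles (Suc m) r j \<theta>) \<partial>angles (Suc m))"
    using assms by (intro integral_swap_angles[symmetric] borel_measurable_times chord_prod_measurable morris_weight_measurable) auto
  also have "\<dots> = (\<integral>\<theta>. chord_prod r \<theta> * (1 - cis (\<theta> j)) * \<Phi> \<theta> \<partial>angles (Suc m))"
  proof (rule Bochner_Integration.integral_cong[OF refl])
    fix \<theta>
    have "chord_prod (Suc r) (swap_angles (Suc m) r j \<theta>) = chord_prod r (swap_angles (Suc m) r j \<theta>) * (1 - cis (\<theta> j))"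
      using assms by (simp add: chord_prod_def swap_angles_apply)
    then show "chord_prod (Suc r) (swap_angles (Suc m) r j \<theta>) * \<Phi> (swap_angles (Suc m) r j \<theta>) = chord_prod r \<theta> * (1 - cis (\<theta> j)) * \<Phi> \<theta>"
      using assms by (simp add: chord_prod_swap_above morris_weight_swap)
  qed
  finally show ?thesis by simp
qed

private abbreviation "I r k j \<equiv> (\<integral>\<theta>. chord_prod r \<theta> * (1 - cis (\<theta> k)) * (of_real (half_cot (\<theta> m) (\<theta> j)) * \<Phi> \<theta>) \<partial>angles (Suc m))"

lemma interaction_swap:
  assumes j: "j < m" and r: "r \<le> m"
  shows "I r m j = - (\<integral>\<theta>. chord_prod r (swap_angles (Suc m) j m \<theta>) * (1 - cis (\<theta> j)) * (of_real (half_cot (\<theta> m) (\<theta> j)) * \<Phi> \<theta>) \<partial>angles (Suc m))"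
proof -
  have "I r m j = (\<integral>\<theta>. (\<lambda>\<theta>. chord_prod r \<theta> * (1 - cis (\<theta> m)) * (of_real (half_cot (\<theta> m) (\<theta> j)) * \<Phi> \<theta>)) (swap_angles (Suc m) j m \<theta>) \<partial>angles (Suc m))"
    using j r by (intro integral_swap_angles[symmetric] borel_measurable_times borel_measurable_of_real half_cot_measurable
      morris_weight_measurable borel_measurable_diff borel_measurable_const chord_prod_measurable cis_angle_measurable) auto
  also have "\<dots> = (\<integral>\<theta>. - (chord_prod r (swap_angles (Suc m) j m \<theta>) * (1 - cis (\<theta> j)) * (of_real (half_cot (\<theta> m) (\<theta> j)) * \<Phi> \<theta>)) \<partial>angles (Suc m))"
    using j by (intro Bochner_Integration.integral_cong refl)
       (simp add: swap_angles_apply morris_weight_swap half_cot_antisym[of "_ j" "_ m"])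
  finally show ?thesis by simp
qed

text \<open>
  Exchanging the angles \<open>j\<close> and \<open>m\<close> preserves the product of chords and the weight and reverses the sign of the
  cotangent.
\<close>

lemma interaction_inside:
  assumes "j < r" "r \<le> m"
  shows "I r m j = 0"
proof -
  have "chord_prod r (swap_angles (Suc m) j m \<theta>) * (1 - cis (\<theta> j)) = chord_prod r \<theta> * (1 - cis (\<theta> m))" for \<theta>
  proof -
    have *: "chord_prod r \<theta> = (1 - cis (\<theta> j)) * (\<Prod>i\<in>{..<r} - {j}. 1 - cis (\<theta> i))" for \<theta>
      unfolding chord_prod_def using assms by (intro prod.remove) auto
    have "(\<Prod>i\<in>{..<r} - {j}. 1 - cis (swap_angles (Suc m) j m \<theta> i)) = (\<Prod>i\<in>{..<r} - {j}. 1 - cis (\<theta> i))"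
      using assms by (intro prod.cong) (auto simp: swap_angles_apply)
    then show ?thesis
      unfolding * using assms by (simp add: swap_angles_apply)
  qed
  then have "I r m j = - I r m j"
    using interaction_swap[of j r] assms by simp
  then show ?thesis by simp
qed

text \<open>
  Here the exchange moves the factor \<open>1 - cis\<close> from the angle \<open>m\<close> to the angle \<open>j\<close>. Averaging both expressions
  produces the difference of the two points, which removes the pole of the cotangent.
\<close>

lemma interaction_outside:
  assumes rj: "r \<le> j" and j: "j < m"
  shows "I r m j = - \<i> * (A r - A (Suc r))"
proof -
  have "I r m j = - I r j j"
    using interaction_swap[of j r] assms chord_prod_swap_above[of r j m "Suc m"] by simp
  \<comment> \<open>Twice the integral, so that the two exchanged forms can be averaged.\<close>
  then have "2 * I r m j = I r m j - I r j j" by simp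
  also have "\<dots> = (\<integral>\<theta>. chord_prod r \<theta> * (1 - cis (\<theta> m)) * (of_real (half_cot (\<theta> m) (\<theta> j)) * \<Phi> \<theta>)
       - chord_prod r \<theta> * (1 - cis (\<theta> j)) * (of_real (half_cot (\<theta> m) (\<theta> j)) * \<Phi> \<theta>) \<partial>angles (Suc m))"
    using assms by (intro Bochner_Integration.integral_diff[symmetric] integrable_times_half_cot_weight[OF chord_prod_times_measurable chord_prod_times_bounded]) auto
  also have "\<dots> = (\<integral>\<theta>. - \<i> * (2 * (chord_prod r \<theta> * \<Phi> \<theta>) - chord_prod r \<theta> * (1 - cis (\<theta> m)) * \<Phi> \<theta> - chord_prod r \<theta> * (1 - cis (\<theta> j)) * \<Phi> \<theta>) \<partial>angles (Suc m))"
  proof (rule Bochner_Integration.integral_cong[OF refl])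
    fix \<theta>
    have *: "(cis (\<theta> j) - cis (\<theta> m)) * of_real (half_cot (\<theta> m) (\<theta> j)) * \<Phi> \<theta> = - \<i> * (cis (\<theta> m) + cis (\<theta> j)) * \<Phi> \<theta>"
    proof (cases "cis (\<theta> j) = cis (\<theta> m)")
      case True
      then show ?thesis using morris_weight_eq_0[of j m "Suc m" \<theta>] j by simp
    qed (simp add: cis_diff_half_cot)
    have "chord_prod r \<theta> * (1 - cis (\<theta> m)) * (of_real (half_cot (\<theta> m) (\<theta> j)) * \<Phi> \<theta>)
       - chord_prod r \<theta> * (1 - cis (\<theta> j)) * (of_real (half_cot (\<theta> m) (\<theta> j)) * \<Phi> \<theta>)
       = chord_prod r \<theta> * ((cis (\<theta> j) - cis (\<theta> m)) * of_real (half_cot (\<theta> m) (\<theta> j)) * \<Phi> \<theta>)"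
      by (simp add: algebra_simps)
    also have "\<dots> = - \<i> * (2 * (chord_prod r \<theta> * \<Phi> \<theta>) - chord_prod r \<theta> * (1 - cis (\<theta> m)) * \<Phi> \<theta> - chord_prod r \<theta> * (1 - cis (\<theta> j)) * \<Phi> \<theta>)"
      unfolding * by (simp add: algebra_simps)
    finally show "chord_prod r \<theta> * (1 - cis (\<theta> m)) * (of_real (half_cot (\<theta> m) (\<theta> j)) * \<Phi> \<theta>)
       - chord_prod r \<theta> * (1 - cis (\<theta> j)) * (of_real (half_cot (\<theta> m) (\<theta> j)) * \<Phi> \<theta>) = \<dots>" .
  qed
  also have "\<dots> = - \<i> * (2 * A r - A (Suc r) - A (Suc r))"
  proof -
    have i: "integrable (angles (Suc m)) (\<lambda>\<theta>. chord_prod r \<theta> * \<Phi> \<theta>)"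
      "integrable (angles (Suc m)) (\<lambda>\<theta>. chord_prod r \<theta> * (1 - cis (\<theta> m)) * \<Phi> \<theta>)"
      "integrable (angles (Suc m)) (\<lambda>\<theta>. chord_prod r \<theta> * (1 - cis (\<theta> j)) * \<Phi> \<theta>)"
      using assms by (auto intro!: integrable_times_weight chord_prod_measurable chord_prod_bounded chord_prod_times_measurable chord_prod_times_bounded)
    show ?thesis
      using i assms by (simp add: chord_prod_times_integral)
  qed
  finally have "2 * I r m j = 2 * (- \<i> * (A r - A (Suc r)))"
    by (simp add: algebra_simps)
  then show ?thesis by (simp only: mult_cancel_left) simp
qed

text \<open>
  In the integrated derivative only the \<open>m - r\<close> interactions with angles outside the product survive, and each
  contributes the same difference of two moments.
\<close>

lemma aomoto_step:
  assumes r: "r \<le> m"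
  shows "(b + 1 + of_real l * of_nat (m - r)) * A (Suc r) = (a + b + 1 + of_real l * of_nat (m - r)) * A r"
proof -
  have i1: "integrable (angles (Suc m)) (\<lambda>\<theta>. chord_prod r \<theta> * \<Phi> \<theta>)"
    "integrable (angles (Suc m)) (\<lambda>\<theta>. chord_prod r \<theta> * (1 - cis (\<theta> m)) * \<Phi> \<theta>)"
    using assms by (auto intro!: integrable_times_weight chord_prod_measurable chord_prod_bounded chord_prod_times_measurable chord_prod_times_bounded)
  have i2: "integrable (angles (Suc m)) (\<lambda>\<theta>. chord_prod r \<theta> * (1 - cis (\<theta> m)) * (of_real (half_cot (\<theta> m) (\<theta> j)) * \<Phi> \<theta>))" if "j < m" for j
    using assms that by (intro integrable_times_half_cot_weight[OF chord_prod_times_measurable chord_prod_times_bounded]) auto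
  have "0 = (\<integral>\<theta>. chord_prod r \<theta> * (- \<i> * ((a + b + 1) - (b + 1) * (1 - cis (\<theta> m)))) * \<Phi> \<theta>
         + (\<Sum>j<m. chord_prod r \<theta> * (1 - cis (\<theta> m)) * of_real l * (of_real (half_cot (\<theta> m) (\<theta> j)) * \<Phi> \<theta>)) \<partial>angles (Suc m))"
    using angular_derivative_integral_zero[OF l ab r] by simp
  also have "\<dots> = (\<integral>\<theta>. - \<i> * ((a + b + 1) * (chord_prod r \<theta> * \<Phi> \<theta>) - (b + 1) * (chord_prod r \<theta> * (1 - cis (\<theta> m)) * \<Phi> \<theta>))
         + of_real l * (\<Sum>j<m. chord_prod r \<theta> * (1 - cis (\<theta> m)) * (of_real (half_cot (\<theta> m) (\<theta> j)) * \<Phi> \<theta>)) \<partial>angles (Suc m))"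
    by (intro Bochner_Integration.integral_cong refl) (simp add: sum_distrib_left algebra_simps)
  also have "\<dots> = - \<i> * ((a + b + 1) * A r - (b + 1) * A (Suc r)) + of_real l * (\<Sum>j<m. I r m j)"
    using i1 i2 chord_prod_times_integral[OF r order.refl]
    by (subst Bochner_Integration.integral_add) (auto intro!: integrable_mult_right Bochner_Integration.integrable_sum simp del: mult_minus_left minus_mult_left)
  also have "(\<Sum>j<m. I r m j) = (\<Sum>j\<in>{r..<m}. I r m j)"
    using r by (intro sum.mono_neutral_right) (auto simp: interaction_inside)
  also have "\<dots> = of_nat (m - r) * (- \<i> * (A r - A (Suc r)))"
    by (simp add: interaction_outside)
  finally have "\<i> * ((b + 1 + of_real l * of_nat (m - r)) * A (Suc r) - (a + b + 1 + of_real l * of_nat (m - r)) * A r) = 0"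
    by (simp add: algebra_simps)
  then show ?thesis by simp
qed

lemma aomoto_product:
  "r \<le> Suc m \<Longrightarrow> A r * (\<Prod>q<r. b + 1 + of_real l * of_nat (m - q)) = A 0 * (\<Prod>q<r. a + b + 1 + of_real l * of_nat (m - q))"
proof (induction r)
  case (Suc r)
  have "A (Suc r) * (\<Prod>q<Suc r. b + 1 + of_real l * of_nat (m - q))
     = ((b + 1 + of_real l * of_nat (m - r)) * A (Suc r)) * (\<Prod>q<r. b + 1 + of_real l * of_nat (m - q))"
    by simp
  also have "\<dots> = (a + b + 1 + of_real l * of_nat (m - r)) * (A r * (\<Prod>q<r. b + 1 + of_real l * of_nat (m - q)))"
    using aomoto_step[of r] Suc.prems by simp
  also have "\<dots> = A 0 * (\<Prod>q<Suc r. a + b + 1 + of_real l * of_nat (m - q))"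
    using Suc by simp
  finally show ?case .
qed simp

end

lemma morris_weight_shift: "morris_weight n l a (b + 1) \<theta> = chord_prod n \<theta> * morris_weight n l a b \<theta>"
  by (simp add: morris_weight_def chord_prod_def jac_shift prod.distrib)

lemma morris_shift_right:
  assumes l: "l \<ge> 1" and ab: "Re (a + b) \<ge> 0"
  shows "morris n (of_real l) a (b + 1) * (\<Prod>j<n. b + 1 + of_real l * of_nat j)
       = morris n (of_real l) a b * (\<Prod>j<n. a + b + 1 + of_real l * of_nat j)"
proof (cases n)
  case 0
  then show ?thesis by (simp add: morris_def morris_weight_def)
next
  case (Suc m)
  have *: "(\<Prod>q<Suc m. f (m - q)) = (\<Prod>j<Suc m. f j)" for f :: "nat \<Rightarrow> complex"
    using prod.nat_diff_reindex[of f "Suc m"] by simp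
  show ?thesis
    using aomoto_product[OF l ab, of "Suc m" m] unfolding Suc morris_def morris_weight_shift
    by (simp add: *[of "\<lambda>q. b + 1 + of_real l * of_nat q"] *[of "\<lambda>q. a + b + 1 + of_real l * of_nat q"] chord_prod_def[of 0] del: prod.lessThan_Suc of_nat_diff)
qed

lemma cnj_morris: "cnj (morris n (of_real l) a b) = morris n (of_real l) (cnj b) (cnj a)"
proof -
  have "cnj (morris n (of_real l) a b) = (\<integral>\<theta>. cnj (morris_weight n (of_real l) a b \<theta>) \<partial>angles n)"
    unfolding morris_def by simp
  also have "\<dots> = morris n (of_real l) (cnj b) (cnj a)"
    unfolding morris_def
  proof (rule Bochner_Integration.integral_cong[OF refl])
    fix \<theta> assume "\<theta> \<in> space (angles n)"
    then have "\<theta> k \<in> {0..<2 * pi}" if "k < n" for k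
      using that by (auto simp: space_angles PiE_iff)
    then have "(\<Prod>k<n. cnj (jac a b (\<theta> k))) = (\<Prod>k<n. jac (cnj b) (cnj a) (\<theta> k))"
      by (intro prod.cong refl cnj_jac) auto
    then show "cnj (morris_weight n (of_real l) a b \<theta>) = morris_weight n (of_real l) (cnj b) (cnj a) \<theta>"
      using powr_of_real[OF vand_nonneg, of n \<theta> "2 * l"] by (simp add: morris_weight_def)
  qed
  finally show ?thesis .
qed

text \<open>
  Complex conjugation exchanges the roles of the two exponents.
\<close>

lemma morris_shift_left:
  assumes l: "l \<ge> 1" and ab: "Re (a + b) \<ge> 0"
  shows "morris n (of_real l) (a + 1) b * (\<Prod>j<n. a + 1 + of_real l * of_nat j)
       = morris n (of_real l) a b * (\<Prod>j<n. a + b + 1 + of_real l * of_nat j)"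
proof -
  have "cnj (morris n (of_real l) (a + 1) b * (\<Prod>j<n. a + 1 + of_real l * of_nat j))
      = cnj (morris n (of_real l) a b * (\<Prod>j<n. a + b + 1 + of_real l * of_nat j))"
    using morris_shift_right[OF l, of "cnj b" "cnj a" n] ab
    by (simp add: cnj_morris cnj_prod add.commute add.left_commute)
  then show ?thesis by (simp only: complex_cnj_cancel_iff)
qed

lemma morris_shift_both_large:
  assumes l: "l \<ge> 1" and ab: "Re (a + b) \<ge> 0"
  shows "morris n (of_real l) (a + 1) (b + 1) * ((\<Prod>j<n. a + 1 + of_real l * of_nat j) * (\<Prod>j<n. b + 1 + of_real l * of_nat j))
       = morris n (of_real l) a b * ((\<Prod>j<n. a + b + 1 + of_real l * of_nat j) * (\<Prod>j<n. a + b + 2 + of_real l * of_nat j))"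
proof -
  \<comment> \<open>Raise \<open>b\<close> at the exponent \<open>a + 1\<close>, then \<open>a\<close>.\<close>
  have "morris n (of_real l) (a + 1) (b + 1) * (\<Prod>j<n. b + 1 + of_real l * of_nat j)
     = morris n (of_real l) (a + 1) b * (\<Prod>j<n. a + b + 2 + of_real l * of_nat j)"
    using morris_shift_right[OF l, of "a + 1" b n] ab by (simp add: algebra_simps)
  then have "morris n (of_real l) (a + 1) (b + 1) * ((\<Prod>j<n. a + 1 + of_real l * of_nat j) * (\<Prod>j<n. b + 1 + of_real l * of_nat j))
     = (morris n (of_real l) (a + 1) b * (\<Prod>j<n. a + 1 + of_real l * of_nat j)) * (\<Prod>j<n. a + b + 2 + of_real l * of_nat j)"
    by (simp only: mult.assoc mult.left_commute[of _ "\<Prod>j<n. a + 1 + of_real l * of_nat j"])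
  then show ?thesis
    unfolding morris_shift_left[OF l ab, of n] by (simp only: mult.assoc)
qed

text \<open>
  In the applications, \<open>f\<close> is the difference of two functions that agree for real arguments.
\<close>

lemma identity_theorem_half_plane:
  assumes f: "f holomorphic_on {z. Re z > c}" and pq: "c \<le> p" "p < q"
    and z: "\<And>x. p < x \<Longrightarrow> x < q \<Longrightarrow> f (of_real x) = 0" and w: "Re w > c"
  shows "f w = 0"
proof (rule analytic_continuation[OF f open_halfspace_Re_gt, of "of_real ` {p<..<q}" "of_real ((p + q) / 2)"])
  show "connected {z. Re z > c}" by (intro convex_connected convex_halfspace_Re_gt)
  show "of_real ((p + q) / 2) islimpt complex_of_real ` {p<..<q}"
    unfolding islimpt_approachable
  proof (intro allI impI)
    fix e :: real assume "e > 0"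
    define d where "d = min (e / 2) ((q - p) / 4)"
    have d: "d > 0" "d < e" "d < (q - p) / 2" using \<open>e > 0\<close> pq by (auto simp: d_def min_def)
    define x where "x = (p + q) / 2 + d"
    have "x \<in> {p<..<q}" "x \<noteq> (p + q) / 2" using d pq by (auto simp: x_def field_simps)
    moreover have "dist (complex_of_real x) (of_real ((p + q) / 2)) < e"
      unfolding dist_norm of_real_diff[symmetric] norm_of_real using d by (simp add: x_def)
    ultimately show "\<exists>x'\<in>complex_of_real ` {p<..<q}. x' \<noteq> of_real ((p + q) / 2) \<and> dist x' (of_real ((p + q) / 2)) < e"
      unfolding of_real_eq_iff[symmetric, where 'a = complex] by blast
  qed
qed (use pq z w in auto)

text \<open>
  As a function of the coupling, the weight is an exponential with exponent \<open>2 l ln (vand n \<theta>)\<close>, except on the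
  zero set of the Vandermonde factor, where it vanishes.
\<close>

lemma morris_holomorphic_in_coupling:
  assumes ab: "Re (a + b) \<ge> 0"
  shows "(\<lambda>l. morris n l a b) holomorphic_on {l. Re l > 0}"
proof -
  define g where "g \<theta> = (if vand n \<theta> = 0 then 0 else \<Prod>k<n. jac a b (\<theta> k))" for \<theta>
  have jm: "(\<lambda>\<theta>. \<Prod>k<n. jac a b (\<theta> k)) \<in> borel_measurable (angles n)"
    by (intro borel_measurable_prod measurable_compose[OF angle_measurable jac_measurable]) auto
  have eq: "morris_weight n l a b \<theta> = exp (l * of_real (2 * ln (vand n \<theta>))) * g \<theta>" for l \<theta>
    by (simp add: morris_weight_def g_def powr_def Ln_of_real vand_nonneg less_le mult_ac)
  have m1: "(\<lambda>\<theta>. 2 * ln (vand n \<theta>)) \<in> borel_measurable (angles n)" by measurable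
  have m2: "g \<in> borel_measurable (angles n)" unfolding g_def using jm by measurable
  have "(\<lambda>l. \<integral>\<theta>. exp (l * of_real (2 * ln (vand n \<theta>))) * g \<theta> \<partial>angles n) holomorphic_on {l. Re l > 0}"
  proof (rule mgf_holomorphic[OF m1 m2])
    fix x :: real assume x: "x > 0"
    have "integrable (angles n) (morris_weight n (of_real x) a b)"
      using x ab by (intro angles_integrable_bounded[OF morris_weight_measurable morris_weight_bounded]) auto
    then have "integrable (angles n) (\<lambda>\<theta>. norm (morris_weight n (of_real x) a b \<theta>))" by simp
    then show "integrable (angles n) (\<lambda>\<theta>. exp (x * (2 * ln (vand n \<theta>))) * norm (g \<theta>))"
      by (simp add: eq norm_mult norm_exp_eq_Re)
  qed
  then show ?thesis
    unfolding morris_def eq .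
qed

text \<open>
  For small couplings the weight is not differentiable at coinciding angles, and integration by parts would
  require singular integrals. Analytic continuation in the coupling avoids them.
\<close>

lemma morris_shift_both:
  assumes l: "l > 0" and ab: "Re (a + b) \<ge> 0"
  shows "morris n (of_real l) (a + 1) (b + 1) * ((\<Prod>j<n. a + 1 + of_real l * of_nat j) * (\<Prod>j<n. b + 1 + of_real l * of_nat j))
       = morris n (of_real l) a b * ((\<Prod>j<n. a + b + 1 + of_real l * of_nat j) * (\<Prod>j<n. a + b + 2 + of_real l * of_nat j))"
proof -
  let ?f = "\<lambda>l. morris n l (a + 1) (b + 1) * ((\<Prod>j<n. a + 1 + l * of_nat j) * (\<Prod>j<n. b + 1 + l * of_nat j))
       - morris n l a b * ((\<Prod>j<n. a + b + 1 + l * of_nat j) * (\<Prod>j<n. a + b + 2 + l * of_nat j))"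
  have "?f (of_real l) = 0"
  proof (rule identity_theorem_half_plane[of ?f 0 1 2 "of_real l"])
    show "?f holomorphic_on {l. Re l > 0}"
      using ab by (intro holomorphic_intros morris_holomorphic_in_coupling) auto
    show "?f (of_real x) = 0" if "1 < x" "x < 2" for x
      using morris_shift_both_large[OF _ ab, of x n] that by simp
  qed (use l in auto)
  then show ?thesis by simp
qed

section \<open>The Morris integral along a line of exponents\<close>

lemma sin_ge_third:
  assumes "0 \<le> x" "x \<le> pi / 2"
  shows "x / 3 \<le> sin x"
proof -
  \<comment> \<open>On \<open>[0, 2]\<close> the cubic Taylor term is at most \<open>2 x / 3\<close>.\<close>
  have x2: "x \<le> 2" using assms pi_less_4 by linarith
  have "\<bar>sin x - (\<Sum>m<3. sin_coeff m * x ^ m)\<bar> \<le> inverse (fact 3) * \<bar>x\<bar> ^ 3"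
    by (rule Maclaurin_sin_bound)
  then have "\<bar>sin x - x\<bar> \<le> x ^ 3 / 6"
    using assms by (simp add: sin_coeff_def eval_nat_numeral divide_simps)
  moreover have "x ^ 3 / 6 \<le> 2 * x / 3"
  proof -
    have "x * x \<le> 2 * 2" using assms x2 by (intro mult_mono) auto
    then have "x * (x * x) \<le> x * 4" using assms by (intro mult_left_mono) auto
    then show ?thesis by (simp add: eval_nat_numeral)
  qed
  ultimately show ?thesis by linarith
qed

lemma powr_integrable_near_0:
  assumes "s > -1" "c \<ge> 0"
  shows "integrable lborel (\<lambda>t::real. indicator {0..c} t * t powr s)"
proof (rule integrableI_nonneg)
  have "((\<lambda>t. t powr s) has_integral c powr (s + 1) / (s + 1)) {0..c}"
    by (rule has_integral_powr_from_0) (use assms in auto)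
  then have "((\<lambda>t. if t \<in> {0..c} then t powr s else 0) has_integral c powr (s + 1) / (s + 1)) UNIV"
    by (simp only: has_integral_restrict_UNIV)
  also have "(\<lambda>t. if t \<in> {0..c} then t powr s else 0) = (\<lambda>t. indicator {0..c} t * t powr s)"
    by auto
  finally have "((\<lambda>t. indicator {0..c} t * t powr s) has_integral c powr (s + 1) / (s + 1)) UNIV" .
  from nn_integral_has_integral_lborel[OF _ _ this] have "(\<integral>\<^sup>+t. ennreal (indicator {0..c} t * t powr s) \<partial>lborel) = ennreal (c powr (s + 1) / (s + 1))"
    by auto
  then show "(\<integral>\<^sup>+t. ennreal (indicator {0..c} t * t powr s) \<partial>lborel) < \<infinity>" by simp
qed auto

lemma not_nonpos_Ints_Re: "Re z > 0 \<Longrightarrow> z \<notin> \<int>\<^sub>\<le>\<^sub>0"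
  by (auto elim!: nonpos_Ints_cases)

definition ln_chord :: "real \<Rightarrow> real" where
  "ln_chord t = ln (2 * sin (t / 2))"

text \<open>
  Near either end of the interval \<open>2 sin (t / 2)\<close> is bounded below by a multiple of the distance to that end, so
  the singularity is integrable for exponents above \<open>-1\<close>.
\<close>

lemma chord_powr_integrable:
  assumes s: "s > -1"
  shows "integrable circ (\<lambda>t. if t = 0 then 0 else exp (s * ln_chord t))"
proof -
  define f where "f t = indicator {0..2 * pi} t * t powr s" for t :: real
  have fi: "integrable lborel f"
    unfolding f_def by (rule powr_integrable_near_0) (use s in auto)
  have fi2: "integrable lborel (\<lambda>t. f (2 * pi + (-1) * t))"
    by (rule lborel_integrable_real_affine[OF fi]) simp
  define B where "B t = 2 powr s + 3 powr (- s) * f t + 3 powr (- s) * f (2 * pi + (-1) * t)" for t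
  have "integrable lborel (\<lambda>t. indicator {0..<2 * pi} t *\<^sub>R (2 powr s))"
    by (intro integrable_scaleR_left integrable_real_indicator) auto
  then have Bi: "integrable lborel (\<lambda>t. indicator {0..<2 * pi} t *\<^sub>R B t)"
    unfolding B_def scaleR_add_right
    by (intro Bochner_Integration.integrable_add integrable_mult_indicator[OF _ integrable_mult_right] fi fi2) auto
  have m: "(\<lambda>t. if t = 0 then 0 else exp (s * ln_chord t)) \<in> borel_measurable borel"
    unfolding ln_chord_def by measurable
  show ?thesis
  proof (subst integrable_restrict_space)
    show "integrable lborel (\<lambda>t. indicator {0..<2 * pi} t *\<^sub>R (if t = 0 then 0 else exp (s * ln_chord t)))"
    proof (rule Bochner_Integration.integrable_bound[OF Bi])
      have "norm (indicator {0..<2 * pi} t *\<^sub>R (if t = 0 then 0 else exp (s * ln_chord t))) \<le> norm (indicator {0..<2 * pi} t *\<^sub>R B t)" for t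
      proof (cases "0 < t \<and> t < 2 * pi")
        case True
        have sp: "sin (t / 2) > 0" using True by (intro sin_gt_zero) auto
        have e: "exp (s * ln_chord t) = (2 * sin (t / 2)) powr s"
          using sp by (simp add: ln_chord_def powr_def)
        have f1: "f t = t powr s" "f (2 * pi + (-1) * t) = (2 * pi - t) powr s"
          using True by (auto simp: f_def)
        have "(2 * sin (t / 2)) powr s \<le> B t"
        proof (cases "s \<ge> 0")
          case s0: True
          have "(2 * sin (t / 2)) powr s \<le> 2 powr s"
            using sp s0 by (intro powr_mono2) auto
          then show ?thesis unfolding B_def f1 by (smt (verit) mult_nonneg_nonneg powr_ge_zero)
        next
          case s0: False
          define u where "u = min t (2 * pi - t)"
          have u: "u > 0" using True by (simp add: u_def)
          have "u / 3 \<le> 2 * sin (t / 2)"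
          proof (cases "t \<le> pi")
            case True
            then show ?thesis using sin_ge_third[of "t / 2"] \<open>0 < t \<and> _\<close> by (simp add: u_def)
          next
            case False
            have "sin (pi - t / 2) = sin (t / 2)" by simp
            moreover have "(pi - t / 2) / 3 \<le> sin (pi - t / 2)"
              using False \<open>0 < t \<and> _\<close> by (intro sin_ge_third) auto
            ultimately show ?thesis using False by (simp add: u_def field_simps)
          qed
          then have "(2 * sin (t / 2)) powr s \<le> (u / 3) powr s"
            using u s0 by (intro powr_mono2') auto
          also have "\<dots> = 3 powr (- s) * u powr s"
            using u by (simp add: powr_divide powr_minus divide_simps)
          also have "\<dots> \<le> B t"
            unfolding B_def f1 u_def min_def by (auto simp: powr_ge_zero)
          finally show ?thesis .
        qed
        moreover have "B t \<ge> 0" unfolding B_def f1 by simp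
        ultimately show ?thesis using True e by simp
      next
        case False
        then show ?thesis by (auto simp: indicator_def)
      qed
      then show "AE t in lborel. norm (indicator {0..<2 * pi} t *\<^sub>R (if t = 0 then 0 else exp (s * ln_chord t))) \<le> norm (indicator {0..<2 * pi} t *\<^sub>R B t)"
        by simp
    qed (intro borel_measurable_scaleR borel_measurable_indicator, use m in simp_all)
  qed simp
qed

context
  fixes n :: nat and l \<eta> :: real
begin

definition log_abs :: "(nat \<Rightarrow> real) \<Rightarrow> real" where
  "log_abs \<theta> = (\<Sum>k<n. ln_chord (\<theta> k))"

text \<open>
  The part of the weight that stays the same when \<open>a + b = s\<close> varies and \<open>a - b = 2 \<i> \<eta>\<close> is fixed.
\<close>

definition tilt :: "(nat \<Rightarrow> real) \<Rightarrow> real" where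
  "tilt \<theta> = vand n \<theta> powr (2 * l) * (\<Prod>k<n. if \<theta> k = 0 then 0 else exp (- \<eta> * (pi - \<theta> k)))"

definition line_morris :: "complex \<Rightarrow> complex" where
  "line_morris s = morris n (of_real l) (s / 2 + \<i> * of_real \<eta>) (s / 2 - \<i> * of_real \<eta>)"

text \<open>
  The product of the chords is at most \<open>2 ^ n\<close>; after division by this bound the integral decreases in \<open>s\<close>.
\<close>

definition line_mgf :: "real \<Rightarrow> real" where
  "line_mgf s = (\<integral>\<theta>. exp (s * (log_abs \<theta> - n * ln 2)) * tilt \<theta> \<partial>angles n)"

text \<open>
  The dependence on \<open>s\<close> of the closed form of the Morris integral.
\<close>

definition line_gamma :: "complex \<Rightarrow> complex" where
  "line_gamma s = (\<Prod>j<n. Gamma (1 + s + of_real l * of_nat j) * rGamma (1 + s / 2 + \<i> * of_real \<eta> + of_real l * of_nat j)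
      * rGamma (1 + s / 2 - \<i> * of_real \<eta> + of_real l * of_nat j))"

lemma log_abs_measurable: "log_abs \<in> borel_measurable (angles n)"
proof -
  have "ln_chord \<in> borel_measurable borel" unfolding ln_chord_def by measurable
  then show ?thesis
    unfolding log_abs_def[abs_def]
    by (intro borel_measurable_sum measurable_compose[OF angle_measurable]) auto
qed

lemma log_abs_le:
  assumes "\<theta> \<in> space (angles n)"
  shows "log_abs \<theta> \<le> n * ln 2"
proof -
  have "ln_chord (\<theta> k) \<le> ln 2" if "k < n" for k
  proof -
    have "sin (\<theta> k / 2) \<ge> 0"
    proof (rule sin_ge_zero)
      have "\<theta> k \<in> {0..<2 * pi}" using assms that by (auto simp: space_angles PiE_iff)
      then show "0 \<le> \<theta> k / 2" "\<theta> k / 2 \<le> pi" by auto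
    qed
    then consider "sin (\<theta> k / 2) = 0" | "sin (\<theta> k / 2) > 0" by linarith
    then show ?thesis by cases (simp_all add: ln_chord_def)
  qed
  then have "log_abs \<theta> \<le> (\<Sum>k<n. ln 2)" unfolding log_abs_def by (intro sum_mono) auto
  then show ?thesis by simp
qed

lemma tilt_nonneg: "tilt \<theta> \<ge> 0"
  unfolding tilt_def by (intro mult_nonneg_nonneg prod_nonneg) auto

lemma tilt_measurable: "tilt \<in> borel_measurable (angles n)"
proof -
  have "(\<lambda>t. if t = 0 then 0 else exp (- \<eta> * (pi - t))) \<in> borel_measurable borel" by measurable
  from measurable_compose[OF angle_measurable this]
  have "(\<lambda>\<theta>. \<Prod>k<n. if \<theta> k = 0 then 0 else exp (- \<eta> * (pi - \<theta> k))) \<in> borel_measurable (angles n)"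
    by (intro borel_measurable_prod) auto
  then show ?thesis unfolding tilt_def[abs_def] by measurable
qed

lemma morris_weight_line:
  assumes "\<theta> \<in> space (angles n)"
  shows "morris_weight n (of_real l) (s / 2 + \<i> * of_real \<eta>) (s / 2 - \<i> * of_real \<eta>) \<theta> = exp (s * of_real (log_abs \<theta>)) * of_real (tilt \<theta>)"
proof -
  have j: "jac (s / 2 + \<i> * of_real \<eta>) (s / 2 - \<i> * of_real \<eta>) t
     = exp (s * of_real (ln_chord t)) * of_real (if t = 0 then 0 else exp (- \<eta> * (pi - t)))"
    if "t \<in> {0..<2 * pi}" for t
  proof (cases "t = 0")
    case False
    then have "jac (s / 2 + \<i> * of_real \<eta>) (s / 2 - \<i> * of_real \<eta>) t = exp (s * of_real (ln_chord t) + of_real (- \<eta> * (pi - t)))"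
    proof -
      have "(s / 2 + \<i> * of_real \<eta> - (s / 2 - \<i> * of_real \<eta>)) * \<i> * of_real ((pi - t) / 2) = of_real (- \<eta> * (pi - t))"
        by (simp add: complex_eq_iff)
      then show ?thesis
        using that False unfolding ln_chord_def by (subst jac_exp) auto
    qed
    then show ?thesis using False by (simp only: exp_add exp_of_real if_False)
  qed (simp add: jac_zero)
  have "(\<Prod>k<n. jac (s / 2 + \<i> * of_real \<eta>) (s / 2 - \<i> * of_real \<eta>) (\<theta> k))
      = (\<Prod>k<n. exp (s * of_real (ln_chord (\<theta> k))) * of_real (if \<theta> k = 0 then 0 else exp (- \<eta> * (pi - \<theta> k))))"
    using assms by (intro prod.cong refl j) (auto simp: space_angles PiE_iff)
  also have "\<dots> = exp (s * of_real (log_abs \<theta>)) * of_real (\<Prod>k<n. if \<theta> k = 0 then 0 else exp (- \<eta> * (pi - \<theta> k)))"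
    by (simp add: prod.distrib log_abs_def exp_sum sum_distrib_left)
  finally show ?thesis
    using powr_of_real[OF vand_nonneg, of n \<theta> "2 * l"] by (simp add: morris_weight_def tilt_def)
qed

lemma line_morris_eq: "line_morris s = (\<integral>\<theta>. exp (s * of_real (log_abs \<theta>)) * of_real (tilt \<theta>) \<partial>angles n)"
  unfolding line_morris_def morris_def
  by (rule Bochner_Integration.integral_cong[OF refl morris_weight_line])

lemma line_mgf_nonneg: "line_mgf s \<ge> 0"
  unfolding line_mgf_def by (intro integral_nonneg_AE AE_I2 mult_nonneg_nonneg tilt_nonneg) auto

lemma line_morris_real: "line_morris (of_real s) = exp (of_real (s * (n * ln 2))) * of_real (line_mgf s)"
proof -
  have "line_morris (of_real s) = (\<integral>\<theta>. complex_of_real (exp (s * (n * ln 2)) * (exp (s * (log_abs \<theta> - n * ln 2)) * tilt \<theta>)) \<partial>angles n)"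
    unfolding line_morris_eq
    by (intro Bochner_Integration.integral_cong refl) (simp add: exp_of_real[symmetric] exp_add[symmetric] algebra_simps)
  also have "\<dots> = of_real (exp (s * (n * ln 2)) * line_mgf s)"
    unfolding line_mgf_def integral_complex_of_real by simp
  finally show ?thesis by (simp only: exp_of_real of_real_mult[of "exp _"])
qed

context
  assumes l: "l > 0"
begin

lemma tilted_exp_integrable:
  assumes "s > -1"
  shows "integrable (angles n) (\<lambda>\<theta>. exp (s * log_abs \<theta>) * tilt \<theta>)"
proof -
  let ?f = "\<lambda>t. if t = 0 then 0 else exp (s * ln_chord t)"
  have i: "integrable (angles n) (\<lambda>\<theta>. (2 ^ (n * n)) powr (2 * l) * exp (\<bar>\<eta>\<bar> * pi) ^ n * (\<Prod>k<n. ?f (\<theta> k)))"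
    unfolding angles_def
    by (intro integrable_mult_right circ.product_integrable_prod chord_powr_integrable assms) auto
  show ?thesis
  proof (rule Bochner_Integration.integrable_bound[OF i])
    show "AE \<theta> in angles n. norm (exp (s * log_abs \<theta>) * tilt \<theta>) \<le> norm ((2 ^ (n * n)) powr (2 * l) * exp (\<bar>\<eta>\<bar> * pi) ^ n * (\<Prod>k<n. ?f (\<theta> k)))"
    proof (rule AE_I2)
      fix \<theta> assume \<theta>: "\<theta> \<in> space (angles n)"
      have "exp (s * log_abs \<theta>) * tilt \<theta> = vand n \<theta> powr (2 * l) * (\<Prod>k<n. ?f (\<theta> k) * exp (- \<eta> * (pi - \<theta> k)))"
      proof -
        have "exp (s * log_abs \<theta>) * (\<Prod>k<n. if \<theta> k = 0 then 0 else exp (- \<eta> * (pi - \<theta> k)))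
           = (\<Prod>k<n. exp (s * ln_chord (\<theta> k)) * (if \<theta> k = 0 then 0 else exp (- \<eta> * (pi - \<theta> k))))"
          by (simp add: log_abs_def exp_sum sum_distrib_left prod.distrib)
        also have "\<dots> = (\<Prod>k<n. ?f (\<theta> k) * exp (- \<eta> * (pi - \<theta> k)))"
          by (intro prod.cong) auto
        finally show ?thesis by (simp add: tilt_def)
      qed
      also have "\<dots> \<le> (2 ^ (n * n)) powr (2 * l) * (\<Prod>k<n. ?f (\<theta> k) * exp (\<bar>\<eta>\<bar> * pi))"
      proof (intro mult_mono prod_mono conjI powr_mono2 vand_le vand_nonneg)
        fix k assume "k \<in> {..<n}"
        then have "\<theta> k \<in> {0..<2 * pi}" using \<theta> by (auto simp: space_angles PiE_iff)
        then have "\<bar>pi - \<theta> k\<bar> \<le> pi" by auto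
        then have "\<bar>\<eta>\<bar> * \<bar>pi - \<theta> k\<bar> \<le> \<bar>\<eta>\<bar> * pi" by (intro mult_left_mono) auto
        then have "- \<eta> * (pi - \<theta> k) \<le> \<bar>\<eta>\<bar> * pi"
          using abs_ge_minus_self[of "\<eta> * (pi - \<theta> k)"] by (simp add: abs_mult)
        then show "exp (- \<eta> * (pi - \<theta> k)) \<le> exp (\<bar>\<eta>\<bar> * pi)" by simp
      qed (use l in \<open>auto intro!: prod_nonneg mult_nonneg_nonneg\<close>)
      finally show "norm (exp (s * log_abs \<theta>) * tilt \<theta>) \<le> norm ((2 ^ (n * n)) powr (2 * l) * exp (\<bar>\<eta>\<bar> * pi) ^ n * (\<Prod>k<n. ?f (\<theta> k)))"
        using tilt_nonneg[of \<theta>] by (simp add: prod.distrib mult_ac abs_mult abs_prod prod_nonneg)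
    qed
  qed (use log_abs_measurable tilt_measurable in measurable)
qed

lemma line_morris_holomorphic: "line_morris holomorphic_on {s. Re s > -1}"
proof -
  have m: "(\<lambda>\<theta>. complex_of_real (tilt \<theta>)) \<in> borel_measurable (angles n)"
    using tilt_measurable by measurable
  show ?thesis
    unfolding line_morris_eq[abs_def]
    by (rule mgf_holomorphic[OF log_abs_measurable m])
       (use tilted_exp_integrable tilt_nonneg in \<open>simp add: abs_of_nonneg\<close>)
qed

lemma line_mgf_integrable: "s > -1 \<Longrightarrow> integrable (angles n) (\<lambda>\<theta>. exp (s * (log_abs \<theta> - n * ln 2)) * tilt \<theta>)"
proof -
  assume "s > -1"
  from integrable_mult_right[OF tilted_exp_integrable[OF this], of "exp (- (s * (n * ln 2)))"]
  show ?thesis by (simp add: right_diff_distrib exp_diff exp_minus divide_simps mult_ac)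
qed

lemma line_mgf_antimono:
  assumes "-1 < s" "s \<le> s'"
  shows "line_mgf s' \<le> line_mgf s"
  unfolding line_mgf_def
proof (intro integral_mono line_mgf_integrable mult_right_mono tilt_nonneg)
  fix \<theta> assume "\<theta> \<in> space (angles n)"
  from log_abs_le[OF this] show "exp (s' * (log_abs \<theta> - n * ln 2)) \<le> exp (s * (log_abs \<theta> - n * ln 2))"
    using assms by (simp add: mult_right_mono_neg)
qed (use assms in auto)

lemma Re_shift_pos: "Re s > -1 \<Longrightarrow> Re (1 + s + of_real l * of_nat j) > 0"
  "Re s > -1 \<Longrightarrow> Re (1 + s / 2 + \<i> * of_real \<eta> + of_real l * of_nat j) > 0"
  "Re s > -1 \<Longrightarrow> Re (1 + s / 2 - \<i> * of_real \<eta> + of_real l * of_nat j) > 0"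
proof -
  assume s: "Re s > -1"
  have "l * real j \<ge> 0" using l by simp
  then show "Re (1 + s + of_real l * of_nat j) > 0"
  "Re (1 + s / 2 + \<i> * of_real \<eta> + of_real l * of_nat j) > 0"
  "Re (1 + s / 2 - \<i> * of_real \<eta> + of_real l * of_nat j) > 0" using s by simp_all
qed

lemma line_gamma_holomorphic: "line_gamma holomorphic_on {s. Re s > -1}"
  unfolding line_gamma_def[abs_def]
  by (intro holomorphic_intros holomorphic_on_compose_gen[of _ _ Gamma UNIV, unfolded o_def] not_nonpos_Ints_Re Re_shift_pos) (auto)

lemma line_gamma_nonzero:
  assumes s: "Re s > -1"
  shows "line_gamma s \<noteq> 0"
proof -
  note nn = Re_shift_pos[OF s, THEN not_nonpos_Ints_Re]
  show ?thesis
    unfolding line_gamma_def using nn by (simp add: Gamma_eq_zero_iff rGamma_eq_zero_iff)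
qed

lemma line_gamma_plus2:
  assumes s: "Re s > -1"
  shows "line_gamma (s + 2) * ((\<Prod>j<n. s / 2 + \<i> * of_real \<eta> + 1 + of_real l * of_nat j) * (\<Prod>j<n. s / 2 - \<i> * of_real \<eta> + 1 + of_real l * of_nat j))
       = line_gamma s * ((\<Prod>j<n. s + 1 + of_real l * of_nat j) * (\<Prod>j<n. s + 2 + of_real l * of_nat j))"
  unfolding line_gamma_def prod.distrib[symmetric]
proof (rule prod.cong[OF refl])
  fix j assume "j \<in> {..<n}"
  let ?x = "1 + s + of_real l * of_nat j" and ?u = "1 + s / 2 + \<i> * of_real \<eta> + of_real l * of_nat j"
    and ?v = "1 + s / 2 - \<i> * of_real \<eta> + of_real l * of_nat j"
  have nz: "?x \<notin> \<int>\<^sub>\<le>\<^sub>0" "?x + 1 \<notin> \<int>\<^sub>\<le>\<^sub>0" "?u \<notin> \<int>\<^sub>\<le>\<^sub>0" "?v \<notin> \<int>\<^sub>\<le>\<^sub>0"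
    using Re_shift_pos[OF s, of j] by (auto intro!: not_nonpos_Ints_Re)
  have e: "1 + (s + 2) + of_real l * of_nat j = ?x + 1 + 1" "1 + (s + 2) / 2 + \<i> * of_real \<eta> + of_real l * of_nat j = ?u + 1"
     "1 + (s + 2) / 2 - \<i> * of_real \<eta> + of_real l * of_nat j = ?v + 1"
    by (simp_all add: algebra_simps)
  have g: "Gamma (?x + 1 + 1) = (?x + 1) * (?x * Gamma ?x)"
    by (simp only: Gamma_plus1[OF nz(2)] Gamma_plus1[OF nz(1)])
  have r: "rGamma (?u + 1) * ?u = rGamma ?u" "rGamma (?v + 1) * ?v = rGamma ?v"
    by (simp_all only: mult.commute[of "rGamma _"] rGamma_plus1)
  have "Gamma (?x + 1 + 1) * rGamma (?u + 1) * rGamma (?v + 1) * (?u * ?v) = Gamma (?x + 1 + 1) * (rGamma (?u + 1) * ?u) * (rGamma (?v + 1) * ?v)"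
    by (simp only: mult_ac)
  also have "\<dots> = Gamma ?x * rGamma ?u * rGamma ?v * (?x * (?x + 1))"
    unfolding r g by (simp only: mult_ac)
  finally have *: "Gamma (?x + 1 + 1) * rGamma (?u + 1) * rGamma (?v + 1) * (?u * ?v) = Gamma ?x * rGamma ?u * rGamma ?v * (?x * (?x + 1))" .
  show "Gamma (1 + (s + 2) + of_real l * of_nat j) * rGamma (1 + (s + 2) / 2 + \<i> * of_real \<eta> + of_real l * of_nat j) *
       rGamma (1 + (s + 2) / 2 - \<i> * of_real \<eta> + of_real l * of_nat j) *
       ((s / 2 + \<i> * of_real \<eta> + 1 + of_real l * of_nat j) * (s / 2 - \<i> * of_real \<eta> + 1 + of_real l * of_nat j)) =
       Gamma ?x * rGamma ?u * rGamma ?v * ((s + 1 + of_real l * of_nat j) * (s + 2 + of_real l * of_nat j))"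
  proof -
    have "s / 2 + \<i> * of_real \<eta> + 1 + of_real l * of_nat j = ?u" "s / 2 - \<i> * of_real \<eta> + 1 + of_real l * of_nat j = ?v"
      "s + 1 + of_real l * of_nat j = ?x" "s + 2 + of_real l * of_nat j = ?x + 1"
      by simp_all
    then show ?thesis unfolding e using * by (simp only:)
  qed
qed

text \<open>
  Raising \<open>s\<close> by 2 raises both exponents of the Morris integral by 1, so \<open>morris_shift_both\<close> applies, and the
  functional equation of the gamma function yields the same factor.
\<close>

lemma line_ratio_periodic:
  assumes "s \<ge> 0"
  shows "line_morris (of_real (s + 2)) / line_gamma (of_real (s + 2)) = line_morris (of_real s) / line_gamma (of_real s)"
proof -
  let ?a = "of_real s / 2 + \<i> * of_real \<eta>" and ?b = "of_real s / 2 - \<i> * of_real \<eta>"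
  let ?P = "(\<Prod>j<n. ?a + 1 + of_real l * of_nat j) * (\<Prod>j<n. ?b + 1 + of_real l * of_nat j)"
  let ?Q = "(\<Prod>j<n. complex_of_real s + 1 + of_real l * of_nat j) * (\<Prod>j<n. of_real s + 2 + of_real l * of_nat j)"
  have e: "complex_of_real (s + 2) / 2 + \<i> * of_real \<eta> = ?a + 1" "complex_of_real (s + 2) / 2 - \<i> * of_real \<eta> = ?b + 1"
    by simp_all
  have 1: "line_morris (of_real (s + 2)) * ?P = line_morris (of_real s) * ?Q"
    unfolding line_morris_def e using morris_shift_both[OF l, of ?a ?b n] assms by simp
  have 2: "line_gamma (of_real (s + 2)) * ?P = line_gamma (of_real s) * ?Q"
    using line_gamma_plus2[of "of_real s"] assms by simp
  have nz: "line_gamma (of_real s) \<noteq> 0" "line_gamma (of_real (s + 2)) \<noteq> 0"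
    using assms by (auto intro!: line_gamma_nonzero)
  have P: "?P \<noteq> 0"
  proof -
    have "Re (?a + 1 + of_real l * of_nat j) > 0" "Re (?b + 1 + of_real l * of_nat j) > 0" for j
      using Re_shift_pos[of "of_real s" j] assms by (simp_all add: ac_simps)
    then have "?a + 1 + of_real l * of_nat j \<noteq> 0" "?b + 1 + of_real l * of_nat j \<noteq> 0" for j
      by (metis less_irrefl zero_complex.sel(1))+
    then show ?thesis by simp
  qed
  have "line_morris (of_real (s + 2)) * line_gamma (of_real s) * ?P = (line_morris (of_real (s + 2)) * ?P) * line_gamma (of_real s)"
    by (simp only: mult_ac)
  also have "\<dots> = line_morris (of_real s) * (line_gamma (of_real (s + 2)) * ?P)"
    unfolding 1 2 by (simp only: mult_ac)
  finally have "line_morris (of_real (s + 2)) * line_gamma (of_real s) * ?P = line_morris (of_real s) * line_gamma (of_real (s + 2)) * ?P"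
    by (simp only: mult_ac)
  then have "line_morris (of_real (s + 2)) * line_gamma (of_real s) = line_morris (of_real s) * line_gamma (of_real (s + 2))"
    using P by (simp only: mult_cancel_right) blast
  then show ?thesis using nz by (simp add: frac_eq_eq)
qed

end

end

section \<open>Evaluation of the Morris integral up to a constant\<close>

text \<open>
  Euler's limit formula, applied to numerator and denominator.
\<close>

lemma Gamma_ratio_asymptotics:
  fixes c s :: complex
  assumes c: "Re c > 0" and cs: "Re (c + s) > 0"
  shows "(\<lambda>m. Gamma (c + s + of_nat m) / (Gamma (c + of_nat m) * exp (s * of_real (ln (real m))))) \<longlonglongrightarrow> 1"
proof -
  have nn: "c \<notin> \<int>\<^sub>\<le>\<^sub>0" "c + s \<notin> \<int>\<^sub>\<le>\<^sub>0"
    using assms by (simp_all only: not_nonpos_Ints_Re not_False_eq_True)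
  have "(\<lambda>m. (Gamma (c + s) / Gamma_series (c + s) m) * (Gamma_series c m / Gamma c) * ((c + of_nat m) / (c + s + of_nat m))) \<longlonglongrightarrow>
      (Gamma (c + s) / Gamma (c + s)) * (Gamma c / Gamma c) * 1"
  proof (intro tendsto_intros)
    show "(\<lambda>m. (c + of_nat m) / (c + s + of_nat m)) \<longlonglongrightarrow> 1"
    proof -
      have "(\<lambda>m. (c / of_nat m + 1) / ((c + s) / of_nat m + 1)) \<longlonglongrightarrow> (0 + 1) / (0 + 1)"
        by (intro tendsto_intros tendsto_divide_0[OF tendsto_const] tendsto_of_nat) auto
      moreover have "\<forall>\<^sub>F m in sequentially. (c / of_nat m + 1) / ((c + s) / of_nat m + 1) = (c + of_nat m) / (c + s + of_nat m)"
      proof (rule eventually_mono[OF eventually_gt_at_top[of 0]])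
        fix m :: nat assume "m > 0"
        then have "c / of_nat m + 1 = (c + of_nat m) / of_nat m" "(c + s) / of_nat m + 1 = (c + s + of_nat m) / of_nat m"
          by (simp_all add: add_divide_distrib)
        then show "(c / of_nat m + 1) / ((c + s) / of_nat m + 1) = (c + of_nat m) / (c + s + of_nat m)"
          using \<open>m > 0\<close> by simp
      qed
      ultimately show ?thesis by (simp add: tendsto_cong)
    qed
  qed (use nn in \<open>auto simp: Gamma_eq_zero_iff Gamma_series_LIMSEQ\<close>)
  then have lim: "(\<lambda>m. (Gamma (c + s) / Gamma_series (c + s) m) * (Gamma_series c m / Gamma c) * ((c + of_nat m) / (c + s + of_nat m))) \<longlonglongrightarrow> 1"
    using nn by (simp add: Gamma_eq_zero_iff)
  show ?thesis
  proof (rule Lim_transform_eventually[OF lim], rule eventually_mono[OF eventually_gt_at_top[of 0]])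
    fix m :: nat assume m: "m > 0"
    have G: "Gamma (z + of_nat m) = Gamma z * fact m * exp (z * of_real (ln (real m))) / (Gamma_series z m * (z + of_nat m))"
      "Gamma_series z m \<noteq> 0" "z + of_nat m \<noteq> 0" if z: "Re z > 0" for z
    proof -
      have zn: "z \<notin> \<int>\<^sub>\<le>\<^sub>0" using z by (auto elim!: nonpos_Ints_cases)
      have "Re (z + of_nat m) > 0" using z by simp
      then show zm: "z + of_nat m \<noteq> 0" by (metis less_irrefl zero_complex.sel(1))
      have p: "pochhammer z m = Gamma (z + of_nat m) / Gamma z"
        by (rule pochhammer_Gamma[OF zn])
      have p0: "pochhammer z m \<noteq> 0"
        using zn by (metis pochhammer_eq_0_imp_nonpos_Int)
      have gs: "Gamma_series z m = fact m * exp (z * of_real (ln (real m))) / (pochhammer z m * (z + of_nat m))"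
        by (simp add: Gamma_series_def pochhammer_Suc)
      show gs0: "Gamma_series z m \<noteq> 0" unfolding gs using p0 zm by simp
      have "pochhammer z m * (Gamma_series z m * (z + of_nat m)) = fact m * exp (z * of_real (ln (real m)))"
        unfolding gs using p0 zm by simp
      then have "pochhammer z m = fact m * exp (z * of_real (ln (real m))) / (Gamma_series z m * (z + of_nat m))"
        using gs0 zm by (metis mult_eq_0_iff nonzero_eq_divide_eq)
      moreover have "Gamma (z + of_nat m) = Gamma z * pochhammer z m"
        using p zn by (simp add: Gamma_eq_zero_iff)
      ultimately show "Gamma (z + of_nat m) = Gamma z * fact m * exp (z * of_real (ln (real m))) / (Gamma_series z m * (z + of_nat m))"
        by simp
    qed
    have "Gamma c \<noteq> 0" using nn by (simp add: Gamma_eq_zero_iff)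
    then show "(Gamma (c + s) / Gamma_series (c + s) m) * (Gamma_series c m / Gamma c) * ((c + of_nat m) / (c + s + of_nat m))
      = Gamma (c + s + of_nat m) / (Gamma (c + of_nat m) * exp (s * of_real (ln (real m))))"
      unfolding G(1)[OF c] G(1)[OF cs] distrib_right[of c s "of_real (ln (real m))"] exp_add
      using G(2,3)[OF c] G(2,3)[OF cs] by (simp add: mult_ac)
  qed
qed

context
  fixes n :: nat and l \<eta> :: real
  assumes l: "l > 0"
begin

private abbreviation "K \<equiv> line_morris n l \<eta>"
private abbreviation "R \<equiv> line_gamma n l \<eta>"
private abbreviation "k \<equiv> line_mgf n l \<eta>"

text \<open>
  Each numerator has its argument shifted by \<open>2 m\<close> and contributes \<open>(2 m) powr s\<close>; the two denominators are shifted
  by \<open>m\<close> and contribute \<open>m powr (s / 2)\<close> each. What remains is \<open>2 powr s\<close> for each of the \<open>n\<close> factors.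
\<close>

lemma line_gamma_ratio_limit:
  assumes s: "s \<ge> 0"
  shows "(\<lambda>m. R (of_real (2 * real m + s)) / (R (of_real (2 * real m)) * exp (of_real (s * (n * ln 2))))) \<longlonglongrightarrow> 1"
proof -
  define c where "c j = 1 + complex_of_real l * of_nat j" for j
  define d where "d j = c j + \<i> * of_real \<eta>" for j
  define e where "e j = c j - \<i> * of_real \<eta>" for j
  have Rec: "Re (c j) > 0" "Re (d j) > 0" "Re (e j) > 0" for j
    using mult_nonneg_nonneg[of l "real j"] l by (auto simp: c_def d_def e_def add_pos_nonneg)
  let ?E = "\<lambda>x m. exp (complex_of_real x * of_real (ln (real m)))"
  have g: "(\<lambda>m. Gamma (z + of_real x + of_nat m) / (Gamma (z + of_nat m) * ?E x m)) \<longlonglongrightarrow> 1" if "Re z > 0" "x \<ge> 0" for z x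
    using that by (intro Gamma_ratio_asymptotics) auto
  have g2: "(\<lambda>m. Gamma (z + of_real x + of_nat (2 * m)) / (Gamma (z + of_nat (2 * m)) * ?E x (2 * m))) \<longlonglongrightarrow> 1" if "Re z > 0" "x \<ge> 0" for z x
    using filterlim_compose[OF g[OF that] mult_nat_left_at_top[of 2]] by simp
  have "(\<lambda>m. \<Prod>j<n. (Gamma (c j + of_real s + of_nat (2 * m)) / (Gamma (c j + of_nat (2 * m)) * ?E s (2 * m)))
      / ((Gamma (d j + of_real (s / 2) + of_nat m) / (Gamma (d j + of_nat m) * ?E (s / 2) m))
       * (Gamma (e j + of_real (s / 2) + of_nat m) / (Gamma (e j + of_nat m) * ?E (s / 2) m)))) \<longlonglongrightarrow> (\<Prod>j<n. 1 / (1 * 1))"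
    by (intro tendsto_prod tendsto_divide tendsto_mult g g2) (use Rec s in auto)
  then have lim: "(\<lambda>m. \<Prod>j<n. (Gamma (c j + of_real s + of_nat (2 * m)) / (Gamma (c j + of_nat (2 * m)) * ?E s (2 * m)))
      / ((Gamma (d j + of_real (s / 2) + of_nat m) / (Gamma (d j + of_nat m) * ?E (s / 2) m))
       * (Gamma (e j + of_real (s / 2) + of_nat m) / (Gamma (e j + of_nat m) * ?E (s / 2) m)))) \<longlonglongrightarrow> 1" by simp
  show ?thesis
  proof (rule Lim_transform_eventually[OF lim], rule eventually_mono[OF eventually_gt_at_top[of 0]])
    fix m :: nat assume m: "m > 0"
    have E: "?E s (2 * m) = exp (of_real (s * ln 2)) * ?E (s / 2) m * ?E (s / 2) m"
      using m by (simp add: ln_mult exp_add[symmetric] algebra_simps)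
    have r0: "R (of_real (2 * real m + x)) = (\<Prod>j<n. Gamma (c j + of_real x + of_nat (2 * m)) / (Gamma (d j + of_real (x / 2) + of_nat m) * Gamma (e j + of_real (x / 2) + of_nat m)))" for x
      unfolding line_gamma_def
      by (intro prod.cong refl) (simp add: c_def d_def e_def rGamma_inverse_Gamma field_simps)
    have "R (of_real (2 * real m)) = (\<Prod>j<n. Gamma (c j + of_nat (2 * m)) / (Gamma (d j + of_nat m) * Gamma (e j + of_nat m)))"
      using r0[of 0] by simp
    moreover have "exp (of_real (s * (n * ln 2))) = (\<Prod>j<n. exp (complex_of_real (s * ln 2)))"
      by (simp add: exp_of_nat_mult[symmetric] mult_ac)
    ultimately show "(\<Prod>j<n. (Gamma (c j + of_real s + of_nat (2 * m)) / (Gamma (c j + of_nat (2 * m)) * ?E s (2 * m)))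
      / ((Gamma (d j + of_real (s / 2) + of_nat m) / (Gamma (d j + of_nat m) * ?E (s / 2) m))
       * (Gamma (e j + of_real (s / 2) + of_nat m) / (Gamma (e j + of_nat m) * ?E (s / 2) m))))
     = R (of_real (2 * real m + s)) / (R (of_real (2 * real m)) * exp (of_real (s * (n * ln 2))))"
      unfolding r0 by (simp only: prod_dividef[symmetric] prod.distrib[symmetric] E) (intro prod.cong refl, simp)

  qed
qed

lemma line_ratio_periodic_iterate:
  assumes "s \<ge> 0"
  shows "K (of_real (2 * real m + s)) / R (of_real (2 * real m + s)) = K (of_real s) / R (of_real s)"
proof (induction m)
  case (Suc m)
  have "2 * real (Suc m) + s = (2 * real m + s) + 2" by simp
  then show ?case
    using line_ratio_periodic[OF l, of "2 * real m + s" n \<eta>] Suc assms by (simp only:)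
qed simp

text \<open>
  An argument in the style of Bohr and Mollerup. The quotient has period 2, so it may be evaluated at \<open>s + 2 m\<close>.
  The normalized integral is monotone, and over a full period its relative change tends to 0 because the gamma
  product has this property; hence it is asymptotically constant on the period, and so is the quotient.
\<close>

lemma line_ratio_constant:
  assumes s: "0 \<le> s" "s \<le> 2"
  shows "K (of_real s) / R (of_real s) = K 0 / R 0"
proof -
  define \<kappa> where "\<kappa> = K 0 / R 0"
  have Rnz: "R (of_real x) \<noteq> 0" if "x \<ge> 0" for x
    using that by (intro line_gamma_nonzero[OF l]) auto
  show ?thesis
  proof (cases "\<kappa> = 0")
    case True
    then have "K 0 = 0" using Rnz[of 0] by (simp add: \<kappa>_def)
    then have "k 0 = 0" using line_morris_real[of n l \<eta> 0] by simp
    then have "k s = 0"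
      using line_mgf_antimono[OF l, of 0 s n \<eta>] line_mgf_nonneg[of n l \<eta> s] s by simp
    then show ?thesis using True line_morris_real[of n l \<eta> s] by (simp add: \<kappa>_def)
  next
    case \<kappa>: False
    have Kk: "of_real (k x) = K (of_real x) / exp (of_real (x * (n * ln 2)))" for x
      by (simp add: line_morris_real)
    have km: "K (of_real (2 * real m)) = \<kappa> * R (of_real (2 * real m))" for m
    proof -
      have "K (of_real (2 * real m)) / R (of_real (2 * real m)) = \<kappa>"
        using line_ratio_periodic_iterate[of 0 m] by (simp only: add_0_right of_real_0 \<kappa>_def order.refl simp_thms)
      then show ?thesis
        by (metis Rnz nonzero_divide_eq_eq mult_nonneg_nonneg of_nat_0_le_iff zero_le_numeral)
    qed
    then have kmnz: "k (2 * real m) \<noteq> 0" for m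
      using \<kappa> Rnz[of "2 * real m"] Kk[of "2 * real m"] by auto
    have ratio: "complex_of_real (k (2 * real m + x) / k (2 * real m)) =
        (K (of_real (2 * real m + x)) / R (of_real (2 * real m + x))) / \<kappa> *
        (R (of_real (2 * real m + x)) / (R (of_real (2 * real m)) * exp (of_real (x * (n * ln 2)))))" if "x \<ge> 0" for m x
    proof -
      have "exp (complex_of_real ((2 * real m + x) * (n * ln 2))) = exp (of_real (2 * real m * (n * ln 2))) * exp (of_real (x * (n * ln 2)))"
        by (simp add: exp_add[symmetric] algebra_simps)
      then show ?thesis
        using Rnz[of "2 * real m + x"] Rnz[of "2 * real m"] \<kappa> that
        by (simp add: Kk km[of m, simplified])
    qed
    \<comment> \<open>Over a full period the quotient of \<open>K\<close> and \<open>R\<close> returns to its value, so the limit for \<open>R\<close> transfers to \<open>k\<close>.\<close>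
    have l2: "(\<lambda>m. k (2 * real m + 2) / k (2 * real m)) \<longlonglongrightarrow> 1"
    proof -
      have "(\<lambda>m. complex_of_real (k (2 * real m + 2) / k (2 * real m))) \<longlonglongrightarrow> 1"
      proof -
        have "K (of_real (2 * real m + 2)) / R (of_real (2 * real m + 2)) = \<kappa>" for m
          using line_ratio_periodic_iterate[of 0 "Suc m"] by (simp add: \<kappa>_def add.commute)
        then have "complex_of_real (k (2 * real m + 2) / k (2 * real m)) =
            R (of_real (2 * real m + 2)) / (R (of_real (2 * real m)) * exp (of_real (2 * (n * ln 2))))" for m
          using \<kappa> by (simp only: ratio[OF zero_le_numeral]) (simp only: divide_self_if if_False mult_1)
        then show ?thesis
          using line_gamma_ratio_limit[of 2] by (simp only: zero_le_numeral simp_thms)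
      qed
      then have "(\<lambda>m. complex_of_real (k (2 * real m + 2) / k (2 * real m))) \<longlonglongrightarrow> of_real 1" by simp
      then show ?thesis by (simp only: tendsto_of_real_iff)
    qed
    have pos: "k (2 * real m) > 0" for m
      using kmnz[of m] line_mgf_nonneg[of n l \<eta> "2 * real m"] by linarith
    \<comment> \<open>Within the period, monotonicity squeezes the ratio.\<close>
    have ls: "(\<lambda>m. k (2 * real m + s) / k (2 * real m)) \<longlonglongrightarrow> 1"
    proof (rule tendsto_sandwich[OF _ _ l2 tendsto_const])
      show "\<forall>\<^sub>F m in sequentially. k (2 * real m + 2) / k (2 * real m) \<le> k (2 * real m + s) / k (2 * real m)"
        using s pos by (intro always_eventually allI divide_right_mono line_mgf_antimono[OF l]) (auto simp: less_imp_le)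
      have "k (2 * real m + s) \<le> k (2 * real m)" for m
        using s by (intro line_mgf_antimono[OF l]) auto
      then show "\<forall>\<^sub>F m in sequentially. k (2 * real m + s) / k (2 * real m) \<le> 1"
        using pos by (intro always_eventually allI) (simp add: divide_le_eq)
    qed
    have "(\<lambda>m. complex_of_real (k (2 * real m + s) / k (2 * real m))) \<longlonglongrightarrow> of_real 1"
      using ls by (simp only: tendsto_of_real_iff)
    then have "(\<lambda>m. (K (of_real s) / R (of_real s)) / \<kappa> * (R (of_real (2 * real m + s)) / (R (of_real (2 * real m)) * exp (of_real (s * (n * ln 2)))))) \<longlonglongrightarrow> 1"
      unfolding ratio[OF s(1)] line_ratio_periodic_iterate[OF s(1)] by simp
    moreover have "(\<lambda>m. (K (of_real s) / R (of_real s)) / \<kappa> * (R (of_real (2 * real m + s)) / (R (of_real (2 * real m)) * exp (of_real (s * (n * ln 2)))))) \<longlonglongrightarrow> (K (of_real s) / R (of_real s)) / \<kappa> * 1"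
      by (intro tendsto_intros line_gamma_ratio_limit s)
    ultimately have "(K (of_real s) / R (of_real s)) / \<kappa> * 1 = 1"
      using LIMSEQ_unique by blast
    then have "K (of_real s) / R (of_real s) = \<kappa>"
      using \<kappa> by (simp only: mult_1_right divide_eq_1_iff)
    then show ?thesis by (simp only: \<kappa>_def)
  qed
qed

theorem line_morris_eq_gamma:
  assumes "Re s > -1"
  shows "K s = K 0 / R 0 * R s"
proof -
  have "K s - K 0 / R 0 * R s = 0"
  proof (rule identity_theorem_half_plane[of "\<lambda>s. K s - K 0 / R 0 * R s" "-1" 0 2 s])
    show "(\<lambda>s. K s - K 0 / R 0 * R s) holomorphic_on {s. Re s > -1}"
      by (intro holomorphic_intros line_morris_holomorphic[OF l] line_gamma_holomorphic[OF l])
    fix x :: real assume "0 < x" "x < 2"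
    then have "K (of_real x) / R (of_real x) = K 0 / R 0" "R (of_real x) \<noteq> 0"
      using line_ratio_constant[of x] line_gamma_nonzero[OF l, of "of_real x" n \<eta>] by auto
    then show "K (of_real x) - K 0 / R 0 * R (of_real x) = 0"
      by (metis nonzero_divide_eq_eq right_minus_eq)
  qed (use assms in auto)
  then show ?thesis by simp
qed

end

section \<open>Binet's formula up to an affine function\<close>

abbreviation halfline :: "real measure" where
  "halfline \<equiv> restrict_space lborel {0<..}"

lemma borel_measurable_halfline:
  "f \<in> borel_measurable borel \<Longrightarrow> f \<in> borel_measurable halfline"
  by (rule measurable_restrict_space1) simp

lemma has_bochner_integral_exp_halfline:
  fixes a :: real
  assumes a: "a > 0"
  shows "has_bochner_integral halfline (\<lambda>s. exp (a * (- s))) (1 / a)"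
proof -
  have "(\<integral>\<^sup>+s. ennreal (exp (a * (- s))) * indicator {0..} s \<partial>lborel) = ennreal (0 - (- exp (a * (- 0)) / a))"
  proof (rule nn_integral_FTC_atLeast)
    show "((\<lambda>s. - exp (a * (- s)) / a) has_real_derivative exp (a * (- x))) (at x)" for x
      using a by (auto intro!: derivative_eq_intros)
    have "((\<lambda>s. exp (a * (- s))) \<longlongrightarrow> 0) at_top"
      using a by real_asymp
    from tendsto_divide[OF tendsto_minus[OF this] tendsto_const[of a]] a
    show "((\<lambda>s. - exp (a * (- s)) / a) \<longlongrightarrow> 0) at_top" by simp
  qed auto
  also have "(\<integral>\<^sup>+s. ennreal (exp (a * (- s))) * indicator {0..} s \<partial>lborel) = (\<integral>\<^sup>+s. ennreal (indicator {0<..} s *\<^sub>R exp (a * (- s))) \<partial>lborel)"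
  proof (rule nn_integral_cong_AE)
    have "AE s in lborel. s \<noteq> (0::real)" by (rule AE_lborel_singleton)
    then show "AE s in lborel. ennreal (exp (a * (- s))) * indicator {0..} s = ennreal (indicator {0<..} s *\<^sub>R exp (a * (- s)))"
      by eventually_elim (auto simp: indicator_def)
  qed
  finally have "has_bochner_integral lborel (\<lambda>s. indicator {0<..} s *\<^sub>R exp (a * (- s))) (1 / a)"
    using a by (intro has_bochner_integral_nn_integral) auto
  then show ?thesis
    by (simp add: has_bochner_integral_restrict_space)
qed

lemma laplace_integrable_bounded:
  fixes g :: "real \<Rightarrow> 'b :: {banach, second_countable_topology}"
  assumes g: "g \<in> borel_measurable halfline" and B: "\<And>s. s > 0 \<Longrightarrow> norm (g s) \<le> B" and x: "x > 0"
  shows "integrable halfline (\<lambda>s. exp (x * (- s)) * norm (g s))"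
proof -
  have i: "integrable halfline (\<lambda>s. B * exp (x * (- s)))"
    using has_bochner_integral_exp_halfline[OF x] by (auto simp: has_bochner_integral_iff)
  have m: "(\<lambda>s. exp (x * (- s))) \<in> borel_measurable halfline"
    by (rule borel_measurable_halfline) measurable
  show ?thesis
  proof (rule Bochner_Integration.integrable_bound[OF i])
    show "AE s in halfline. norm (exp (x * - s) * norm (g s)) \<le> norm (B * exp (x * - s))"
    proof (rule AE_I2)
      fix s assume "s \<in> space halfline"
      then have "s > 0" by (simp add: space_restrict_space)
      from B[OF this] have "norm (g s) \<le> \<bar>B\<bar>" by simp
      then show "norm (exp (x * - s) * norm (g s)) \<le> norm (B * exp (x * - s))"
        by (simp add: abs_mult mult.commute mult_left_mono)
    qed
  qed (use m g in measurable)
qed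

lemma uminus_measurable_halfline: "(\<lambda>s. - s) \<in> borel_measurable halfline"
  by (rule borel_measurable_halfline) measurable

lemma laplace_power_integrable:
  fixes g :: "real \<Rightarrow> complex"
  assumes "g \<in> borel_measurable halfline" "\<And>s. s > 0 \<Longrightarrow> norm (g s) \<le> B" "Re x > 0"
  shows "integrable halfline (\<lambda>s. of_real (- s) ^ n * exp (x * of_real (- s)) * g s)"
  by (rule power_exp_integrable[OF uminus_measurable_halfline assms(1) laplace_integrable_bounded[OF assms(1,2)] assms(3)]) auto

text \<open>
  The identity theorem reduces the claim to real exponents.
\<close>

lemma laplace_one:
  assumes "Re x > 0"
  shows "(\<integral>s. exp (x * of_real (- s)) \<partial>halfline) = 1 / x"
proof -
  let ?f = "\<lambda>x::complex. (\<integral>s. exp (x * of_real (- s)) * 1 \<partial>halfline) - 1 / x"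
  have "?f x = 0"
  proof (rule identity_theorem_half_plane[of ?f 0 1 2])
    have "(\<lambda>x. \<integral>s. exp (x * of_real (- s)) * 1 \<partial>halfline) holomorphic_on {x. Re x > 0}"
      by (rule mgf_holomorphic[OF uminus_measurable_halfline _ laplace_integrable_bounded[where B = 1]]) auto
    then show "?f holomorphic_on {x. Re x > 0}"
      by (intro holomorphic_intros) auto
    fix a :: real assume "1 < a" "a < 2"
    then have "has_bochner_integral halfline (\<lambda>s. exp (a * (- s))) (1 / a)"
      by (intro has_bochner_integral_exp_halfline) auto
    then have "(\<integral>s. complex_of_real (exp (a * (- s))) \<partial>halfline) = of_real (1 / a)"
      by (simp only: integral_complex_of_real has_bochner_integral_iff)
    then show "?f (of_real a) = 0" by (simp add: exp_of_real[symmetric])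
  qed (use assms in auto)
  then show ?thesis by simp
qed

lemma laplace_id_integrable: "Re x > 0 \<Longrightarrow> integrable halfline (\<lambda>s. of_real s * exp (x * of_real (- s)))"
  using laplace_power_integrable[of "\<lambda>_. 1" 1 x 1] by simp

lemma laplace_one_integrable: "Re x > 0 \<Longrightarrow> integrable halfline (\<lambda>s. exp (x * of_real (- s)))"
  using laplace_power_integrable[of "\<lambda>_. 1" 1 x 0] by simp

lemma laplace_id:
  assumes x: "Re x > 0"
  shows "(\<integral>s. of_real s * exp (x * of_real (- s)) \<partial>halfline) = 1 / x ^ 2"
proof -
  have "((\<lambda>x. \<integral>s. exp (x * of_real (- s)) * 1 \<partial>halfline) has_field_derivative (\<integral>s. of_real (- s) * exp (x * of_real (- s)) * 1 \<partial>halfline)) (at x)"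
    by (rule mgf_has_field_derivative[OF uminus_measurable_halfline _ laplace_integrable_bounded[where B = 1]]) (use x in auto)
  moreover have "((\<lambda>x. \<integral>s. exp (x * of_real (- s)) * 1 \<partial>halfline) has_field_derivative - 1 / x ^ 2) (at x)"
  proof (rule has_field_derivative_transform_within_open[of "\<lambda>x. 1 / x" _ x "{x. Re x > 0}"])
    show "((\<lambda>x. 1 / x) has_field_derivative - 1 / x\<^sup>2) (at x)"
      using x by (auto intro!: derivative_eq_intros simp: power2_eq_square)
  qed (use x in \<open>auto simp: open_halfspace_Re_gt laplace_one[unfolded of_real_minus mult_minus_right]\<close>)
  ultimately have "(\<integral>s. of_real (- s) * exp (x * of_real (- s)) * 1 \<partial>halfline) = - 1 / x ^ 2"
    by (rule DERIV_unique)
  then show ?thesis by simp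
qed

text \<open>
  The geometric series for \<open>1 / (1 - exp (- s))\<close> integrates term by term to the series of \<open>1 / (x + k)\<^sup>2\<close>.
\<close>

lemma trigamma_laplace:
  assumes x: "Re x > 0"
  shows "integrable halfline (\<lambda>s. of_real (s / (1 - exp (- s))) * exp (x * of_real (- s)))" (is ?i)
    and "(\<integral>s. of_real (s / (1 - exp (- s))) * exp (x * of_real (- s)) \<partial>halfline) = Polygamma 1 x"
proof -
  define f where "f k s = complex_of_real s * exp ((x + of_nat k) * of_real (- s))" for k :: nat and s :: real
  have xk: "Re (x + of_nat k) > 0" for k using x by simp
  have fi: "integrable halfline (f k)" for k
    unfolding f_def by (rule laplace_id_integrable[OF xk])
  have fint: "(\<integral>s. f k s \<partial>halfline) = 1 / (x + of_nat k) ^ 2" for k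
    unfolding f_def by (rule laplace_id[OF xk])
  have fs: "(\<lambda>k. f k s) sums (of_real (s / (1 - exp (- s))) * exp (x * of_real (- s)))"
    and fns: "summable (\<lambda>k. norm (f k s))" if "s > 0" for s
  proof -
    have q: "norm (exp (- s)) < 1" using that by simp
    have fk: "f k s = of_real (s * exp (- s) ^ k) * exp (x * of_real (- s))" for k
    proof -
      have "exp (of_nat k * complex_of_real (- s)) = of_real (exp (- s) ^ k)"
        by (simp only: exp_of_nat_mult of_real_power exp_of_real)
      then show ?thesis
        unfolding f_def distrib_right exp_add by (simp only: of_real_mult mult_ac)
    qed
    have "(\<lambda>k. s * exp (- s) ^ k) sums (s * (1 / (1 - exp (- s))))"
      by (intro sums_mult geometric_sums q)
    then have "(\<lambda>k. complex_of_real (s * exp (- s) ^ k)) sums of_real (s / (1 - exp (- s)))"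
      by (simp only: sums_of_real_iff times_divide_eq_right mult_1_right)
    then show "(\<lambda>k. f k s) sums (of_real (s / (1 - exp (- s))) * exp (x * of_real (- s)))"
      unfolding fk by (rule sums_mult2)
    have "norm (f k s) = s * norm (exp (x * of_real (- s))) * exp (- s) ^ k" for k
      unfolding fk using that by (simp add: norm_mult norm_power abs_mult)
    then show "summable (\<lambda>k. norm (f k s))"
      using q by (simp add: summable_mult summable_geometric)
  qed
  have fnint: "(\<integral>s. norm (f k s) \<partial>halfline) = 1 / (Re x + k) ^ 2" for k
  proof -
    have "complex_of_real (\<integral>s. norm (f k s) \<partial>halfline) = (\<integral>s. of_real s * exp (of_real (Re x + k) * of_real (- s)) \<partial>halfline)"
      unfolding integral_complex_of_real[symmetric]
    proof (rule Bochner_Integration.integral_cong[OF refl])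
      fix s assume "s \<in> space halfline"
      then have "s > 0" by (simp add: space_restrict_space)
      then show "complex_of_real (norm (f k s)) = of_real s * exp (of_real (Re x + k) * of_real (- s))"
        by (simp add: f_def norm_mult norm_exp_eq_Re flip: exp_of_real)
    qed
    also have "\<dots> = of_real (1 / (Re x + k) ^ 2)"
      by (subst laplace_id) (use x in auto)
    finally show ?thesis by (simp only: of_real_eq_iff)
  qed
  have sm: "summable (\<lambda>k. \<integral>s. norm (f k s) \<partial>halfline)"
  proof -
    have "(\<lambda>k. inverse ((Re x + of_nat k) ^ Suc 1)) sums ((-1) ^ Suc 1 * Polygamma 1 (Re x) / fact 1)"
      using x by (intro Polygamma_LIMSEQ) auto
    then show ?thesis
      unfolding fnint by (simp add: sums_iff power2_eq_square inverse_eq_divide)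
  qed
  have AEs: "AE s in halfline. summable (\<lambda>k. norm (f k s))"
    using fns by (intro AE_I2) (simp add: space_restrict_space)
  have I: "integrable halfline (\<lambda>s. \<Sum>k. f k s)" "(\<integral>s. (\<Sum>k. f k s) \<partial>halfline) = (\<Sum>k. \<integral>s. f k s \<partial>halfline)"
    using integrable_suminf[OF fi AEs sm] integral_suminf[OF fi AEs sm] by auto
  have eq: "(\<Sum>k. f k s) = of_real (s / (1 - exp (- s))) * exp (x * of_real (- s))" if "s \<in> space halfline" for s
    using fs[of s] that by (simp add: sums_iff space_restrict_space)
  show ?i
    by (rule iffD1[OF Bochner_Integration.integrable_cong[OF refl eq] I(1)])
  have "(\<integral>s. of_real (s / (1 - exp (- s))) * exp (x * of_real (- s)) \<partial>halfline) = (\<integral>s. (\<Sum>k. f k s) \<partial>halfline)"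
    by (intro Bochner_Integration.integral_cong refl eq[symmetric])
  also have "\<dots> = Polygamma 1 x"
  proof -
    have "x \<noteq> 0" using x by auto
    then have "(\<lambda>k. inverse ((x + of_nat k) ^ Suc 1)) sums ((-1) ^ Suc 1 * Polygamma 1 x / fact 1)"
      by (intro Polygamma_LIMSEQ) auto
    then have "(\<lambda>k. 1 / (x + of_nat k) ^ 2) sums Polygamma 1 x"
      by (simp add: inverse_eq_divide power2_eq_square)
    then show ?thesis unfolding I(2) fint by (simp add: sums_iff)
  qed
  finally show "(\<integral>s. of_real (s / (1 - exp (- s))) * exp (x * of_real (- s)) \<partial>halfline) = Polygamma 1 x" .
qed

text \<open>
  The lower bound amounts to \<open>(2 - s) exp s \<le> 2 + s\<close>, and the upper one to the quadratic Taylor bound of \<open>exp\<close>.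
\<close>

lemma binet_phi_bounds:
  assumes s: "s > 0"
  shows "0 \<le> binet_phi s" "binet_phi s \<le> 1 / 4"
proof -
  have e: "exp s - 1 > 0" using s by simp
  have "(2 - s) * exp s \<le> 2 + s"
  proof -
    have "2 + 0 - (2 - 0) * exp 0 \<le> 2 + s - (2 - s) * exp s"
    proof (rule DERIV_nonneg_imp_nondecreasing[of 0 s "\<lambda>s. 2 + s - (2 - s) * exp s"])
      fix x :: real assume "0 \<le> x"
      have "1 - x \<le> exp (- x)" using exp_ge_add_one_self[of "- x"] by simp
      then have "(1 - x) * exp x \<le> exp (- x) * exp x" by (rule mult_right_mono) simp
      also have "\<dots> = 1" by (simp add: exp_minus)
      finally have "0 \<le> 1 - (1 - x) * exp x" by simp
      moreover have "((\<lambda>s. 2 + s - (2 - s) * exp s) has_real_derivative 1 - (1 - x) * exp x) (at x)"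
        by (auto intro!: derivative_eq_intros simp: algebra_simps)
      ultimately show "\<exists>y. ((\<lambda>s. 2 + s - (2 - s) * exp s) has_real_derivative y) (at x) \<and> 0 \<le> y"
        by blast
    qed (use s in auto)
    then show ?thesis by simp
  qed
  then have "0 \<le> (s - 2) * (exp s - 1) + 2 * s" by (simp add: algebra_simps)
  then have "0 \<le> ((s - 2) * (exp s - 1) + 2 * s) / (2 * s * (exp s - 1))" using s e by simp
  also have "\<dots> = 1 / 2 - 1 / s + 1 / (exp s - 1)"
  proof -
    have "1 / 2 - 1 / s + 1 / E = ((s - 2) * E + 2 * s) / (2 * s * E)" if "E > 0" for E
      using s that by (simp add: field_simps)
    from this[OF e] show ?thesis by simp
  qed
  finally show "0 \<le> binet_phi s" using s by (simp add: binet_phi_def)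
  have "s + s\<^sup>2 / 2 \<le> exp s - 1"
    using exp_lower_Taylor_quadratic[of s] s by simp
  then have "1 / (exp s - 1) \<le> 1 / (s + s\<^sup>2 / 2)"
    using s by (intro divide_left_mono) (auto intro!: mult_pos_pos add_pos_pos)
  also have "\<dots> = 1 / s - 1 / (2 + s)"
    using s by (simp add: field_simps power2_eq_square)
  finally have "1 / 2 - 1 / s + 1 / (exp s - 1) \<le> 1 / 2 - 1 / (2 + s)" by linarith
  also have "\<dots> \<le> s / 4" using s by (simp add: field_simps)
  finally have "(1 / 2 - 1 / s + 1 / (exp s - 1)) * (1 / s) \<le> (s / 4) * (1 / s)"
    using s by (intro mult_right_mono) auto
  then show "binet_phi s \<le> 1 / 4" using s by (simp add: binet_phi_def)
qed

lemma binet_phi_measurable: "binet_phi \<in> borel_measurable borel"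
  unfolding binet_phi_def[abs_def] by measurable

text \<open>
  The correction term in Binet's first formula for \<open>ln_Gamma\<close>.
\<close>

definition binet_J :: "complex \<Rightarrow> complex" where
  "binet_J x = (\<integral>s. exp (x * of_real (- s)) * of_real (binet_phi s) \<partial>halfline)"

lemma phi_complex_measurable: "(\<lambda>s. complex_of_real (binet_phi s)) \<in> borel_measurable halfline"
  by (rule borel_measurable_halfline) (use binet_phi_measurable in measurable)

lemma phi_norm_le: "s > 0 \<Longrightarrow> norm (complex_of_real (binet_phi s)) \<le> 1 / 4"
  using binet_phi_bounds[of s] by simp

lemma binet_J_integrable: "Re x > 0 \<Longrightarrow> integrable halfline (\<lambda>s. exp (x * of_real (- s)) * of_real (binet_phi s))"
  using laplace_power_integrable[OF phi_complex_measurable phi_norm_le, of x 0] by simp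

definition binet_J1 :: "complex \<Rightarrow> complex" where
  "binet_J1 x = (\<integral>s. of_real (- s) * exp (x * of_real (- s)) * of_real (binet_phi s) \<partial>halfline)"

lemma binet_J_deriv: "Re x > 0 \<Longrightarrow> (binet_J has_field_derivative binet_J1 x) (at x)"
  unfolding binet_J_def[abs_def] binet_J1_def
  by (rule mgf_has_field_derivative[OF uminus_measurable_halfline phi_complex_measurable laplace_integrable_bounded[OF phi_complex_measurable phi_norm_le]]) auto

text \<open>
  Multiplication by \<open>s\<^sup>2\<close>, the effect of two derivatives, clears the denominators and leaves elementary Laplace
  transforms and that of the trigamma function.
\<close>

lemma binet_phi_square:
  assumes "s > 0"
  shows "s\<^sup>2 * binet_phi s = s / 2 - 1 + s / (1 - exp (- s)) * exp (- s)"
proof -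
  have "s / (1 - exp (- s)) * exp (- s) = s / (exp s - 1)"
    using assms by (simp add: exp_minus field_simps)
  moreover have "s\<^sup>2 * ((1 / 2 - 1 / s + A) * (1 / s)) = s / 2 - 1 + s * A" for A
    using assms by (simp add: power2_eq_square algebra_simps)
  ultimately show ?thesis
    by (simp add: binet_phi_def)
qed

lemma binet_J1_deriv:
  assumes x: "Re x > 0"
  shows "(binet_J1 has_field_derivative Polygamma 1 x - 1 / x - 1 / (2 * x\<^sup>2)) (at x)"
proof -
  define g where "g s = complex_of_real (- s) * of_real (binet_phi s)" for s
  have gm: "g \<in> borel_measurable halfline"
    unfolding g_def using uminus_measurable_halfline phi_complex_measurable by measurable
  have gi: "integrable halfline (\<lambda>s. exp (y * (- s)) * norm (g s))" if "y > 0" for y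
    using integrable_norm[OF laplace_power_integrable[OF phi_complex_measurable phi_norm_le, of "of_real y" 1]] that
    by (simp add: g_def norm_mult mult_ac)
  have J1: "binet_J1 = (\<lambda>x. \<integral>s. exp (x * of_real (- s)) * g s \<partial>halfline)"
    unfolding binet_J1_def[abs_def] g_def by (simp add: mult_ac)
  have "(binet_J1 has_field_derivative (\<integral>s. of_real (- s) * exp (x * of_real (- s)) * g s \<partial>halfline)) (at x)"
    unfolding J1 by (rule mgf_has_field_derivative[OF uminus_measurable_halfline gm gi x])
  also have "(\<integral>s. of_real (- s) * exp (x * of_real (- s)) * g s \<partial>halfline) =
      (\<integral>s. (1 / 2 * (of_real s * exp (x * of_real (- s))) - exp (x * of_real (- s)))
        + of_real (s / (1 - exp (- s))) * exp ((x + 1) * of_real (- s)) \<partial>halfline)"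
  proof (rule Bochner_Integration.integral_cong[OF refl])
    fix s assume "s \<in> space halfline"
    then have s: "s > 0" by (simp add: space_restrict_space)
    have "of_real (- s) * exp (x * of_real (- s)) * g s = exp (x * of_real (- s)) * of_real (s\<^sup>2 * binet_phi s)"
      by (simp add: g_def power2_eq_square)
    also have "\<dots> = (1 / 2 * (of_real s * exp (x * of_real (- s))) - exp (x * of_real (- s)))
        + of_real (s / (1 - exp (- s))) * exp ((x + 1) * of_real (- s))"
    proof -
      have e: "exp ((x + 1) * of_real (- s)) = exp (x * of_real (- s)) * of_real (exp (- s))"
        by (simp only: distrib_right exp_add mult_1 exp_of_real)
      define c where "c = s / (1 - exp (- s))"
      show ?thesis
        unfolding binet_phi_square[OF s] e c_def[symmetric] by (simp add: algebra_simps)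
    qed
    finally show "of_real (- s) * exp (x * of_real (- s)) * g s = \<dots>" .
  qed
  also have "\<dots> = (1 / 2 * (1 / x\<^sup>2) - 1 / x) + Polygamma 1 (x + 1)"
  proof -
    have x1: "Re (x + 1) > 0" using x by simp
    show ?thesis
      using laplace_id_integrable[OF x] laplace_one_integrable[OF x] trigamma_laplace[OF x1]
      by (subst Bochner_Integration.integral_add, simp, simp, subst Bochner_Integration.integral_diff, simp, simp)
         (simp add: laplace_id[OF x, unfolded of_real_minus mult_minus_right] laplace_one[OF x, unfolded of_real_minus mult_minus_right])
  qed
  also have "Polygamma 1 (x + 1) = Polygamma 1 x - 1 / x\<^sup>2"
    using x by (subst Polygamma_plus1) (auto simp: power2_eq_square)
  finally show ?thesis
    by (rule DERIV_cong) (simp add: field_simps)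
qed

text \<open>
  Both sides have the same second derivative. Leaving the affine term undetermined is enough, because the
  alternating sum over the six arguments in the limiting function annihilates affine functions.
\<close>

lemma binet_up_to_affine:
  "\<exists>p q. \<forall>x. Re x > 0 \<longrightarrow> ln_Gamma x = (x - 1 / 2) * Ln x + binet_J x + p * x + (q :: complex)"
proof -
  let ?S = "{x::complex. Re x > 0}"
  have cv: "convex ?S" by (rule convex_halfspace_Re_gt)
  have nn: "x \<notin> \<real>\<^sub>\<le>\<^sub>0" if "Re x > 0" for x using that by (auto simp: complex_nonpos_Reals_iff)
  \<comment> \<open>The first derivative of the difference, up to the constant \<open>p\<close>.\<close>
  define H1 where "H1 x = Digamma x - (Ln x + (x - 1 / 2) / x) - binet_J1 x" for x :: complex
  have "(H1 has_field_derivative 0) (at x within ?S)" if x: "x \<in> ?S" for x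
  proof (rule has_field_derivative_at_within)
    have x': "Re x > 0" and x0: "x \<noteq> 0" using x by auto
    have "((\<lambda>x. Ln x + (x - 1 / 2) / x) has_field_derivative 1 / x + 1 / (2 * x\<^sup>2)) (at x)"
      using nn[OF x'] x0 by (auto intro!: derivative_eq_intros simp: power2_eq_square field_simps)
    moreover have "(Digamma has_field_derivative Polygamma 1 x) (at x)"
      using has_field_derivative_Polygamma[of x 0 UNIV] not_nonpos_Ints_Re[OF x'] by simp
    ultimately have "(H1 has_field_derivative Polygamma 1 x - (1 / x + 1 / (2 * x\<^sup>2)) - (Polygamma 1 x - 1 / x - 1 / (2 * x\<^sup>2))) (at x)"
      unfolding H1_def[abs_def] by (intro DERIV_diff binet_J1_deriv x')
    then show "(H1 has_field_derivative 0) (at x)"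
      by (rule DERIV_cong) simp
  qed
  from has_field_derivative_zero_constant[OF cv this] obtain p where p: "\<And>x. x \<in> ?S \<Longrightarrow> H1 x = p" by blast
  define H where "H x = ln_Gamma x - (x - 1 / 2) * Ln x - binet_J x - p * x" for x :: complex
  have "(H has_field_derivative 0) (at x within ?S)" if x: "x \<in> ?S" for x
  proof (rule has_field_derivative_at_within)
    have x': "Re x > 0" and x0: "x \<noteq> 0" using x by auto
    have "((\<lambda>x. (x - 1 / 2) * Ln x) has_field_derivative Ln x + (x - 1 / 2) / x) (at x)"
    proof -
      have "((\<lambda>x. x - 1 / 2) has_field_derivative 1) (at x)"
        by (auto intro!: derivative_eq_intros)
      moreover have "(Ln has_field_derivative inverse x) (at x)"
        using nn[OF x'] by (intro has_field_derivative_Ln)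
      ultimately have "((\<lambda>x. (x - 1 / 2) * Ln x) has_field_derivative 1 * Ln x + inverse x * (x - 1 / 2)) (at x)"
        by (rule DERIV_mult)
      then show ?thesis
        by (rule DERIV_cong) (simp add: inverse_eq_divide)
    qed
    moreover have "((\<lambda>x. p * x) has_field_derivative p) (at x)"
      by (auto intro!: derivative_eq_intros)
    ultimately have "(H has_field_derivative Digamma x - (Ln x + (x - 1 / 2) / x) - binet_J1 x - p) (at x)"
      unfolding H_def[abs_def] by (intro DERIV_diff binet_J_deriv x' has_field_derivative_ln_Gamma_complex nn)
    then show "(H has_field_derivative 0) (at x)"
      by (rule DERIV_cong) (use p[OF x] in \<open>simp add: H1_def\<close>)
  qed
  from has_field_derivative_zero_constant[OF cv this] obtain q where q: "\<And>x. x \<in> ?S \<Longrightarrow> H x = q" by blast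
  show ?thesis
  proof (intro exI allI impI)
    fix x :: complex assume "Re x > 0"
    then have "H x = q" using q by simp
    then show "ln_Gamma x = (x - 1 / 2) * Ln x + binet_J x + p * x + q"
      unfolding H_def by (simp add: algebra_simps)
  qed
qed

section \<open>Weierstrass products of the Barnes and gamma functions\<close>

lemma norm_Ln_cubic_remainder:
  assumes z: "norm (z::complex) \<le> 1 / 2"
  shows "norm (Ln (1 + z) - z + z\<^sup>2 / 2) \<le> 8 * norm z ^ 3"
proof -
  define f where "f i x = (if i = 0 then Ln (1 + x) else if i = 1 then inverse (1 + x)
      else if i = 2 then - (inverse (1 + x) ^ 2) else 2 * inverse (1 + x) ^ 3)" for i :: nat and x :: complex
  have far: "norm (1 + x) \<ge> 1 / 2" if "x \<in> cball 0 (1 / 2)" for x :: complex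
    using that norm_triangle_ineq2[of 1 "- x"] by simp
  have "norm (f 0 z - (\<Sum>i\<le>2. f i 0 * (z - 0) ^ i / fact i)) \<le> 16 * norm (z - 0) ^ Suc 2 / fact 2"
  proof (rule complex_Taylor[where S = "cball 0 (1 / 2)"])
    fix i x assume x: "x \<in> cball (0::complex) (1 / 2)" and i: "i \<le> (2::nat)"
    have "\<bar>Re x\<bar> \<le> 1 / 2" using x abs_Re_le_cmod[of x] by simp
    then have nn: "1 + x \<notin> \<real>\<^sub>\<le>\<^sub>0" by (auto simp: complex_nonpos_Reals_iff)
    then have nz: "1 + x \<noteq> 0" by auto
    have inv: "((\<lambda>x. inverse (1 + x)) has_field_derivative - (inverse (1 + x) ^ 2)) (at x within cball 0 (1 / 2))"
      using nz by (auto intro!: derivative_eq_intros simp: power2_eq_square)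
    consider "i = 0" | "i = 1" | "i = 2" using i by linarith
    then show "(f i has_field_derivative f (Suc i) x) (at x within cball 0 (1 / 2))"
    proof cases
      case 1
      have "((\<lambda>x. Ln (1 + x)) has_field_derivative inverse (1 + x)) (at x within cball 0 (1 / 2))"
        using nn by (auto intro!: derivative_eq_intros simp: inverse_eq_divide)
      then show ?thesis using 1 by (simp add: f_def[abs_def])
    next
      case 2
      then show ?thesis using inv by (simp add: f_def[abs_def])
    next
      case 3
      have "((\<lambda>x. - (inverse (1 + x) ^ 2)) has_field_derivative 2 * inverse (1 + x) ^ 3) (at x within cball 0 (1 / 2))"
        by (rule DERIV_cong[OF DERIV_minus[OF DERIV_power[OF inv, of 2]]]) (simp add: power2_eq_square power3_eq_cube)
      then show ?thesis using 3 by (simp add: f_def[abs_def])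
    qed
  next
    fix x :: complex assume "x \<in> cball 0 (1 / 2)"
    from power_mono[OF far[OF this], of 3] have "1 / 8 \<le> norm (1 + x) ^ 3" by (simp add: power3_eq_cube)
    then have "inverse (norm (1 + x) ^ 3) \<le> inverse (1 / 8)" by (intro le_imp_inverse_le) auto
    then show "norm (f (Suc 2) x) \<le> 16" by (simp add: f_def norm_mult norm_inverse norm_power power_inverse)
  qed (use z in auto)
  then show ?thesis
    by (simp add: f_def eval_nat_numeral power3_eq_cube algebra_simps)
qed

text \<open>
  The logarithm of a factor in the Weierstrass product of \<open>barnes_G (1 + u)\<close>.
\<close>

definition barnes_term :: "nat \<Rightarrow> complex \<Rightarrow> complex" where
  "barnes_term j u = of_nat (Suc j) * Ln (1 + u / of_nat (Suc j)) - u + u\<^sup>2 / 2 * of_real (ln (1 + 1 / real (Suc j)))"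

text \<open>
  Up to sign, the logarithm of a factor in the Weierstrass product of \<open>Gamma (1 + u)\<close>.
\<close>

definition gamma_term :: "nat \<Rightarrow> complex \<Rightarrow> complex" where
  "gamma_term j u = Ln (1 + u / of_nat (Suc j)) - u / of_nat (Suc j)"

lemma barnes_term_bound:
  assumes "norm u \<le> R" "real (Suc j) \<ge> 2 * R"
  shows "norm (barnes_term j u) \<le> (8 * R ^ 3 + R\<^sup>2) * inverse (real (Suc j) ^ 2)"
proof -
  define k where "k = real (Suc j)"
  have k: "k \<ge> 1" "k > 0" "complex_of_nat (Suc j) = of_real k" by (simp_all add: k_def)
  define z where "z = u / of_real k"
  have R: "R \<ge> 0" using assms(1) norm_ge_zero order.trans by blast
  have nz: "norm z = norm u / k" using k by (simp add: z_def norm_divide)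
  have "2 * R \<le> k" using assms(2) by (simp add: k_def)
  then have z: "norm z \<le> 1 / 2" unfolding nz using k assms(1) by (simp add: divide_le_eq)
  have "barnes_term j u = of_real k * (Ln (1 + z) - z + z\<^sup>2 / 2) + u\<^sup>2 / 2 * of_real (ln (1 + 1 / k) - 1 / k)"
    unfolding barnes_term_def k(3) k_def[symmetric] z_def[symmetric] of_real_diff
    using k by (simp add: z_def power2_eq_square field_simps)
  also have "norm \<dots> \<le> k * (8 * norm z ^ 3) + (norm u)\<^sup>2 / 2 * (1 / k)\<^sup>2"
  proof (rule order.trans[OF norm_triangle_ineq add_mono])
    show "norm (of_real k * (Ln (1 + z) - z + z\<^sup>2 / 2)) \<le> k * (8 * norm z ^ 3)"
      unfolding norm_mult using norm_Ln_cubic_remainder[OF z] k by (simp add: mult_left_mono)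
    have "\<bar>ln (1 + 1 / k) - 1 / k\<bar> \<le> (1 / k)\<^sup>2"
      by (rule abs_ln_one_plus_x_minus_x_bound_nonneg) (use k in auto)
    then show "norm (u\<^sup>2 / 2 * of_real (ln (1 + 1 / k) - 1 / k)) \<le> (norm u)\<^sup>2 / 2 * (1 / k)\<^sup>2"
      unfolding norm_mult norm_of_real norm_divide norm_power by (intro mult_mono) auto
  qed
  also have "\<dots> = (8 * norm u ^ 3 + (norm u)\<^sup>2 / 2) * inverse (k\<^sup>2)"
    unfolding nz using k by (simp add: field_simps power2_eq_square power3_eq_cube)
  also have "\<dots> \<le> (8 * R ^ 3 + R\<^sup>2) * inverse (k\<^sup>2)"
  proof (intro mult_right_mono)
    have "norm u ^ 3 \<le> R ^ 3" "(norm u)\<^sup>2 \<le> R\<^sup>2" using assms by (auto intro: power_mono)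
    then show "8 * norm u ^ 3 + (norm u)\<^sup>2 / 2 \<le> 8 * R ^ 3 + R\<^sup>2"
      using zero_le_power2[of "norm u"] by linarith
  qed simp
  finally show ?thesis unfolding k_def .
qed

lemma gamma_term_bound:
  assumes "norm u \<le> R" "real (Suc j) \<ge> 2 * R"
  shows "norm (gamma_term j u) \<le> 2 * R\<^sup>2 * inverse (real (Suc j) ^ 2)"
proof -
  define k where "k = real (Suc j)"
  have k: "k \<ge> 1" "k > 0" "complex_of_nat (Suc j) = of_real k" by (simp_all add: k_def)
  define z where "z = u / of_real k"
  have R: "R \<ge> 0" using assms(1) norm_ge_zero order.trans by blast
  have nz: "norm z = norm u / k" using k by (simp add: z_def norm_divide)
  have "2 * R \<le> k" using assms(2) by (simp add: k_def)
  then have z: "norm z \<le> 1 / 2" unfolding nz using k assms(1) by (simp add: divide_le_eq)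
  have "norm (gamma_term j u) \<le> norm z ^ 2 / (1 - norm z)"
    unfolding gamma_term_def k(3) z_def[symmetric] by (rule Ln_approx_linear) (use z in simp)
  also have "\<dots> \<le> norm z ^ 2 / (1 / 2)"
    using z by (intro divide_left_mono) auto
  also have "\<dots> = 2 * (norm u)\<^sup>2 * inverse (k\<^sup>2)"
    unfolding nz by (simp add: power_divide inverse_eq_divide)
  also have "\<dots> \<le> 2 * R\<^sup>2 * inverse (k\<^sup>2)"
    using assms by (intro mult_right_mono mult_left_mono power_mono) auto
  finally show ?thesis unfolding k_def .
qed

lemma summable_inverse_Suc_squares: "summable (\<lambda>j. c * inverse (real (Suc j) ^ 2))"
  using inverse_power_summable[of 2, where 'a = real] by (intro summable_mult) (subst summable_Suc_iff, simp)

lemma eventually_Suc_ge: "\<forall>\<^sub>F j in sequentially. real (Suc j) \<ge> c"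
proof (rule eventually_mono[OF eventually_ge_at_top[of "nat \<lceil>c\<rceil>"]])
  fix j assume "nat \<lceil>c\<rceil> \<le> j"
  then have "c \<le> real j" by (simp add: nat_le_iff ceiling_le_iff)
  then show "c \<le> real (Suc j)" by simp
qed

definition barnes_sum :: "complex \<Rightarrow> complex" where "barnes_sum u = (\<Sum>j. barnes_term j u)"
definition gamma_sum :: "complex \<Rightarrow> complex" where "gamma_sum u = (\<Sum>j. gamma_term j u)"

lemma barnes_sum_uniform_limit:
  assumes "bounded A"
  shows "uniform_limit A (\<lambda>n u. \<Sum>j<n. barnes_term j u) barnes_sum sequentially"
proof -
  obtain R where R: "\<And>u. u \<in> A \<Longrightarrow> norm u \<le> R" using assms by (auto simp: bounded_iff)
  show ?thesis
    unfolding barnes_sum_def[abs_def]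
    by (rule Weierstrass_m_test_ev[OF eventually_mono[OF eventually_Suc_ge[of "2 * R"]] summable_inverse_Suc_squares])
       (use barnes_term_bound R in blast)
qed

lemma gamma_sum_uniform_limit:
  assumes "bounded A"
  shows "uniform_limit A (\<lambda>n u. \<Sum>j<n. gamma_term j u) gamma_sum sequentially"
proof -
  obtain R where R: "\<And>u. u \<in> A \<Longrightarrow> norm u \<le> R" using assms by (auto simp: bounded_iff)
  show ?thesis
    unfolding gamma_sum_def[abs_def]
    by (rule Weierstrass_m_test_ev[OF eventually_mono[OF eventually_Suc_ge[of "2 * R"]] summable_inverse_Suc_squares])
       (use gamma_term_bound R in blast)
qed

lemma Re_one_plus_div_pos:
  assumes "Re u > -1"
  shows "Re (1 + u / of_nat (Suc j)) > 0"
proof -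
  have "Re u / real (Suc j) > -1"
    using assms by (simp add: less_divide_eq)
  moreover have "Re (u / of_nat (Suc j)) = Re u / real (Suc j)"
    by (rule Re_divide_of_nat)
  ultimately show ?thesis by (simp only: plus_complex.sel one_complex.sel)
qed

lemma one_plus_div_slit:
  "Re u > -1 \<Longrightarrow> 1 + u / of_nat (Suc j) \<notin> \<real>\<^sub>\<le>\<^sub>0"
  using Re_one_plus_div_pos[of u j] by (auto simp: complex_nonpos_Reals_iff simp del: of_nat_Suc)

lemma locally_uniform_limit_holomorphic:
  assumes "\<And>n. f n holomorphic_on {u. Re u > c}"
    and "\<And>A. bounded A \<Longrightarrow> uniform_limit A f g sequentially"
  shows "g holomorphic_on {u. Re u > c}"
proof (rule holomorphic_uniform_sequence[OF open_halfspace_Re_gt assms(1)])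
  fix x :: complex assume "x \<in> {u. Re u > c}"
  then obtain e where "e > 0" "cball x e \<subseteq> {u. Re u > c}"
    using open_contains_cball open_halfspace_Re_gt by metis
  then show "\<exists>d>0. cball x d \<subseteq> {u. Re u > c} \<and> uniform_limit (cball x d) f g sequentially"
    using assms(2)[OF bounded_cball] by blast
qed

lemma barnes_sum_holomorphic: "barnes_sum holomorphic_on {u. Re u > -1}"
proof (rule locally_uniform_limit_holomorphic[OF _ barnes_sum_uniform_limit])
  show "(\<lambda>u. \<Sum>j<n. barnes_term j u) holomorphic_on {u. Re u > -1}" for n
    unfolding barnes_term_def using one_plus_div_slit by (intro holomorphic_intros) (auto simp del: of_nat_Suc)
qed

lemma gamma_sum_holomorphic: "gamma_sum holomorphic_on {u. Re u > -1}"
proof (rule locally_uniform_limit_holomorphic[OF _ gamma_sum_uniform_limit])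
  show "(\<lambda>u. \<Sum>j<n. gamma_term j u) holomorphic_on {u. Re u > -1}" for n
    unfolding gamma_term_def using one_plus_div_slit by (intro holomorphic_intros) (auto simp del: of_nat_Suc)
qed

lemma barnes_sum_sums: "(\<lambda>j. barnes_term j u) sums barnes_sum u"
  using tendsto_uniform_limitI[OF barnes_sum_uniform_limit[of "{u}"], of u] by (simp add: sums_def)

lemma gamma_sum_sums: "(\<lambda>j. gamma_term j u) sums gamma_sum u"
  using tendsto_uniform_limitI[OF gamma_sum_uniform_limit[of "{u}"], of u] by (simp add: sums_def)

text \<open>
  For positive real \<open>u\<close> this is the logarithmic Weierstrass product combined with \<open>Gamma (1 + u) = u Gamma u\<close>; the
  identity theorem then covers the half-plane, where no relation between branches has to be tracked.
\<close>

lemma ln_Gamma_one_plus: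
  assumes u: "Re u > -1"
  shows "ln_Gamma (1 + u) = - gamma_sum u - euler_mascheroni * u"
proof -
  have "ln_Gamma (1 + u) - (- gamma_sum u - euler_mascheroni * u) = 0"
  proof (rule identity_theorem_half_plane[of "\<lambda>u. ln_Gamma (1 + u) - (- gamma_sum u - euler_mascheroni * u)" "-1" 0 1 u])
    have "(\<lambda>u. ln_Gamma (1 + u)) holomorphic_on {u::complex. Re u > -1}"
      by (rule holomorphic_on_compose_gen[of _ _ ln_Gamma "{z. Re z > 0}", unfolded o_def])
         (auto intro!: holomorphic_intros holomorphic_ln_Gamma simp: complex_nonpos_Reals_iff)
    then show "(\<lambda>u. ln_Gamma (1 + u) - (- gamma_sum u - euler_mascheroni * u)) holomorphic_on {u. Re u > -1}"
      by (intro holomorphic_intros gamma_sum_holomorphic)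
    fix x :: real assume x: "0 < x" "x < 1"
    have "complex_of_real x \<notin> \<int>\<^sub>\<le>\<^sub>0" using x by (intro not_nonpos_Ints_Re) simp
    from sums_minus[OF ln_Gamma_series'_aux[OF this]]
    have "(\<lambda>j. gamma_term j (of_real x)) sums - (ln_Gamma (of_real x) + euler_mascheroni * of_real x + ln (of_real x))"
      by (simp add: gamma_term_def)
    then have "gamma_sum (of_real x) = - (ln_Gamma (of_real x) + euler_mascheroni * of_real x + ln (of_real x))"
      using gamma_sum_sums sums_unique2 by blast
    moreover have "ln_Gamma (1 + complex_of_real x) = ln_Gamma (of_real x) + ln (of_real x)"
    proof -
      have "ln_Gamma (1 + x) = ln_Gamma x + ln x"
      proof -
        have "x \<notin> \<int>\<^sub>\<le>\<^sub>0" using x by (auto elim!: nonpos_Ints_cases)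
        then have "Gamma (1 + x) = x * Gamma x" using Gamma_plus1[of x] by (simp add: add.commute)
        moreover have "Gamma x \<noteq> 0" using Gamma_real_pos[of x] x by linarith
        ultimately show ?thesis
          using x by (simp add: ln_Gamma_real_pos ln_mult)
      qed
      then have "complex_of_real (ln_Gamma (1 + x)) = of_real (ln_Gamma x) + of_real (ln x)" by simp
      moreover have "complex_of_real (ln_Gamma (1 + x)) = ln_Gamma (1 + complex_of_real x)"
        using x ln_Gamma_complex_of_real[of "1 + x"] by simp
      ultimately show ?thesis
        using x ln_Gamma_complex_of_real[of x] by (simp add: Ln_of_real)
    qed
    ultimately show "ln_Gamma (1 + of_real x) - (- gamma_sum (of_real x) - euler_mascheroni * of_real x) = 0"
      by simp
  qed (use u in auto)
  then show ?thesis by simp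
qed

text \<open>
  The logarithm of the Weierstrass product, taken factor by factor.
\<close>

definition barnes_log :: "complex \<Rightarrow> complex" where
  "barnes_log z = (z - 1) / 2 * of_real (ln (2 * pi)) - z * (z - 1) / 2 + barnes_sum (z - 1)"

lemma exp_barnes_log:
  assumes z: "Re z > 0"
  shows "exp (barnes_log z) = barnes_G z"
proof -
  define u where "u = z - 1"
  have u: "Re u > -1" using z by (simp add: u_def)
  have e: "exp (barnes_term j u) = (1 + u / of_nat (Suc j)) ^ Suc j * of_real (1 + 1 / real (Suc j)) powr (u\<^sup>2 / 2) * exp (- u)" for j
  proof -
    have nz: "1 + u / of_nat (Suc j) \<noteq> 0"
      using one_plus_div_slit[OF u, of j] by auto
    have "exp (of_nat (Suc j) * Ln (1 + u / of_nat (Suc j))) = (1 + u / of_nat (Suc j)) ^ Suc j"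
      unfolding exp_of_nat_mult exp_Ln[OF nz] ..
    moreover have "complex_of_real (1 + 1 / real (Suc j)) powr (u\<^sup>2 / 2) = exp (u\<^sup>2 / 2 * of_real (ln (1 + 1 / real (Suc j))))"
    proof -
      have p: "1 + 1 / real (Suc j) > 0" by (simp add: add_pos_pos)
      then have "complex_of_real (1 + 1 / real (Suc j)) \<noteq> 0" by (simp only: of_real_eq_0_iff)
      then show ?thesis unfolding powr_def by (simp only: if_False Ln_of_real[OF p])
    qed
    ultimately show ?thesis
      unfolding barnes_term_def diff_conv_add_uminus exp_add by (simp only: mult_ac)
  qed
  have "(\<Prod>j. exp (barnes_term j u)) = exp (barnes_sum u)"
    using prodinf_exp[OF sums_summable[OF barnes_sum_sums]] by (simp add: barnes_sum_def)
  then have P: "(\<Prod>j. (1 + u / of_nat (Suc j)) ^ Suc j * of_real (1 + 1 / real (Suc j)) powr (u\<^sup>2 / 2) * exp (- u)) = exp (barnes_sum u)"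
    by (simp only: e)
  have "complex_of_real (2 * pi) powr (u / 2) = exp (u / 2 * of_real (ln (2 * pi)))"
    unfolding powr_def using Ln_of_real[of "2 * pi"] by simp
  note powr_two_pi = this
  have eu: "- (u + 1) * u / 2 = - (z * u / 2)" by (simp add: u_def)
  show ?thesis
    unfolding barnes_log_def barnes_G_def Let_def u_def[symmetric] P
    unfolding powr_two_pi eu by (simp only: diff_conv_add_uminus exp_add)
qed

lemma barnes_log_holomorphic: "barnes_log holomorphic_on {z. Re z > 0}"
proof -
  have "(\<lambda>z. barnes_sum (z - 1)) holomorphic_on {z. Re z > 0}"
    by (rule holomorphic_on_compose_gen[of _ _ barnes_sum "{z. Re z > -1}", unfolded o_def])
       (auto intro!: holomorphic_intros barnes_sum_holomorphic)
  then show ?thesis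
    unfolding barnes_log_def[abs_def] by (intro holomorphic_intros) auto
qed

lemma barnes_log_real:
  assumes x: "(x::real) > 0"
  shows "barnes_log (of_real x) \<in> \<real>"
proof -
  have t: "barnes_term j (of_real (x - 1)) \<in> \<real>" for j
  proof -
    have "Re (1 + complex_of_real (x - 1) / of_nat (Suc j)) > 0"
      by (rule Re_one_plus_div_pos) (use x in simp)
    moreover have "1 + complex_of_real (x - 1) / of_nat (Suc j) = of_real (1 + (x - 1) / real (Suc j))" by simp
    ultimately have "0 < 1 + (x - 1) / real (Suc j)" by (simp only: Re_complex_of_real)
    from Ln_of_real[OF this] have "Ln (1 + complex_of_real (x - 1) / of_nat (Suc j)) \<in> \<real>"
      by (simp only: \<open>1 + complex_of_real (x - 1) / of_nat (Suc j) = _\<close> Reals_of_real)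
    then show ?thesis
      unfolding barnes_term_def by (intro Reals_add Reals_diff Reals_mult Reals_of_nat Reals_of_real Reals_divide Reals_power) auto
  qed
  have "barnes_sum (of_real (x - 1)) \<in> \<real>"
    using closed_sequentially[OF closed_complex_Reals _ barnes_sum_sums[unfolded sums_def]] t by (auto intro: sum_in_Reals)
  then show ?thesis
    unfolding barnes_log_def by (intro Reals_add Reals_diff Reals_mult Reals_divide Reals_of_real) auto
qed

text \<open>
  Two branches with the required properties differ by a function \<open>D\<close> with \<open>exp D = 1\<close>. Its derivative vanishes, so
  it is constant, and it is real at 1, hence 0.
\<close>

lemma ln_barnes_G_eq:
  assumes z: "Re z > 0"
  shows "ln_barnes_G z = barnes_log z"
proof -
  let ?S = "{z::complex. 0 < Re z}"
  define P where "P L \<longleftrightarrow> L holomorphic_on ?S \<and> (\<forall>z. 0 < Re z \<longrightarrow> exp (L z) = barnes_G z) \<and> (\<forall>x::real. 0 < x \<longrightarrow> L (of_real x) \<in> \<real>)" for L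
  have "P barnes_log"
    using barnes_log_holomorphic exp_barnes_log barnes_log_real by (simp add: P_def)
  then have "P (SOME L. P L)" by (rule someI[of P])
  also have "(SOME L. P L) = ln_barnes_G" by (simp only: P_def ln_barnes_G_def)
  finally have L: "ln_barnes_G holomorphic_on ?S \<and> (\<forall>z. 0 < Re z \<longrightarrow> exp (ln_barnes_G z) = barnes_G z) \<and> (\<forall>x::real. 0 < x \<longrightarrow> ln_barnes_G (of_real x) \<in> \<real>)"
    unfolding P_def .
  define D where "D z = ln_barnes_G z - barnes_log z" for z
  have expD: "exp (D z) = 1" if "Re z > 0" for z
    using L that exp_barnes_log[OF that] by (simp add: D_def exp_diff flip: exp_barnes_log)
  have Dh: "D holomorphic_on ?S"
    unfolding D_def[abs_def] using L barnes_log_holomorphic by (intro holomorphic_intros) auto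
  have "(D has_field_derivative 0) (at z within ?S)" if z: "z \<in> ?S" for z
  proof (rule has_field_derivative_at_within)
    obtain d where d: "(D has_field_derivative d) (at z)"
      using Dh z by (auto simp: holomorphic_on_open open_halfspace_Re_gt)
    have "((\<lambda>z. exp (D z)) has_field_derivative exp (D z) * d) (at z)"
      by (rule DERIV_fun_exp[OF d])
    moreover have "((\<lambda>z. exp (D z)) has_field_derivative 0) (at z)"
      by (rule has_field_derivative_transform_within_open[of "\<lambda>_. 1" _ z ?S])
         (use z expD in \<open>auto simp: open_halfspace_Re_gt\<close>)
    ultimately have "exp (D z) * d = 0" by (rule DERIV_unique)
    then show "(D has_field_derivative 0) (at z)" using d by simp
  qed
  from has_field_derivative_zero_constant[OF convex_halfspace_Re_gt this] obtain c where c: "\<And>z. z \<in> ?S \<Longrightarrow> D z = c" by blast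
  have "D 1 \<in> \<real>" unfolding D_def using L barnes_log_real[of 1] by (auto intro: Reals_diff dest: spec[of _ "1::real"])
  then obtain r where r: "D 1 = of_real r" by (auto elim: Reals_cases)
  have "exp r = 1" using expD[of 1] unfolding r exp_of_real by simp
  then have "D 1 = 0" using r by simp
  then show ?thesis using c[of 1] c[of z] z by (simp add: D_def)
qed

section \<open>Summation of the Binet integrals\<close>

lemma exp_measurable_halfline: "(\<lambda>s. complex_of_real (exp (c * s))) \<in> borel_measurable halfline"
  by (rule borel_measurable_halfline) measurable

context
  fixes l :: real
begin

text \<open>
  The integrand of the integral in \<open>Upsilon (2 * l)\<close>.
\<close>

definition tail_integrand :: "complex \<Rightarrow> real \<Rightarrow> complex" where
  "tail_integrand w s = of_real (binet_phi s) * (exp (- of_real s * w) - 1) / of_real (exp (s * l) - 1)"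

definition tail_integral :: "complex \<Rightarrow> complex" where
  "tail_integral w = (\<integral>s. tail_integrand w s \<partial>halfline)"

lemma tail_integrand_measurable: "tail_integrand w \<in> borel_measurable halfline"
proof (rule borel_measurable_halfline)
  have [measurable]: "binet_phi \<in> borel_measurable borel" by (rule binet_phi_measurable)
  show "tail_integrand w \<in> borel_measurable borel"
    unfolding tail_integrand_def[abs_def] by measurable
qed

context
  assumes l: "l > 0"
begin

lemma tail_integrand_bound:
  assumes s: "s > 0" and w: "norm w \<le> r"
  shows "norm (tail_integrand w s * of_real (exp (- (real n * l * s)))) \<le> r / (4 * l) * exp ((real n * l - r) * (- s))"
proof -
  have "norm (exp (- of_real s * w) - 1) \<le> s * r * exp (s * r)"
  proof -
    have "norm (- of_real s * w) \<le> s * r" using s w by (simp add: norm_mult mult_left_mono)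
    then have "norm (- of_real s * w) * exp (norm (- of_real s * w)) \<le> s * r * exp (s * r)"
      using s order.trans[OF norm_ge_zero w] by (intro mult_mono) auto
    then show ?thesis using norm_exp_minus_1_le[of "- of_real s * w"] by linarith
  qed
  moreover have "s * l \<le> exp (s * l) - 1" using exp_ge_add_one_self[of "s * l"] by linarith
  ultimately have "norm (tail_integrand w s) \<le> 1 / 4 * (s * r * exp (s * r)) / (s * l)"
    unfolding tail_integrand_def norm_mult norm_divide norm_of_real
    using s l binet_phi_bounds[OF s] order.trans[OF norm_ge_zero w]
    by (intro frac_le mult_mono) (auto intro!: mult_nonneg_nonneg)
  also have "\<dots> = r / (4 * l) * exp (s * r)" using s by (simp add: field_simps)
  finally have "norm (tail_integrand w s) * exp (- (real n * l * s)) \<le> r / (4 * l) * exp (s * r) * exp (- (real n * l * s))"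
    by (rule mult_right_mono) simp
  also have "\<dots> = r / (4 * l) * exp ((real n * l - r) * (- s))"
    by (simp add: exp_add[symmetric] algebra_simps)
  finally show ?thesis by (simp add: norm_mult)
qed

text \<open>
  The bound \<open>\<bar>exp (- s w) - 1\<bar> \<le> s \<bar>w\<bar> exp (s \<bar>w\<bar>)\<close> is crude, but the damping factor outweighs its growth as soon as
  \<open>n * l\<close> exceeds \<open>\<bar>w\<bar>\<close>.
\<close>

lemma damped_tail:
  assumes w: "norm w \<le> r" and n: "real n * l > r"
  shows "integrable halfline (\<lambda>s. tail_integrand w s * of_real (exp (- (real n * l * s))))" (is ?i)
    and "norm (\<integral>s. tail_integrand w s * of_real (exp (- (real n * l * s))) \<partial>halfline) \<le> r / (4 * l) * (1 / (real n * l - r))"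
proof -
  have b: "has_bochner_integral halfline (\<lambda>s. r / (4 * l) * exp ((real n * l - r) * (- s))) (r / (4 * l) * (1 / (real n * l - r)))"
    using n by (intro has_bochner_integral_mult_right has_bochner_integral_exp_halfline) auto
  have m: "(\<lambda>s. tail_integrand w s * of_real (exp (- (real n * l * s)))) \<in> borel_measurable halfline"
    using tail_integrand_measurable exp_measurable_halfline[of "- (real n * l)"] by simp
  have r: "r \<ge> 0" using order.trans[OF norm_ge_zero w] .
  have le: "norm (tail_integrand w s * of_real (exp (- (real n * l * s)))) \<le> r / (4 * l) * exp ((real n * l - r) * (- s))"
    if "s \<in> space halfline" for s
    using that w by (intro tail_integrand_bound) (auto simp: space_restrict_space)
  show i: ?i
  proof (rule Bochner_Integration.integrable_bound[OF _ m])
    show "integrable halfline (\<lambda>s. r / (4 * l) * exp ((real n * l - r) * (- s)))"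
      using b by (simp only: has_bochner_integral_iff)
    show "AE s in halfline. norm (tail_integrand w s * of_real (exp (- (real n * l * s)))) \<le> norm (r / (4 * l) * exp ((real n * l - r) * (- s)))"
      by (intro AE_I2 order.trans[OF le]) (simp_all only: real_norm_def abs_ge_self)
  qed
  show "norm (\<integral>s. tail_integrand w s * of_real (exp (- (real n * l * s))) \<partial>halfline) \<le> r / (4 * l) * (1 / (real n * l - r))"
  proof (rule order.trans[OF integral_norm_bound])
    have "(\<integral>s. norm (tail_integrand w s * of_real (exp (- (real n * l * s)))) \<partial>halfline) \<le> (\<integral>s. r / (4 * l) * exp ((real n * l - r) * (- s)) \<partial>halfline)"
      using i b by (intro integral_mono le integrable_norm) (auto simp only: has_bochner_integral_iff)
    then show "(\<integral>s. norm (tail_integrand w s * of_real (exp (- (real n * l * s)))) \<partial>halfline) \<le> r / (4 * l) * (1 / (real n * l - r))"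
      using b by (simp only: has_bochner_integral_iff)
  qed
qed

text \<open>
  Under the integral sign the sum is a geometric series in \<open>exp (- l s)\<close>. Its value consists of the integrand of
  \<open>Upsilon\<close> and a remainder damped by \<open>exp (- n l s)\<close>. Integrability of the former follows, since it is a sum of
  integrable functions.
\<close>

lemma binet_J_sum_diff:
  assumes w: "Re w > - l" and n: "real n * l > norm w"
  shows "integrable halfline (tail_integrand w)"
    and "(\<Sum>j<n. binet_J (of_real (l * real (Suc j)) + w) - binet_J (of_real (l * real (Suc j)))) =
         tail_integral w - (\<integral>s. tail_integrand w s * of_real (exp (- (real n * l * s))) \<partial>halfline)"
proof -
  let ?x = "\<lambda>j. complex_of_real (l * real (Suc j))"
  let ?d = "\<lambda>s. tail_integrand w s * of_real (exp (- (real n * l * s)))"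
  let ?f = "\<lambda>j s. exp ((?x j + w) * of_real (- s)) * of_real (binet_phi s) - exp (?x j * of_real (- s)) * complex_of_real (binet_phi s)"
  have pos: "Re (?x j + w) > 0" "Re (?x j) > 0" for j
  proof -
    have "l * 1 \<le> l * real (Suc j)" using l by (intro mult_left_mono) auto
    then show "Re (?x j + w) > 0" "Re (?x j) > 0"
      using w l by (simp_all only: plus_complex.sel Re_complex_of_real)
  qed
  have fi: "integrable halfline (?f j)" for j
    by (intro Bochner_Integration.integrable_diff binet_J_integrable pos)
  have fint: "(\<integral>s. ?f j s \<partial>halfline) = binet_J (?x j + w) - binet_J (?x j)" for j
    unfolding binet_J_def by (intro Bochner_Integration.integral_diff binet_J_integrable pos)
  have di: "integrable halfline ?d"
    by (rule damped_tail(1)[OF order.refl n])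
  have eq: "tail_integrand w s = (\<Sum>j<n. ?f j s) + ?d s" if "s \<in> space halfline" for s
  proof -
    have s: "s > 0" using that by (simp add: space_restrict_space)
    define q where "q = complex_of_real (exp (- (l * s)))"
    have "exp (- (l * s)) \<noteq> 1" "exp (- (l * s)) \<noteq> 0" using s l by simp_all
    then have q: "q \<noteq> 1" "q \<noteq> 0" unfolding q_def of_real_eq_1_iff of_real_eq_0_iff by blast+
    have f: "?f j s = of_real (binet_phi s) * (exp (- of_real s * w) - 1) * (q * q ^ j)" for j
    proof -
      have "exp (?x j * of_real (- s)) = q ^ Suc j"
      proof -
        have "exp (l * real (Suc j) * (- s)) = exp (- (l * s)) ^ Suc j"
          unfolding exp_of_nat_mult[symmetric] by (simp only: mult_minus_right mult_minus_left mult_ac)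
        then show ?thesis
          unfolding q_def of_real_power[symmetric] by (simp only: exp_of_real of_real_mult[symmetric])
      qed
      moreover have "exp ((?x j + w) * of_real (- s)) = exp (?x j * of_real (- s)) * exp (- of_real s * w)"
        by (simp only: distrib_right exp_add) (simp add: mult.commute)
      ultimately show ?thesis by (simp only: power_Suc) (simp add: algebra_simps)
    qed
    have E: "complex_of_real (exp (s * l) - 1) = 1 / q - 1"
    proof -
      have "exp (s * l) * exp (- (l * s)) = 1"
        unfolding exp_add[symmetric] by (simp add: mult.commute)
      then have "exp (s * l) = 1 / exp (- (l * s))"
        by (metis exp_not_eq_zero nonzero_eq_divide_eq)
      then show ?thesis
        by (simp only: q_def of_real_diff of_real_divide of_real_1)
    qed
    have n: "complex_of_real (exp (- (real n * l * s))) = q ^ n"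
      unfolding q_def of_real_power[symmetric] exp_of_nat_mult[symmetric] by (simp only: mult_minus_right mult_minus_left mult_ac)
    have g: "q * (\<Sum>j<n. q ^ j) = q * (1 - q ^ n) / (1 - q)"
      using q by (simp add: sum_gp_strict)
    have "(\<Sum>j<n. ?f j s) = of_real (binet_phi s) * (exp (- of_real s * w) - 1) * (q * (1 - q ^ n) / (1 - q))"
      unfolding f sum_distrib_left[symmetric] g ..
    moreover have "X / (1 / q - 1) = X * (q * (1 - q ^ n) / (1 - q)) + X / (1 / q - 1) * q ^ n" for X
    proof -
      have "1 / (1 / q - 1) = q / (1 - q)" using q by (simp add: field_simps)
      then have *: "X / (1 / q - 1) = X * (q / (1 - q))" by (metis times_divide_eq_right mult_1_right)
      show ?thesis unfolding * by (simp add: diff_divide_distrib[symmetric] add_divide_distrib[symmetric] algebra_simps)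
    qed
    ultimately show ?thesis
      unfolding tail_integrand_def E n by metis
  qed
  show i: "integrable halfline (tail_integrand w)"
  proof (rule iffD2[OF Bochner_Integration.integrable_cong[OF refl eq]])
    show "integrable halfline (\<lambda>s. (\<Sum>j<n. ?f j s) + ?d s)"
      by (intro Bochner_Integration.integrable_add Bochner_Integration.integrable_sum fi di)
  qed
  have "tail_integral w = (\<integral>s. (\<Sum>j<n. ?f j s) + ?d s \<partial>halfline)"
    unfolding tail_integral_def by (rule Bochner_Integration.integral_cong[OF refl eq])
  also have "\<dots> = (\<integral>s. (\<Sum>j<n. ?f j s) \<partial>halfline) + (\<integral>s. ?d s \<partial>halfline)"
    by (intro Bochner_Integration.integral_add Bochner_Integration.integrable_sum fi di)
  also have "(\<integral>s. (\<Sum>j<n. ?f j s) \<partial>halfline) = (\<Sum>j<n. binet_J (?x j + w) - binet_J (?x j))"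
    by (simp only: Bochner_Integration.integral_sum[OF fi] fint)
  finally show "(\<Sum>j<n. binet_J (?x j + w) - binet_J (?x j)) = tail_integral w - (\<integral>s. ?d s \<partial>halfline)"
    by simp
qed

lemma binet_J_sum_uniform_limit:
  assumes bd: "bounded A" and A: "A \<subseteq> {w. Re w > - l}"
  shows "uniform_limit A (\<lambda>n w. \<Sum>j<n. binet_J (of_real (l * real (Suc j)) + w) - binet_J (of_real (l * real (Suc j)))) tail_integral sequentially"
proof -
  obtain r where r: "\<And>w. w \<in> A \<Longrightarrow> norm w \<le> r" "r > 0"
    using bd by (meson bounded_pos)
  show ?thesis
  proof (rule uniform_limitI)
    fix e :: real assume e: "e > 0"
    have "\<forall>\<^sub>F n in sequentially. real n * l > r"
      using l by real_asymp
    moreover have "(\<lambda>n. r / (4 * l) * (1 / (real n * l - r))) \<longlonglongrightarrow> 0"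
      using l by real_asymp
    then have "\<forall>\<^sub>F n in sequentially. r / (4 * l) * (1 / (real n * l - r)) < e"
      using e by (rule order_tendstoD)
    ultimately show "\<forall>\<^sub>F n in sequentially. \<forall>w\<in>A. dist (\<Sum>j<n. binet_J (of_real (l * real (Suc j)) + w) - binet_J (of_real (l * real (Suc j)))) (tail_integral w) < e"
    proof eventually_elim
      case (elim n)
      show ?case
      proof
        fix w assume w: "w \<in> A"
        have n: "real n * l > norm w" using r(1)[OF w] elim by linarith
        have "Re w > - l" using A w by auto
        from binet_J_sum_diff(2)[OF this n] damped_tail(2)[OF r(1)[OF w] elim(1)] elim(2)
        show "dist (\<Sum>j<n. binet_J (of_real (l * real (Suc j)) + w) - binet_J (of_real (l * real (Suc j)))) (tail_integral w) < e"
          by (simp add: dist_norm norm_minus_commute)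
      qed
    qed
  qed
qed

end

end

section \<open>Sums of log-gamma values along an arithmetic progression\<close>

text \<open>
  The coefficient of \<open>w\<^sup>2 / l\<close> in the sum of \<open>n\<close> log-gamma values, with its logarithmic growth removed.
\<close>

definition harmonic_defect :: "nat \<Rightarrow> real" where
  "harmonic_defect n = (\<Sum>j<n. 1 / real (Suc j) - ln (1 + 1 / real (Suc j)) / 2) - ln (real n) / 2"

lemma harmonic_defect_limit: "harmonic_defect \<longlonglongrightarrow> euler_mascheroni"
proof -
  have "(\<Sum>j<n. 1 / real (Suc j)) = harm n" for n
    unfolding harm_def by (rule sum.reindex_bij_witness[of _ "\<lambda>k. k - 1" Suc]) (auto simp: inverse_eq_divide)
  moreover have "(\<Sum>j<n. ln (1 + 1 / real (Suc j))) = ln (real n + 1)" for n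
  proof (induction n)
    case (Suc n)
    have "ln (real n + 1) + ln (1 + 1 / real (Suc n)) = ln ((real n + 1) * (1 + 1 / real (Suc n)))"
    proof (rule ln_mult_pos[symmetric])
      show "0 < 1 + 1 / real (Suc n)" by (simp add: add_pos_pos)
    qed simp
    also have "(real n + 1) * (1 + 1 / real (Suc n)) = real (Suc n) + 1"
      by (simp add: field_simps)
    finally show ?case using Suc by simp
  qed simp
  ultimately have eq: "harmonic_defect n = (harm n - ln (real n)) - (ln (real n + 1) - ln (real n)) / 2" for n
    unfolding harmonic_defect_def sum_subtractf sum_divide_distrib[symmetric] by (simp add: field_simps)
  have "(\<lambda>n. (harm n - ln (real n)) - (ln (real n + 1) - ln (real n)) / 2) \<longlonglongrightarrow> euler_mascheroni - 0 / 2"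
  proof (intro tendsto_intros)
    show "(\<lambda>n. harm n - ln (real n)) \<longlonglongrightarrow> (euler_mascheroni :: real)"
      by (rule euler_mascheroni_LIMSEQ)
    show "(\<lambda>n. ln (real n + 1) - ln (real n)) \<longlonglongrightarrow> 0" by real_asymp
  qed simp
  then show ?thesis unfolding eq[abs_def] by simp
qed

lemma continuous_on_half_plane:
  "f holomorphic_on {u. Re u > c} \<Longrightarrow> (\<And>w. w \<in> A \<Longrightarrow> Re (h w) > c) \<Longrightarrow> continuous_on A h \<Longrightarrow> continuous_on A (\<lambda>w. f (h w))"
  by (rule continuous_on_compose2[OF holomorphic_on_imp_continuous_on]) auto

context
  fixes l :: real
begin

definition ln_Gamma_sum :: "nat \<Rightarrow> complex \<Rightarrow> complex" where
  "ln_Gamma_sum n w = (\<Sum>j<n. ln_Gamma (of_real (l * real (Suc j)) + w))"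

context
  assumes l: "l > 0"
begin

lemma Re_shift_index_pos: "Re w > - l \<Longrightarrow> Re (of_real (l * real (Suc j)) + w) > 0"
proof -
  assume w: "Re w > - l"
  have "l * 1 \<le> l * real (Suc j)" using l by (intro mult_left_mono) auto
  then show ?thesis using w by (simp only: plus_complex.sel Re_complex_of_real)
qed

text \<open>
  In terms of the Weierstrass series the quadratic term of \<open>ln_barnes_G\<close> cancels the summand \<open>w\<^sup>2 / \<beta>\<close> of \<open>Upsilon\<close>.
\<close>

lemma Upsilon_eq:
  assumes w: "Re w > - l"
  shows "Upsilon (2 * l) w = of_real l * barnes_sum (w / of_real l) + (w - 1 / 2) * gamma_sum (w / of_real l) + tail_integral l w
    + euler_mascheroni / of_real l * w\<^sup>2 + w * (of_real (ln (2 * pi)) / 2 - euler_mascheroni / (2 * of_real l))"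
proof -
  define u where "u = w / of_real l"
  have wu: "w = of_real l * u" using l by (simp add: u_def)
  have "Re w / l > - 1" using w l by (simp add: less_divide_eq)
  then have u: "Re u > -1" by (simp add: u_def Re_divide_of_real)
  have uu: "2 * w / of_real (2 * l) = u" by (simp add: u_def)
  have G: "ln_barnes_G (u + 1) = u / 2 * of_real (ln (2 * pi)) - (u + 1) * u / 2 + barnes_sum u"
    using ln_barnes_G_eq[of "u + 1"] u by (simp add: barnes_log_def)
  have g: "ln_Gamma (u + 1) = - gamma_sum u - euler_mascheroni * u"
    using ln_Gamma_one_plus[OF u] by (simp add: add.commute)
  have t: "(LBINT s:{0<..}. of_real (binet_phi s) * (exp (- of_real s * w) - 1) / of_real (exp (s * (2 * l) / 2) - 1)) = tail_integral l w"
    unfolding tail_integral_def tail_integrand_def set_lebesgue_integral_def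
    by (subst integral_restrict_space) auto
  have lc: "complex_of_real l \<noteq> 0" using l by simp
  show ?thesis
    unfolding Upsilon_def uu G g t u_def[symmetric]
    unfolding wu using lc by (simp add: field_simps power2_eq_square)
qed

text \<open>
  Binet's formula at \<open>l k + w\<close>, where \<open>k = j + 1\<close>, with \<open>Ln (l k + w) = ln (l k) + Ln (1 + u / k)\<close> for \<open>u = w / l\<close>. The
  multiple \<open>l k\<close> of the last logarithm is a Barnes term and the multiple \<open>w - 1 / 2\<close> a gamma term, apart from
  expressions that are affine or quadratic in \<open>w\<close>.
\<close>

lemma ln_Gamma_decomposition:
  assumes w: "Re w > - l"
    and binet: "\<forall>x. Re x > 0 \<longrightarrow> ln_Gamma x = (x - 1 / 2) * Ln x + binet_J x + p * x + (q :: complex)"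
  shows "ln_Gamma (of_real (l * real (Suc j)) + w) =
     (of_real (l * real (Suc j)) - 1 / 2) * of_real (ln (l * real (Suc j))) + p * of_real (l * real (Suc j)) + q + binet_J (of_real (l * real (Suc j)))
   + w * (of_real (ln (l * real (Suc j))) + 1 + p - 1 / (2 * of_real (l * real (Suc j))))
   + of_real l * barnes_term j (w / of_real l) + (w - 1 / 2) * gamma_term j (w / of_real l)
   + (binet_J (of_real (l * real (Suc j)) + w) - binet_J (of_real (l * real (Suc j))))
   + w\<^sup>2 / of_real l * of_real (1 / real (Suc j) - ln (1 + 1 / real (Suc j)) / 2)"
proof -
  define k where "k = complex_of_nat (Suc j)"
  define x where "x = complex_of_real (l * real (Suc j))"
  define L where "L = complex_of_real (ln (l * real (Suc j)))"
  define u where "u = w / of_real l"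
  define Lam where "Lam = Ln (1 + u / k)"
  define h where "h = complex_of_real (ln (1 + 1 / real (Suc j)))"
  have k0: "k \<noteq> 0" unfolding k_def of_nat_eq_0_iff by simp
  have lc: "complex_of_real l \<noteq> 0" using l by simp
  have xk: "x = of_real l * k" by (simp add: x_def k_def)
  have wu: "w = of_real l * u" using lc by (simp add: u_def)
  have "Re w / l > - 1" using w l by (simp add: less_divide_eq)
  then have u: "Re u > -1" by (simp add: u_def Re_divide_of_real)
  have nz: "1 + u / k \<noteq> 0" using one_plus_div_slit[OF u, of j] by (auto simp: k_def)
  have pos: "l * real (Suc j) > 0" using l by simp
  have xw: "x + w = of_real (l * real (Suc j)) * (1 + u / k)"
    unfolding x_def[symmetric] xk wu using k0 by (simp add: algebra_simps)
  have Ln: "Ln (x + w) = L + Lam"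
    unfolding xw L_def Lam_def by (simp only: Ln_times_of_real[OF pos nz] Ln_of_real[OF pos])
  have "ln_Gamma (x + w) = (x + w - 1 / 2) * (L + Lam) + binet_J (x + w) + p * (x + w) + q"
    unfolding Ln[symmetric] x_def by (rule binet[rule_format, OF Re_shift_index_pos[OF w]])
  moreover have bt: "barnes_term j u = k * Lam - u + u\<^sup>2 / 2 * h"
    by (simp only: barnes_term_def k_def Lam_def h_def)
  moreover have gt: "gamma_term j u = Lam - u / k"
    by (simp only: gamma_term_def k_def Lam_def)
  moreover have "complex_of_real (1 / real (Suc j) - ln (1 + 1 / real (Suc j)) / 2) = 1 / k - h / 2"
    by (simp add: k_def h_def)
  moreover have "(x + w - 1 / 2) * (L + Lam) + binet_J (x + w) + p * (x + w) + q =
     (x - 1 / 2) * L + p * x + q + binet_J x + w * (L + 1 + p - 1 / (2 * x))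
     + of_real l * (k * Lam - u + u\<^sup>2 / 2 * h) + (w - 1 / 2) * (Lam - u / k) + (binet_J (x + w) - binet_J x) + w\<^sup>2 / of_real l * (1 / k - h / 2)"
    unfolding xk wu using k0 lc by (simp add: field_simps power2_eq_square)
  ultimately show ?thesis
    unfolding x_def[symmetric] L_def[symmetric] u_def[symmetric] by (simp only:)
qed

text \<open>
  Summing the decomposition, the Barnes terms, the gamma terms and the Binet integrals converge to the three
  transcendental parts of \<open>Upsilon\<close>, the coefficient of \<open>w\<^sup>2\<close> is \<open>ln n / (2 l)\<close> up to a convergent sequence, and the
  affine terms are collected in \<open>a\<close> and \<open>b\<close>.
\<close>

lemma ln_Gamma_sum_asymptotics:
  obtains a b :: "nat \<Rightarrow> complex"
  where "\<And>A. compact A \<Longrightarrow> A \<subseteq> {w. Re w > - l} \<Longrightarrow>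
    uniform_limit A (\<lambda>n w. ln_Gamma_sum n w - a n - b n * w - w\<^sup>2 / of_real (2 * l) * of_real (ln (real n))) (Upsilon (2 * l)) sequentially"
proof -
  obtain p q :: complex where binet: "\<forall>x. Re x > 0 \<longrightarrow> ln_Gamma x = (x - 1 / 2) * Ln x + binet_J x + p * x + q"
    using binet_up_to_affine by blast
  let ?x = "\<lambda>j. complex_of_real (l * real (Suc j))" and ?L = "\<lambda>j. complex_of_real (ln (l * real (Suc j)))"
  define c where "c = complex_of_real (ln (2 * pi)) / 2 - euler_mascheroni / (2 * of_real l)"
  define a where "a n = (\<Sum>j<n. (?x j - 1 / 2) * ?L j + p * ?x j + q + binet_J (?x j))" for n
  define b where "b n = (\<Sum>j<n. ?L j + 1 + p - 1 / (2 * ?x j)) - c" for n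
  define V where "V n w = of_real l * (\<Sum>j<n. barnes_term j (w / of_real l)) + (w - 1 / 2) * (\<Sum>j<n. gamma_term j (w / of_real l))
     + (\<Sum>j<n. binet_J (?x j + w) - binet_J (?x j)) + of_real (harmonic_defect n) * (w\<^sup>2 / of_real l) + w * c" for n w
  have lc: "complex_of_real l \<noteq> 0" using l by simp
  have V: "ln_Gamma_sum n w - a n - b n * w - w\<^sup>2 / of_real (2 * l) * of_real (ln (real n)) = V n w" if w: "Re w > - l" for n w
  proof -
    have "ln_Gamma_sum n w = a n + w * (\<Sum>j<n. ?L j + 1 + p - 1 / (2 * ?x j)) + of_real l * (\<Sum>j<n. barnes_term j (w / of_real l))
      + (w - 1 / 2) * (\<Sum>j<n. gamma_term j (w / of_real l)) + (\<Sum>j<n. binet_J (?x j + w) - binet_J (?x j))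
      + w\<^sup>2 / of_real l * (\<Sum>j<n. of_real (1 / real (Suc j) - ln (1 + 1 / real (Suc j)) / 2))"
      unfolding ln_Gamma_sum_def ln_Gamma_decomposition[OF w binet] a_def sum_distrib_left sum.distrib[symmetric] ..
    moreover have "(\<Sum>j<n. complex_of_real (1 / real (Suc j) - ln (1 + 1 / real (Suc j)) / 2)) = of_real (harmonic_defect n + ln (real n) / 2)"
      unfolding harmonic_defect_def of_real_sum[symmetric] by simp
    moreover have "w\<^sup>2 / of_real (2 * l) = w\<^sup>2 / of_real l / 2" by simp
    ultimately show ?thesis
      unfolding V_def b_def by (simp add: algebra_simps add_divide_distrib)
  qed
  have "uniform_limit A (\<lambda>n w. ln_Gamma_sum n w - a n - b n * w - w\<^sup>2 / of_real (2 * l) * of_real (ln (real n))) (Upsilon (2 * l)) sequentially"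
    if A: "compact A" "A \<subseteq> {w. Re w > - l}" for A
  proof -
    let ?B = "(\<lambda>w. w / of_real l) ` A"
    have bA: "bounded A" by (rule compact_imp_bounded[OF A(1)])
    have cdiv: "continuous_on A (\<lambda>w. w / complex_of_real l)"
      using lc by (intro continuous_intros) auto
    have bB: "bounded ?B" by (intro compact_imp_bounded compact_continuous_image cdiv A)
    have ReB: "Re (w / of_real l) > -1" if "w \<in> A" for w
      using A that l by (auto simp: Re_divide_of_real less_divide_eq)
    have u1: "uniform_limit A (\<lambda>n w. \<Sum>j<n. barnes_term j (w / of_real l)) (\<lambda>w. barnes_sum (w / of_real l)) sequentially"
      by (rule uniform_limit_compose'[OF barnes_sum_uniform_limit[OF bB]]) auto
    have u2: "uniform_limit A (\<lambda>n w. \<Sum>j<n. gamma_term j (w / of_real l)) (\<lambda>w. gamma_sum (w / of_real l)) sequentially"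
      by (rule uniform_limit_compose'[OF gamma_sum_uniform_limit[OF bB]]) auto
    have bg: "bounded ((\<lambda>w. gamma_sum (w / of_real l)) ` A)" "bounded ((\<lambda>w. w - 1 / 2) ` A)" "bounded ((\<lambda>w. w\<^sup>2 / of_real l) ` A)"
      by (intro compact_imp_bounded compact_continuous_image A continuous_on_half_plane[OF gamma_sum_holomorphic] cdiv ReB continuous_intros; use lc in simp)+
    have u3: "uniform_limit A (\<lambda>n w. (w - 1 / 2) * (\<Sum>j<n. gamma_term j (w / of_real l))) (\<lambda>w. (w - 1 / 2) * gamma_sum (w / of_real l)) sequentially"
      by (rule uniform_lim_mult[OF uniform_limit_const u2 bg(2,1)])
    have "uniform_limit A (\<lambda>n w. complex_of_real (harmonic_defect n)) (\<lambda>w. of_real euler_mascheroni) sequentially"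
    proof (rule uniform_limitI)
      fix e :: real assume "e > 0"
      from tendstoD[OF tendsto_of_real[OF harmonic_defect_limit, where 'a = complex] this]
      show "\<forall>\<^sub>F n in sequentially. \<forall>w\<in>A. dist (complex_of_real (harmonic_defect n)) (of_real euler_mascheroni) < e"
        by (rule eventually_mono) simp
    qed
    then have u4: "uniform_limit A (\<lambda>n w. of_real (harmonic_defect n) * (w\<^sup>2 / of_real l)) (\<lambda>w. of_real euler_mascheroni * (w\<^sup>2 / of_real l)) sequentially"
      by (rule uniform_lim_mult[OF _ uniform_limit_const _ bg(3)]) (auto simp: bounded_iff)
    have "uniform_limit A V (\<lambda>w. of_real l * barnes_sum (w / of_real l) + (w - 1 / 2) * gamma_sum (w / of_real l) + tail_integral l w
        + of_real euler_mascheroni * (w\<^sup>2 / of_real l) + w * c) sequentially"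
      unfolding V_def[abs_def]
      by (intro uniform_limit_add u3 u4 uniform_limit_const binet_J_sum_uniform_limit l bA A
          bounded_linear.uniform_limit[OF bounded_linear_mult_right u1])
    then show ?thesis
    proof (rule uniform_limit_cong'[THEN iffD1, rotated -1])
      show "V n w = ln_Gamma_sum n w - a n - b n * w - w\<^sup>2 / of_real (2 * l) * of_real (ln (real n))" if "w \<in> A" for n w
        using V[of w n] A that by auto
      show "of_real l * barnes_sum (w / of_real l) + (w - 1 / 2) * gamma_sum (w / of_real l) + tail_integral l w
        + of_real euler_mascheroni * (w\<^sup>2 / of_real l) + w * c = Upsilon (2 * l) w" if "w \<in> A" for w
        using Upsilon_eq[of w] A that by (auto simp: c_def)
    qed
  qed
  then show ?thesis using that by blast
qed

text \<open>
  A locally uniform limit of continuous functions.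
\<close>

lemma Upsilon_continuous_on:
  assumes A: "compact A" "A \<subseteq> {w. Re w > - l}"
  shows "continuous_on A (Upsilon (2 * l))"
proof -
  obtain a b :: "nat \<Rightarrow> complex" where ab: "\<And>A. compact A \<Longrightarrow> A \<subseteq> {w. Re w > - l} \<Longrightarrow>
    uniform_limit A (\<lambda>n w. ln_Gamma_sum n w - a n - b n * w - w\<^sup>2 / of_real (2 * l) * of_real (ln (real n))) (Upsilon (2 * l)) sequentially"
    using ln_Gamma_sum_asymptotics by blast
  show ?thesis
  proof (rule uniform_limit_theorem[OF always_eventually ab[OF A]], intro allI)
    fix n
    have "of_real (l * real (Suc j)) + w \<notin> \<real>\<^sub>\<le>\<^sub>0" if "w \<in> A" for w j
      using Re_shift_index_pos[of w j] A that by (auto simp: complex_nonpos_Reals_iff)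
    then show "continuous_on A (\<lambda>w. ln_Gamma_sum n w - a n - b n * w - w\<^sup>2 / of_real (2 * l) * of_real (ln (real n)))"
      unfolding ln_Gamma_sum_def using l
      by (intro continuous_intros continuous_on_compose2[OF holomorphic_on_imp_continuous_on[OF holomorphic_ln_Gamma[of "- \<real>\<^sub>\<le>\<^sub>0"]]]) auto
  qed simp
qed

end

end

section \<open>The moment generating function of the characteristic polynomial\<close>

lemma det_one_minus_eq_prod:
  assumes A: "A \<in> carrier_mat n n" and cp: "char_poly A = (\<Prod>k<n. [:- cis (t k), 1:])"
  shows "Determinant.det (1\<^sub>m n - A) = (\<Prod>k<n. 1 - cis (t k))"
proof -
  have "poly (char_poly A) 1 = Determinant.det (- char_matrix A 1)"
    by (rule char_poly_matrix[OF A])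
  also have "- char_matrix A 1 = 1\<^sub>m n - A"
    using A by (intro eq_matI) (auto simp: char_matrix_def)
  finally show ?thesis
    unfolding cp by (simp add: poly_prod)
qed

lemma jacobi_weight_eq:
  assumes b: "\<beta> > 0" and \<theta>: "\<theta> \<in> space (angles n)"
  shows "circular_jacobi_weight \<beta> \<delta> n \<theta> = exp (2 * Re \<delta> * log_abs n \<theta>) * tilt n (\<beta> / 2) (Im \<delta>) \<theta>"
proof -
  have l: "\<beta> / 2 > 0" using b by simp
  have d: "complex_of_real (2 * Re \<delta>) / 2 + \<i> * of_real (Im \<delta>) = \<delta>" "complex_of_real (2 * Re \<delta>) / 2 - \<i> * of_real (Im \<delta>) = cnj \<delta>"
    by (simp_all add: complex_eq_iff)
  have "morris_weight n (of_real (\<beta> / 2)) \<delta> (cnj \<delta>) \<theta> = of_real (exp (2 * Re \<delta> * log_abs n \<theta>) * tilt n (\<beta> / 2) (Im \<delta>) \<theta>)"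
    using morris_weight_line[OF \<theta>, where l = "\<beta> / 2" and s = "of_real (2 * Re \<delta>)" and \<eta> = "Im \<delta>"] unfolding d
    by (simp add: exp_of_real[symmetric])
  moreover have "morris_weight n (of_real (\<beta> / 2)) \<delta> (cnj \<delta>) \<theta> = of_real (vand n \<theta> powr \<beta>) * (\<Prod>k<n. jac \<delta> (cnj \<delta>) (\<theta> k))"
    using powr_of_real[OF vand_nonneg, of n \<theta> \<beta>] by (simp add: morris_weight_def)
  moreover have "vand n \<theta> powr \<beta> = (\<Prod>j<n. \<Prod>k<j. cmod (cis (\<theta> k) - cis (\<theta> j)) powr \<beta>)"
    by (simp add: vand_def prod_powr_distrib)
  ultimately show ?thesis
    unfolding circular_jacobi_weight_def jac_def[symmetric] 
  proof -
    assume 1: "morris_weight n (of_real (\<beta> / 2)) \<delta> (cnj \<delta>) \<theta> = of_real (exp (2 * Re \<delta> * log_abs n \<theta>) * tilt n (\<beta> / 2) (Im \<delta>) \<theta>)"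
      and 2: "morris_weight n (of_real (\<beta> / 2)) \<delta> (cnj \<delta>) \<theta> = of_real (vand n \<theta> powr \<beta>) * (\<Prod>k<n. jac \<delta> (cnj \<delta>) (\<theta> k))"
      and 3: "vand n \<theta> powr \<beta> = (\<Prod>j<n. \<Prod>k<j. cmod (cis (\<theta> k) - cis (\<theta> j)) powr \<beta>)"
    have "Re (of_real (vand n \<theta> powr \<beta>) * (\<Prod>k<n. jac \<delta> (cnj \<delta>) (\<theta> k))) = exp (2 * Re \<delta> * log_abs n \<theta>) * tilt n (\<beta> / 2) (Im \<delta>) \<theta>"
      unfolding 2[symmetric] 1 by (rule Re_complex_of_real)
    then show "(\<Prod>j<n. \<Prod>k<j. cmod (cis (\<theta> k) - cis (\<theta> j)) powr \<beta>) * Re (\<Prod>k<n. jac \<delta> (cnj \<delta>) (\<theta> k)) = exp (2 * Re \<delta> * log_abs n \<theta>) * tilt n (\<beta> / 2) (Im \<delta>) \<theta>"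
      unfolding 3[symmetric] by simp
  qed
qed

text \<open>
  The index of \<open>ln_Gamma_sum\<close> starts at \<open>l\<close> and that of \<open>line_gamma\<close> at 0, hence the shift by \<open>l\<close>.
\<close>

lemma line_gamma_eq_exp_ln_Gamma_sums:
  assumes l: "l > 0" and s: "Re s > -1"
  shows "line_gamma n l \<eta> s = exp (ln_Gamma_sum l n (1 + s - of_real l) - ln_Gamma_sum l n (1 + s / 2 + \<i> * of_real \<eta> - of_real l)
      - ln_Gamma_sum l n (1 + s / 2 - \<i> * of_real \<eta> - of_real l))"
proof -
  have e: "exp (ln_Gamma z) = Gamma z" "exp (- ln_Gamma z) = rGamma z" if "Re z > 0" for z
    using not_nonpos_Ints_Re[OF that] by (simp_all add: Gamma_complex_altdef exp_minus rGamma_inverse_Gamma)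
  have sh: "of_real (l * real (Suc j)) + (x - of_real l) = x + of_real l * of_nat j" for j x
    by (simp add: algebra_simps)
  have "exp (ln_Gamma_sum l n (1 + s - of_real l) - ln_Gamma_sum l n (1 + s / 2 + \<i> * of_real \<eta> - of_real l)
      - ln_Gamma_sum l n (1 + s / 2 - \<i> * of_real \<eta> - of_real l)) =
     (\<Prod>j<n. exp (ln_Gamma (1 + s + of_real l * of_nat j)) * exp (- ln_Gamma (1 + s / 2 + \<i> * of_real \<eta> + of_real l * of_nat j))
       * exp (- ln_Gamma (1 + s / 2 - \<i> * of_real \<eta> + of_real l * of_nat j)))"
    unfolding ln_Gamma_sum_def sh sum_subtractf[symmetric]
    by (simp add: exp_sum exp_add[symmetric])
  also have "\<dots> = line_gamma n l \<eta> s"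
    unfolding line_gamma_def using Re_shift_pos[OF l s] by (intro prod.cong refl) (simp only: e)
  finally show ?thesis ..
qed

lemma ln_prod_chord_eq_log_abs:
  assumes \<theta>: "\<theta> \<in> space (angles n)" and nz: "\<And>k. k < n \<Longrightarrow> \<theta> k \<noteq> 0"
  shows "ln (\<Prod>k<n. cmod (1 - cis (\<theta> k))) = log_abs n \<theta>"
proof -
  have c: "cmod (1 - cis (\<theta> k)) = 2 * sin (\<theta> k / 2)" "2 * sin (\<theta> k / 2) \<noteq> 0" if "k < n" for k
  proof -
    have "\<theta> k \<in> {0..<2 * pi}" using \<theta> that by (auto simp: space_angles PiE_iff)
    then have "sin (\<theta> k / 2) > 0" using nz[OF that] by (intro sin_gt_zero) auto
    then show "cmod (1 - cis (\<theta> k)) = 2 * sin (\<theta> k / 2)" "2 * sin (\<theta> k / 2) \<noteq> 0" by (simp_all add: cmod_one_minus_cis)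
  qed
  have "ln (\<Prod>k<n. cmod (1 - cis (\<theta> k))) = (\<Sum>k<n. ln (cmod (1 - cis (\<theta> k))))"
    by (rule ln_prod) (use c in auto)
  also have "\<dots> = log_abs n \<theta>"
    unfolding log_abs_def ln_chord_def by (intro sum.cong refl) (simp add: c)
  finally show ?thesis .
qed

text \<open>
  The density of the eigenangles multiplied by \<open>\<bar>Z\<bar> powr z\<close> is the Morris weight at \<open>s = 2 Re \<delta> + z\<close>. The unknown factor
  in \<open>line_morris_eq_gamma\<close> and the normalization of the density cancel, because the total mass is 1.
\<close>

lemma circular_jacobi_mgf:
  fixes \<beta> :: real and \<delta> :: complex
  assumes b: "\<beta> > 0" and d: "Re \<delta> > - 1 / 3"
    and E: "circular_jacobi_ensemble \<beta> \<delta> n M W \<theta>"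
    and X: "\<And>\<omega>. X \<omega> = ln (cmod (Determinant.det (1\<^sub>m n - W \<omega>))) - c"
  shows "prob_space M" and "X \<in> borel_measurable M"
    and "\<And>z. Re z > - 1 / 3 \<Longrightarrow> integrable M (\<lambda>\<omega>. exp (z * of_real (X \<omega>)))"
    and "\<And>z. Re z > - 1 / 3 \<Longrightarrow> (\<integral>\<omega>. exp (z * of_real (X \<omega>)) \<partial>M) =
       exp (- z * of_real c) * line_gamma n (\<beta> / 2) (Im \<delta>) (of_real (2 * Re \<delta>) + z) / line_gamma n (\<beta> / 2) (Im \<delta>) (of_real (2 * Re \<delta>))"
proof -
  define l where "l = \<beta> / 2"
  have l: "l > 0" using b by (simp add: l_def)
  define \<eta> where "\<eta> = Im \<delta>"
  define \<rho> where "\<rho> = 2 * Re \<delta>"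
  show P: "prob_space M" using E by (simp add: circular_jacobi_ensemble_def)
  obtain C where D: "distributed M (angles n) \<theta> (\<lambda>x. ennreal (C * circular_jacobi_weight \<beta> \<delta> n x))"
    using E unfolding circular_jacobi_ensemble_def angles_def by blast
  have \<theta>m: "\<theta> \<in> measurable M (angles n)" using D by (rule distributed_measurable)
  define Y where "Y x = ln (\<Prod>k<n. cmod (1 - cis (x k))) - c" for x :: "nat \<Rightarrow> real"
  have Ym: "Y \<in> borel_measurable (angles n)"
    unfolding Y_def by (intro borel_measurable_diff borel_measurable_const borel_measurable_ln borel_measurable_prod
      measurable_compose[OF _ borel_measurable_norm] cis_angle_measurable) auto
  have XY: "X \<omega> = Y (\<theta> \<omega>)" if "\<omega> \<in> space M" for \<omega>
  proof -
    have "W \<omega> \<in> carrier_mat n n" "char_poly (W \<omega>) = (\<Prod>k<n. [:- cis (\<theta> \<omega> k), 1:])"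
      using E that by (auto simp: circular_jacobi_ensemble_def)
    then show ?thesis
      unfolding X Y_def by (simp add: det_one_minus_eq_prod prod_norm)
  qed
  have "(\<lambda>\<omega>. Y (\<theta> \<omega>)) \<in> borel_measurable M" by (rule measurable_compose[OF \<theta>m Ym])
  then show Xm: "X \<in> borel_measurable M" using XY by (simp cong: measurable_cong)
  define g where "g x = exp (\<rho> * log_abs n x) * tilt n l \<eta> x" for x
  have wg: "circular_jacobi_weight \<beta> \<delta> n x = g x" if "x \<in> space (angles n)" for x
    using jacobi_weight_eq[OF b that, of \<delta>] by (simp add: g_def l_def \<eta>_def \<rho>_def)
  have gnn: "g x \<ge> 0" for x unfolding g_def using tilt_nonneg by simp
  have gm: "g \<in> borel_measurable (angles n)"
    unfolding g_def[abs_def] using log_abs_measurable[of n] tilt_measurable[of n l \<eta>] by measurable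
  have distr: "distr M (angles n) \<theta> = density (angles n) (\<lambda>x. ennreal (C * g x))"
  proof -
    have "distr M (angles n) \<theta> = density (angles n) (\<lambda>x. ennreal (C * circular_jacobi_weight \<beta> \<delta> n x))"
      using D by (rule distributed_distr_eq_density[symmetric, THEN sym])
    also have "\<dots> = density (angles n) (\<lambda>x. ennreal (C * g x))"
      by (intro density_cong AE_I2) (use D gm wg in \<open>auto simp: distributed_def\<close>)
    finally show ?thesis .
  qed
  have C: "C \<ge> 0"
  proof (rule ccontr)
    assume "\<not> C \<ge> 0"
    then have "C * g x \<le> 0" for x using gnn[of x] by (simp add: mult_nonpos_nonneg)
    then have "density (angles n) (\<lambda>x. ennreal (C * g x)) = density (angles n) (\<lambda>x. 0)"
      by (simp add: ennreal_neg)
    then have "emeasure (distr M (angles n) \<theta>) (space (angles n)) = 0"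
      unfolding distr by (simp add: emeasure_density)
    moreover have "emeasure (distr M (angles n) \<theta>) (space (angles n)) = 1"
      using prob_space.emeasure_space_1[OF prob_space.prob_space_distr[OF P \<theta>m]] by simp
    ultimately show False by simp
  qed
  have f_eq: "(C * g x) *\<^sub>R exp (z * of_real (Y x)) = of_real C * exp (- z * of_real c) * (exp ((of_real \<rho> + z) * of_real (log_abs n x)) * of_real (tilt n l \<eta> x))"
    if x: "x \<in> space (angles n)" for x and z :: complex
  proof (cases "\<exists>k<n. x k = 0")
    case True
    then have "tilt n l \<eta> x = 0" unfolding tilt_def by auto
    then show ?thesis by (simp add: g_def)
  next
    case False
    then have Y: "Y x = log_abs n x - c" unfolding Y_def using ln_prod_chord_eq_log_abs[OF x] by auto
    have "exp ((complex_of_real \<rho> + z) * of_real (log_abs n x)) = of_real (exp (\<rho> * log_abs n x)) * exp (z * of_real (log_abs n x))"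
      by (simp add: distrib_right exp_add exp_of_real[symmetric])
    moreover have "exp (z * of_real (Y x)) = exp (- z * of_real c) * exp (z * of_real (log_abs n x))"
      unfolding Y by (simp add: exp_add[symmetric] algebra_simps)
    ultimately show ?thesis by (simp only: g_def scaleR_conv_of_real of_real_mult mult_ac)
  qed
  have fm: "(\<lambda>x. exp (z * of_real (Y x))) \<in> borel_measurable (angles n)" for z :: complex
    using Ym by measurable
  have Cg: "(\<lambda>x. C * g x) \<in> borel_measurable (angles n)" "AE x in angles n. 0 \<le> C * g x"
    using gm C gnn by auto
  have int_s: "integrable (angles n) (\<lambda>x. exp (s * of_real (log_abs n x)) * of_real (tilt n l \<eta> x))" if "Re s > -1" for s
  proof -
    have "integrable (angles n) (\<lambda>x. exp (Re s * log_abs n x) * tilt n l \<eta> x)"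
      by (rule tilted_exp_integrable[OF l that])
    then show ?thesis
    proof (rule Bochner_Integration.integrable_bound)
      show "(\<lambda>x. exp (s * of_real (log_abs n x)) * complex_of_real (tilt n l \<eta> x)) \<in> borel_measurable (angles n)"
        using log_abs_measurable[of n] tilt_measurable[of n l \<eta>] by measurable
    qed (simp add: norm_mult norm_exp_eq_Re)
  qed
  \<comment> \<open>Transport the expectation to the angles and compare with \<open>line_morris\<close>.\<close>
  have key: "integrable M (\<lambda>\<omega>. exp (z * of_real (X \<omega>)))"
    "(\<integral>\<omega>. exp (z * of_real (X \<omega>)) \<partial>M) = of_real C * exp (- z * of_real c) * line_morris n l \<eta> (of_real \<rho> + z)"
    if z: "Re (of_real \<rho> + z) > -1" for z
  proof -
    have i: "integrable (angles n) (\<lambda>x. (C * g x) *\<^sub>R exp (z * of_real (Y x)))"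
      by (rule iffD2[OF Bochner_Integration.integrable_cong[OF refl f_eq]]) (assumption, intro integrable_mult_right int_s z)
    then have "integrable (distr M (angles n) \<theta>) (\<lambda>x. exp (z * of_real (Y x)))"
      unfolding distr using integrable_density[OF fm Cg] by blast
    then have "integrable M (\<lambda>\<omega>. exp (z * of_real (Y (\<theta> \<omega>))))"
      by (simp add: integrable_distr_eq[OF \<theta>m fm])
    then show "integrable M (\<lambda>\<omega>. exp (z * of_real (X \<omega>)))"
      by (rule iffD2[OF Bochner_Integration.integrable_cong[OF refl], rotated]) (simp add: XY)
    have "(\<integral>\<omega>. exp (z * of_real (X \<omega>)) \<partial>M) = (\<integral>\<omega>. exp (z * of_real (Y (\<theta> \<omega>))) \<partial>M)"
      by (intro Bochner_Integration.integral_cong refl) (simp add: XY)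
    also have "\<dots> = (\<integral>x. exp (z * of_real (Y x)) \<partial>distr M (angles n) \<theta>)"
      by (rule integral_distr[OF \<theta>m fm, symmetric])
    also have "\<dots> = (\<integral>x. (C * g x) *\<^sub>R exp (z * of_real (Y x)) \<partial>angles n)"
      unfolding distr by (rule integral_density[OF fm Cg])
    also have "\<dots> = (\<integral>x. of_real C * exp (- z * of_real c) * (exp ((of_real \<rho> + z) * of_real (log_abs n x)) * of_real (tilt n l \<eta> x)) \<partial>angles n)"
      by (intro Bochner_Integration.integral_cong refl f_eq)
    also have "\<dots> = of_real C * exp (- z * of_real c) * line_morris n l \<eta> (of_real \<rho> + z)"
      by (simp add: line_morris_eq)
    finally show "(\<integral>\<omega>. exp (z * of_real (X \<omega>)) \<partial>M) = of_real C * exp (- z * of_real c) * line_morris n l \<eta> (of_real \<rho> + z)" .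
  qed
  have \<rho>: "\<rho> > - 2 / 3" using d by (simp add: \<rho>_def)
  have z: "Re (of_real \<rho> + z) > -1" if "Re z > - 1 / 3" for z using that \<rho> by simp
  show "integrable M (\<lambda>\<omega>. exp (z * of_real (X \<omega>)))" if "Re z > - 1 / 3" for z
    by (rule key(1)[OF z[OF that]])
  define \<kappa> where "\<kappa> = line_morris n l \<eta> 0 / line_gamma n l \<eta> 0"
  have LM: "line_morris n l \<eta> s = \<kappa> * line_gamma n l \<eta> s" if "Re s > -1" for s
    unfolding \<kappa>_def by (rule line_morris_eq_gamma[OF l that])
  have "1 = of_real C * line_morris n l \<eta> (of_real \<rho>)"
    using key(2)[of 0] z[of 0] prob_space.prob_space[OF P] by simp
  also have "\<dots> = of_real C * \<kappa> * line_gamma n l \<eta> (of_real \<rho>)"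
    using LM[of "of_real \<rho>"] z[of 0] by simp
  finally have one: "of_real C * \<kappa> * line_gamma n l \<eta> (of_real \<rho>) = 1" by simp
  then have nz: "line_gamma n l \<eta> (of_real \<rho>) \<noteq> 0" by auto
  have Ck: "of_real C * \<kappa> = 1 / line_gamma n l \<eta> (of_real \<rho>)"
    using one nz by (simp add: nonzero_eq_divide_eq)
  show "(\<integral>\<omega>. exp (z * of_real (X \<omega>)) \<partial>M) =
       exp (- z * of_real c) * line_gamma n (\<beta> / 2) (Im \<delta>) (of_real (2 * Re \<delta>) + z) / line_gamma n (\<beta> / 2) (Im \<delta>) (of_real (2 * Re \<delta>))"
    if "Re z > - 1 / 3" for z
  proof -
    have "(\<integral>\<omega>. exp (z * of_real (X \<omega>)) \<partial>M) = of_real C * exp (- z * of_real c) * (\<kappa> * line_gamma n l \<eta> (of_real \<rho> + z))"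
      unfolding key(2)[OF z[OF that]] LM[OF z[OF that]] ..
    also have "\<dots> = (of_real C * \<kappa>) * (exp (- z * of_real c) * line_gamma n l \<eta> (of_real \<rho> + z))"
      by (simp only: mult_ac)
    finally show ?thesis
      unfolding Ck l_def[symmetric] \<eta>_def[symmetric] \<rho>_def[symmetric] by simp
  qed
qed

section \<open>Mod-Gaussian convergence\<close>

lemma strip_one_third: "z \<in> strip (- 1 / 3) \<infinity> \<longleftrightarrow> Re z > - 1 / 3"
proof -
  have "(- 1 / 3 :: ereal) = ereal (- 1) / ereal 3"
    by (simp add: one_ereal_def)
  also have "\<dots> = ereal (- 1 / 3)" by simp
  finally show ?thesis by (simp add: strip_def)
qed

text \<open>
  The exponential is uniformly continuous only on bounded sets; the values of the limit are bounded, and so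
  eventually are those of the sequence.
\<close>

lemma uniform_limit_exp:
  fixes F :: "nat \<Rightarrow> 'b \<Rightarrow> complex"
  assumes F: "uniform_limit A F f sequentially" and f: "bounded (f ` A)"
  shows "uniform_limit A (\<lambda>n z. exp (F n z)) (\<lambda>z. exp (f z)) sequentially"
proof -
  obtain B where B: "\<And>z. z \<in> A \<Longrightarrow> norm (f z) \<le> B" using f by (auto simp: bounded_iff)
  have "uniform_limit A (\<lambda>n z. exp (F n z)) (exp \<circ> f) sequentially"
  proof (rule uniform_limit_compose[OF F])
    show "uniformly_continuous_on (cball 0 (B + 1)) (exp :: complex \<Rightarrow> complex)"
      by (intro compact_uniformly_continuous continuous_intros compact_cball)
    show "\<forall>\<^sub>F n in sequentially. F n ` A \<subseteq> cball 0 (B + 1)"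
    proof (rule eventually_mono)
      show "\<forall>\<^sub>F n in sequentially. \<forall>x\<in>A. dist (F n x) (f x) < 1"
        by (rule uniform_limitD[OF F]) simp
      fix n assume *: "\<forall>x\<in>A. dist (F n x) (f x) < 1"
      have "norm (F n x) \<le> B + 1" if "x \<in> A" for x
      proof -
        have "norm (F n x) \<le> norm (f x) + dist (F n x) (f x)"
          using norm_triangle_sub[of "F n x" "f x"] by (simp add: dist_norm)
        then show ?thesis using *[rule_format, OF that] B[OF that] by linarith
      qed
      then show "F n ` A \<subseteq> cball 0 (B + 1)" by auto
    qed
    show "f ` A \<subseteq> cball 0 (B + 1)" using B by (auto intro!: add_increasing2)
  qed
  then show ?thesis by (simp add: o_def)
qed

theorem theorem4p15:
  fixes \<beta> :: real and \<delta> :: complex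
    and M :: "nat \<Rightarrow> 'a measure"
    and W :: "nat \<Rightarrow> 'a \<Rightarrow> complex mat"
    and \<theta> :: "nat \<Rightarrow> 'a \<Rightarrow> nat \<Rightarrow> real"
    and Z :: "nat \<Rightarrow> 'a \<Rightarrow> complex"
    and X :: "nat \<Rightarrow> 'a \<Rightarrow> real"
  assumes "\<beta> > 0" and "Re \<delta> > - 1 / 3"
    and "\<And>n. n \<ge> 1 \<Longrightarrow> circular_jacobi_ensemble \<beta> \<delta> n (M n) (W n) (\<theta> n)"
    and "\<And>n \<omega>. Z n \<omega> = Determinant.det (1\<^sub>m n - W n \<omega>)"
    and "\<And>n \<omega>. X n \<omega> = ln (cmod (Z n \<omega>)) - Re (\<delta> + cnj \<delta>) / \<beta> * ln (real n)"
  shows "mod_gaussian_convergent M X (- 1 / 3) \<infinity> (\<lambda>n. ln (real n) / \<beta>) (circular_jacobi_psi \<beta> \<delta>)"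
proof -
  define l where "l = \<beta> / 2"
  have l: "l > 0" and \<beta>l: "\<beta> = 2 * l" using assms(1) by (simp_all add: l_def)
  have lc: "complex_of_real l \<noteq> 0" using l by simp
  let ?c = "\<lambda>n. Re (\<delta> + cnj \<delta>) / \<beta> * ln (real n)"
  have X: "X n \<omega> = ln (cmod (Determinant.det (1\<^sub>m n - W n \<omega>))) - ?c n" for n \<omega>
    by (simp only: assms(4,5))
  note mgf = circular_jacobi_mgf[OF assms(1,2,3) X]
  obtain a b :: "nat \<Rightarrow> complex" where ab: "\<And>A. compact A \<Longrightarrow> A \<subseteq> {w. Re w > - l} \<Longrightarrow>
    uniform_limit A (\<lambda>n w. ln_Gamma_sum l n w - a n - b n * w - w\<^sup>2 / of_real (2 * l) * of_real (ln (real n))) (Upsilon (2 * l)) sequentially"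
    using ln_Gamma_sum_asymptotics[OF l] by blast
  define V where "V n w = ln_Gamma_sum l n w - a n - b n * w - w\<^sup>2 / of_real (2 * l) * of_real (ln (real n))" for n w
  define w1 w3 w5 where "w1 = 1 + \<delta> - of_real l" "w3 = 1 + cnj \<delta> - of_real l" "w5 = 1 + \<delta> + cnj \<delta> - of_real l"
  define w2 w4 w6 where "w2 z = 1 + \<delta> + z / 2 - of_real l" and "w4 z = 1 + cnj \<delta> + z / 2 - of_real l"
    and "w6 z = 1 + \<delta> + cnj \<delta> + z - of_real l" for z
  note w_defs = w1_w3_w5_def w2_def w4_def w6_def
  have limit_V: "uniform_limit K (\<lambda>n z. V n (h z)) (\<lambda>z. Upsilon \<beta> (h z)) sequentially"
      "bounded ((\<lambda>z. Upsilon \<beta> (h z)) ` K)"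
    if K: "compact K" "continuous_on K h" "\<And>z. z \<in> K \<Longrightarrow> Re (h z) > - l" for K and h :: "complex \<Rightarrow> complex"
  proof -
    have hK: "compact (h ` K)" "h ` K \<subseteq> {w. Re w > - l}"
      using K by (auto intro: compact_continuous_image)
    show "uniform_limit K (\<lambda>n z. V n (h z)) (\<lambda>z. Upsilon \<beta> (h z)) sequentially"
      unfolding V_def \<beta>l by (rule uniform_limit_compose'[OF ab[OF hK]]) auto
    have "bounded (Upsilon \<beta> ` h ` K)"
      unfolding \<beta>l by (intro compact_imp_bounded compact_continuous_image Upsilon_continuous_on[OF l] hK)
    then show "bounded ((\<lambda>z. Upsilon \<beta> (h z)) ` K)" by (simp add: image_image)
  qed
  \<comment> \<open>The alternating sum over the six arguments that occur in the limiting function.\<close>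
  define F where "F n z = V n w1 - V n (w2 z) + V n w3 - V n (w4 z) - V n w5 + V n (w6 z)" for n z
  define \<psi> where "\<psi> z = Upsilon \<beta> w1 - Upsilon \<beta> (w2 z) + Upsilon \<beta> w3 - Upsilon \<beta> (w4 z) - Upsilon \<beta> w5 + Upsilon \<beta> (w6 z)" for z
  have psi: "circular_jacobi_psi \<beta> \<delta> z = exp (\<psi> z)" for z
    by (simp add: circular_jacobi_psi_def \<psi>_def w_defs Let_def l_def)
  have expF: "(\<integral>\<omega>. exp (z * complex_of_real (X n \<omega>)) \<partial>M n) * exp (- of_real (ln (real n) / \<beta>) * z\<^sup>2 / 2) = exp (F n z)"
    if n: "n \<ge> 1" and z: "Re z > - 1 / 3" for n z
  proof -
    let ?T = "ln_Gamma_sum l n" and ?L = "complex_of_real (ln (real n))"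
    have dd: "complex_of_real (2 * Re \<delta>) = \<delta> + cnj \<delta>" by (simp add: complex_eq_iff)
    have s: "Re (of_real (2 * Re \<delta>) :: complex) > -1" "Re (of_real (2 * Re \<delta>) + z) > -1"
      using assms(2) z by simp_all
    have half: "(\<delta> + cnj \<delta>) / 2 + \<i> * of_real (Im \<delta>) = \<delta>" "(\<delta> + cnj \<delta>) / 2 - \<i> * of_real (Im \<delta>) = cnj \<delta>"
      by (simp_all add: complex_eq_iff)
    have args: "1 + (\<delta> + cnj \<delta>) / 2 + \<i> * of_real (Im \<delta>) - of_real l = w1" "1 + (\<delta> + cnj \<delta>) / 2 - \<i> * of_real (Im \<delta>) - of_real l = w3"
      "1 + (\<delta> + cnj \<delta>) - of_real l = w5" "1 + (\<delta> + cnj \<delta> + z) / 2 + \<i> * of_real (Im \<delta>) - of_real l = w2 z"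
      "1 + (\<delta> + cnj \<delta> + z) / 2 - \<i> * of_real (Im \<delta>) - of_real l = w4 z" "1 + (\<delta> + cnj \<delta> + z) - of_real l = w6 z"
      unfolding w_defs by (simp_all add: complex_eq_iff)
    have g0: "line_gamma n l (Im \<delta>) (of_real (2 * Re \<delta>)) = exp (?T w5 - ?T w1 - ?T w3)"
      unfolding line_gamma_eq_exp_ln_Gamma_sums[OF l s(1)] unfolding dd args ..
    have g1: "line_gamma n l (Im \<delta>) (of_real (2 * Re \<delta>) + z) = exp (?T (w6 z) - ?T (w2 z) - ?T (w4 z))"
      unfolding line_gamma_eq_exp_ln_Gamma_sums[OF l s(2)] unfolding dd args ..
    \<comment> \<open>This quadratic expression matches the centering and the Gaussian factor exactly.\<close>
    have squares: "w1\<^sup>2 - (w2 z)\<^sup>2 + w3\<^sup>2 - (w4 z)\<^sup>2 - w5\<^sup>2 + (w6 z)\<^sup>2 = (\<delta> + cnj \<delta>) * z + z\<^sup>2 / 2"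
      unfolding w_defs by (simp add: power2_eq_square algebra_simps add_divide_distrib)
    \<comment> \<open>Constants cancel in \<open>F\<close> because there are three signs of each kind; linear terms cancel by this identity.\<close>
    have linear: "w1 - w2 z + w3 - w4 z - w5 + w6 z = 0"
      unfolding w_defs by simp
    have "F n z = ?T w1 - ?T (w2 z) + ?T w3 - ?T (w4 z) - ?T w5 + ?T (w6 z) - b n * (w1 - w2 z + w3 - w4 z - w5 + w6 z)
        - (w1\<^sup>2 - (w2 z)\<^sup>2 + w3\<^sup>2 - (w4 z)\<^sup>2 - w5\<^sup>2 + (w6 z)\<^sup>2) / of_real (2 * l) * ?L"
      unfolding F_def V_def by (simp add: algebra_simps add_divide_distrib diff_divide_distrib)
    also have "\<dots> = ?T w1 - ?T (w2 z) + ?T w3 - ?T (w4 z) - ?T w5 + ?T (w6 z) - ((\<delta> + cnj \<delta>) * z + z\<^sup>2 / 2) / of_real (2 * l) * ?L"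
      unfolding squares linear by simp
    finally have Fn: "F n z = \<dots>" .
    have c: "complex_of_real (?c n) = (\<delta> + cnj \<delta>) / of_real (2 * l) * ?L"
      unfolding \<beta>l dd[symmetric] by simp
    have "(\<integral>\<omega>. exp (z * complex_of_real (X n \<omega>)) \<partial>M n) * exp (- of_real (ln (real n) / \<beta>) * z\<^sup>2 / 2)
      = exp (- z * of_real (?c n)) * exp (?T (w6 z) - ?T (w2 z) - ?T (w4 z)) / exp (?T w5 - ?T w1 - ?T w3) * exp (- of_real (ln (real n) / \<beta>) * z\<^sup>2 / 2)"
      unfolding mgf(4)[OF n z, folded l_def] g0 g1 ..
    also have "\<dots> = exp (- z * of_real (?c n) + (?T (w6 z) - ?T (w2 z) - ?T (w4 z)) - (?T w5 - ?T w1 - ?T w3) + (- of_real (ln (real n) / \<beta>) * z\<^sup>2 / 2))"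
      by (simp only: exp_add exp_diff)
    also have "\<dots> = exp (F n z)"
    proof (rule arg_cong[where f = exp])
      have "complex_of_real (ln (real n) / \<beta>) = ?L / of_real (2 * l)" unfolding \<beta>l by simp
      then show "- z * of_real (?c n) + (?T (w6 z) - ?T (w2 z) - ?T (w4 z)) - (?T w5 - ?T w1 - ?T w3) + (- of_real (ln (real n) / \<beta>) * z\<^sup>2 / 2) = F n z"
        unfolding Fn c using lc by (simp only:) (simp add: field_simps)
    qed
    finally show ?thesis .
  qed
  have unif: "uniform_limit K (\<lambda>n z. (\<integral>\<omega>. exp (z * complex_of_real (X n \<omega>)) \<partial>M n) * exp (- of_real (ln (real n) / \<beta>) * z\<^sup>2 / 2))
          (circular_jacobi_psi \<beta> \<delta>) sequentially"
    if K: "compact K" "K \<subseteq> strip (- 1 / 3) \<infinity>" for K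
  proof -
    have z: "Re z > - 1 / 3" if "z \<in> K" for z using K that strip_one_third by blast
    have Re_w: "Re w1 > - l" "Re w3 > - l" "Re w5 > - l" using assms(2) by (simp_all add: w_defs)
    have Re_wz: "Re (w2 x) > - l" "Re (w4 x) > - l" "Re (w6 x) > - l" if "x \<in> K" for x
      using assms(2) z[OF that] by (simp_all add: w_defs)
    have cont: "continuous_on K w2" "continuous_on K w4" "continuous_on K w6"
      unfolding w2_def[abs_def] w4_def[abs_def] w6_def[abs_def] by (intro continuous_intros; simp)+
    note lims = limit_V[OF K(1) continuous_on_const Re_w(1)] limit_V[OF K(1) continuous_on_const Re_w(2)]
      limit_V[OF K(1) continuous_on_const Re_w(3)] limit_V[OF K(1) cont(1) Re_wz(1)] limit_V[OF K(1) cont(2) Re_wz(2)]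
      limit_V[OF K(1) cont(3) Re_wz(3)]
    have "uniform_limit K F \<psi> sequentially"
      unfolding F_def[abs_def] \<psi>_def[abs_def] by (intro uniform_limit_add uniform_limit_minus lims)
    moreover have "bounded (\<psi> ` K)"
      unfolding \<psi>_def[abs_def] by (intro bounded_plus_comp bounded_minus_comp lims)
    ultimately have "uniform_limit K (\<lambda>n z. exp (F n z)) (\<lambda>z. exp (\<psi> z)) sequentially"
      by (rule uniform_limit_exp)
    then show ?thesis
    proof (rule uniform_limit_cong[THEN iffD1, rotated 2])
      show "\<forall>\<^sub>F n in sequentially. \<forall>z\<in>K. exp (F n z) = (\<integral>\<omega>. exp (z * complex_of_real (X n \<omega>)) \<partial>M n) * exp (- of_real (ln (real n) / \<beta>) * z\<^sup>2 / 2)"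
        using eventually_ge_at_top[of 1] by eventually_elim (use expF z in auto)
    qed (simp add: psi)
  qed
  have t: "filterlim (\<lambda>n. ln (real n) / \<beta>) at_top sequentially"
    using assms(1) by real_asymp
  have lt: "(- 1 / 3 :: ereal) < 0"
  proof -
    have "(- 1 / 3 :: ereal) = ereal (- 1) / ereal 3"
      by (simp add: one_ereal_def)
    then show ?thesis by simp
  qed
  show ?thesis
    unfolding mod_gaussian_convergent_def
    using mgf(1-3) unif t lt strip_one_third by auto
qed

end
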